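(* Let $d\geq 2$ be an integer and set $m:=3d-2$. For each $j=1,\dots,d-1$ let $u_j,v_j,w_j\in\mathbb{C}$ be complex numbers that do not lie on a common real line in $\mathbb{C}$. Consider the polynomials in $\mathbb{C}[z_1,\dots,z_d]$ $$f_{3j-2}(z)=z_j+u_j,\quad f_{3j-1}(z)=z_j+v_j,\quad f_{3j}(z)=z_j+w_j\qquad (j=1,\dots,d-1),\qquad f_{3d-2}(z)=z_d .$$ Then the complex $*$-algebra $$A:=\mathbb{C}\big[z_1,\dots,z_d,\overline{z_1},\dots,\overline{z_d},f_1^{-1},\dots,f_m^{-1},(\overline{f_1})^{-1},\dots,(\overline{f_m})^{-1}\big]$$ has the moment property.
   Context: $\mathbb{C}[z_1,\dots,z_d,\overline{z_1},\dots,\overline{z_d}]$ is the unital commutative complex $*$-algebra of polynomials in the $2d$ independent variables $z_j,\overline{z_j}$, with (conjugate-linear) involution $p\mapsto p^*$ determined by $z_j^*=\overline{z_j}$; for a polynomial $f$ in it write $\overline{f}:=f^*$. The algebra $A$ is the subalgebra of its field of fractions generated by it and by the listed inverses, with the extended involution. For a finitely generated commutative unital complex $*$-algebra $A$, a character is a unital $*$-homomorphism $A\to\mathbb{C}$, and $\widehat{A}$ denotes the set of characters. A finite set of generators identifies $\widehat A$ with a closed subset of some $\mathbb{C}^N$ (a character being identified with its values on the generators), so $\widehat A$ is a locally compact Hausdorff space and elements $f\in A$ are continuous functions on it, $f(\chi):=\chi(f)$. For the algebra $A$ of the claim, $\widehat A$ consists of the point evaluations at the points of $\{z\in\mathbb{C}^d: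 f_j(z)\neq 0,\ j=1,\dots,m\}$. A linear functional $L:A\to\mathbb{C}$ is positive if $L(a^*a)\geq 0$ for all $a\in A$. It is a moment functional if there is a (positive) Radon measure $\mu$ on $\widehat A$ such that every $f\in A$ is $\mu$-integrable and $L(f)=\int_{\widehat A} f\,d\mu$ for all $f\in A$. The $*$-algebra $A$ has the moment property if every positive linear functional on $A$ is a moment functional. *)

theory Defs
  imports
    "HOL-Analysis.Analysis"
    "HOL-Library.Poly_Mapping"
    "HOL-Computational_Algebra.Polynomial_Factorial"
begin

section \<open>Commutative complex $*$-algebras and the moment property\<close>

text \<open>
  A commutative unital complex \<open>*\<close>-algebra is given by a carrier \<open>A\<close> inside a commutative ring,
  together with the unital ring homomorphism \<open>sc\<close> embedding the scalars (so that \<open>c \<cdot> a\<close> is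
  \<open>sc c * a\<close>) and the involution \<open>star\<close>.
\<close>

locale comm_star_algebra =
  fixes sc :: "complex \<Rightarrow> 'a::comm_ring_1"
    and star :: "'a \<Rightarrow> 'a"
    and A :: "'a set"
  assumes sc_one: "sc 1 = 1"
    and sc_add: "sc (b + c) = sc b + sc c"
    and sc_mult: "sc (b * c) = sc b * sc c"
    and sc_closed: "sc c \<in> A"
    and add_closed: "x \<in> A \<Longrightarrow> y \<in> A \<Longrightarrow> x + y \<in> A"
    and mult_closed: "x \<in> A \<Longrightarrow> y \<in> A \<Longrightarrow> x * y \<in> A"
    and star_closed: "x \<in> A \<Longrightarrow> star x \<in> A"
    and star_add: "x \<in> A \<Longrightarrow> y \<in> A \<Longrightarrow> star (x + y) = star x + star y"
    and star_mult: "x \<in> A \<Longrightarrow> y \<in> A \<Longrightarrow> star (x * y) = star x * star y"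
    and star_sc: "star (sc c) = sc (cnj c)"
    and star_star: "x \<in> A \<Longrightarrow> star (star x) = x"

inductive_set generated_subalgebra :: "(complex \<Rightarrow> 'a::comm_ring_1) \<Rightarrow> 'a set \<Rightarrow> 'a set"
  for sc :: "complex \<Rightarrow> 'a" and G :: "'a set"
where
  scalar: "sc c \<in> generated_subalgebra sc G"
| generator: "g \<in> G \<Longrightarrow> g \<in> generated_subalgebra sc G"
| add: "x \<in> generated_subalgebra sc G \<Longrightarrow> y \<in> generated_subalgebra sc G
    \<Longrightarrow> x + y \<in> generated_subalgebra sc G"
| mult: "x \<in> generated_subalgebra sc G \<Longrightarrow> y \<in> generated_subalgebra sc G
    \<Longrightarrow> x * y \<in> generated_subalgebra sc G"

definition radon_measure :: "'b topology \<Rightarrow> 'b measure \<Rightarrow> bool" where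
  "radon_measure X M \<longleftrightarrow>
     space M = topspace X \<and>
     sets M = sigma_sets (topspace X) {U. openin X U} \<and>
     (\<forall>K. compactin X K \<longrightarrow> emeasure M K < \<infinity>) \<and>
     (\<forall>B\<in>sets M. emeasure M B = (SUP K\<in>{K. compactin X K \<and> K \<subseteq> B}. emeasure M K))"

lemma continuous_map_mult:
  fixes f g :: "'b \<Rightarrow> complex"
  assumes "continuous_map X euclidean f" "continuous_map X euclidean g"
  shows "continuous_map X euclidean (\<lambda>x. f x * g x)"
  using assms by (simp add: continuous_map_atin tendsto_mult)

context comm_star_algebra
begin

definition linear_functional :: "('a \<Rightarrow> complex) \<Rightarrow> bool" where
  "linear_functional L \<longleftrightarrow>
     (\<forall>x\<in>A. \<forall>y\<in>A. L (x + y) = L x + L y) \<and> (\<forall>c. \<forall>x\<in>A. L (sc c * x) = c * L x)"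

definition positive_functional :: "('a \<Rightarrow> complex) \<Rightarrow> bool" where
  "positive_functional L \<longleftrightarrow> linear_functional L \<and> (\<forall>a\<in>A. L (star a * a) \<in> \<real>\<^sub>\<ge>\<^sub>0)"

text \<open>
  Membership in \<open>extensional A\<close> fixes the values outside \<open>A\<close>, so that each character of \<open>A\<close> is
  represented by exactly one function.
\<close>

definition characters :: "('a \<Rightarrow> complex) set" where
  "characters = {\<phi> \<in> extensional A. linear_functional \<phi> \<and> \<phi> 1 = 1 \<and>
     (\<forall>x\<in>A. \<forall>y\<in>A. \<phi> (x * y) = \<phi> x * \<phi> y) \<and> (\<forall>x\<in>A. \<phi> (star x) = cnj (\<phi> x))}"

text \<open>
  The topology of pointwise convergence on \<open>A\<close>.  By \<open>character_topology_generators\<close> below it is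
  the topology obtained by identifying a character with its tuple of values on any
  generating set.
\<close>

definition character_topology :: "('a \<Rightarrow> complex) topology" where
  "character_topology = subtopology (product_topology (\<lambda>_. euclidean) A) characters"

definition moment_functional :: "('a \<Rightarrow> complex) \<Rightarrow> bool" where
  "moment_functional L \<longleftrightarrow>
     (\<exists>M. radon_measure character_topology M \<and>
       (\<forall>a\<in>A. integrable M (\<lambda>\<phi>. \<phi> a) \<and> L a = (\<integral>\<phi>. \<phi> a \<partial>M)))"

definition moment_property :: bool where
  "moment_property \<longleftrightarrow> (\<forall>L. positive_functional L \<longrightarrow> moment_functional L)"

lemma topspace_character_topology: "topspace character_topology = characters"
  by (auto simp: character_topology_def characters_def PiE_def)

lemma character_topology_generators:
  assumes gen: "A = generated_subalgebra sc G"
  shows "character_topology =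
    pullback_topology characters (\<lambda>\<phi>. restrict \<phi> G) (product_topology (\<lambda>_. euclidean) G)"
    (is "_ = ?P")
proof -
  have tP: "topspace ?P = characters"
    by (auto simp: topspace_pullback_topology)
  have ext: "\<phi> \<in> extensional A" if "\<phi> \<in> characters" for \<phi>
    using that by (simp add: characters_def)
  have GA: "G \<subseteq> A"
    using gen by (auto intro: generated_subalgebra.generator)
  have one: "1 \<in> A"
    using sc_closed[of 1] sc_one by simp
  have "continuous_map ?P euclidean (\<lambda>\<phi>. \<phi> a)" if "a \<in> generated_subalgebra sc G" for a
    using that
  proof (induction rule: generated_subalgebra.induct)
    case (scalar c)
    have "\<phi> (sc c) = c" if "\<phi> \<in> characters" for \<phi>
    proof -
      have "\<phi> (sc c * 1) = c * \<phi> 1" "\<phi> 1 = 1"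
        using that one unfolding characters_def linear_functional_def by blast+
      then show ?thesis by simp
    qed
    moreover have "continuous_map ?P euclidean (\<lambda>_. c)"
      by simp
    ultimately show ?case
      by (elim continuous_map_eq) (metis tP)
  next
    case (generator g)
    have "continuous_map (product_topology (\<lambda>_. euclidean) G) euclidean (\<lambda>x. x g :: complex)"
      using generator by (rule continuous_map_product_projection)
    from continuous_map_pullback[OF this, of characters "\<lambda>\<phi>. restrict \<phi> G"]
    show ?case by (rule continuous_map_eq) (simp add: generator)
  next
    case (add x y)
    have "x \<in> A" "y \<in> A"
      using add.hyps by (simp_all only: gen)
    then have "\<phi> (x + y) = \<phi> x + \<phi> y" if "\<phi> \<in> characters" for \<phi>
      using that by (simp add: characters_def linear_functional_def)
    moreover have "continuous_map ?P euclidean (\<lambda>\<phi>. \<phi> x + \<phi> y)"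
      using add.IH by (rule continuous_map_add)
    ultimately show ?case
      by (elim continuous_map_eq) (simp add: tP)
  next
    case (mult x y)
    have "x \<in> A" "y \<in> A"
      using mult.hyps by (simp_all only: gen)
    then have "\<phi> (x * y) = \<phi> x * \<phi> y" if "\<phi> \<in> characters" for \<phi>
      using that by (simp add: characters_def)
    moreover have "continuous_map ?P euclidean (\<lambda>\<phi>. \<phi> x * \<phi> y)"
      using mult.IH by (rule continuous_map_mult)
    ultimately show ?case
      by (elim continuous_map_eq) (simp add: tP)
  qed
  then have ev: "continuous_map ?P euclidean (\<lambda>\<phi>. \<phi> a)" if "a \<in> A" for a
    using that gen by simp
  have "continuous_map ?P character_topology (\<lambda>\<phi>. \<phi>)"
    unfolding character_topology_def continuous_map_in_subtopology continuous_map_componentwise tP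
    using ev by (auto simp: ext)
  moreover have "continuous_map character_topology ?P (\<lambda>\<phi>. \<phi>)"
  proof (rule continuous_map_pullback')
    show "continuous_map character_topology (product_topology (\<lambda>_. euclidean) G)
        ((\<lambda>\<phi>. restrict \<phi> G) \<circ> (\<lambda>\<phi>. \<phi>))"
      unfolding character_topology_def
      using GA by (auto simp: continuous_map_componentwise o_def
          intro!: continuous_map_from_subtopology continuous_map_product_projection)
  qed (simp add: topspace_character_topology)
  ultimately have "homeomorphic_maps ?P character_topology id id"
    by (simp add: homeomorphic_maps_def id_def)
  then show ?thesis
    by (simp only: homeomorphic_maps_id)
qed

end

section \<open>Polynomials in $z_j, \overline{z_j}$ and their fractions\<close>

text \<open>
  Polynomials in countably many variables indexed by \<open>nat\<close>: a monomial is a finitely supported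
  exponent function.  The index \<open>2 * j\<close> stands for \<open>z\<^sub>j\<close>, the index \<open>2 * j + 1\<close> for its conjugate.
\<close>

type_synonym cpoly = "(nat \<Rightarrow>\<^sub>0 nat) \<Rightarrow>\<^sub>0 complex"

definition pconst :: "complex \<Rightarrow> cpoly" where
  "pconst c = Poly_Mapping.single 0 c"

definition zvar :: "nat \<Rightarrow> cpoly" where
  "zvar j = Poly_Mapping.single (Poly_Mapping.single (2 * j) 1) 1"

definition zbar :: "nat \<Rightarrow> cpoly" where
  "zbar j = Poly_Mapping.single (Poly_Mapping.single (2 * j + 1) 1) 1"

definition swap_index :: "nat \<Rightarrow> nat" where
  "swap_index n = (if even n then n + 1 else n - 1)"

definition swap_monom :: "(nat \<Rightarrow>\<^sub>0 nat) \<Rightarrow> (nat \<Rightarrow>\<^sub>0 nat)" where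
  "swap_monom = Poly_Mapping.map_key swap_index"

text \<open>
  Conjugate the coefficients and exchange each variable with its conjugate; as
  \<open>swap_monom\<close> is its own inverse, precomposition with it is the same as pushing forward.
\<close>

definition poly_star :: "cpoly \<Rightarrow> cpoly" where
  "poly_star p = Poly_Mapping.map cnj (Poly_Mapping.map_key swap_monom p)"

lemma swap_index_invol [simp]: "swap_index (swap_index n) = n"
  by (auto simp: swap_index_def)

lemma inj_swap_index: "inj swap_index"
  by (metis injI swap_index_invol)

lemma lookup_swap_monom: "Poly_Mapping.lookup (swap_monom m) i = Poly_Mapping.lookup m (swap_index i)"
  by (simp add: swap_monom_def map_key.rep_eq inj_swap_index)

lemma swap_monom_invol [simp]: "swap_monom (swap_monom m) = m"
  by (rule poly_mapping_eqI) (simp add: lookup_swap_monom)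

lemma inj_swap_monom: "inj swap_monom"
  by (metis injI swap_monom_invol)

lemma swap_monom_add: "swap_monom (m + n) = swap_monom m + swap_monom n"
  by (rule poly_mapping_eqI) (simp add: lookup_swap_monom lookup_add)

lemma swap_monom_0 [simp]: "swap_monom 0 = 0"
  by (rule poly_mapping_eqI) (simp add: lookup_swap_monom)

lemma swap_monom_single [simp]:
  "swap_monom (Poly_Mapping.single i k) = Poly_Mapping.single (swap_index i) k"
  by (rule poly_mapping_eqI)
    (auto simp: lookup_swap_monom lookup_single when_def)

lemma lookup_poly_star: "Poly_Mapping.lookup (poly_star p) m = cnj (Poly_Mapping.lookup p (swap_monom m))"
  by (simp add: poly_star_def map.rep_eq map_key.rep_eq inj_swap_monom when_def)

lemma poly_star_invol [simp]: "poly_star (poly_star p) = p"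
  by (rule poly_mapping_eqI) (simp add: lookup_poly_star)

lemma poly_star_0 [simp]: "poly_star 0 = 0"
  by (rule poly_mapping_eqI) (simp add: lookup_poly_star)

lemma poly_star_eq_0_iff [simp]: "poly_star p = 0 \<longleftrightarrow> p = 0"
  by (metis poly_star_0 poly_star_invol)

lemma poly_star_add: "poly_star (p + q) = poly_star p + poly_star q"
  by (rule poly_mapping_eqI) (simp add: lookup_poly_star lookup_add)

lemma poly_star_single:
  "poly_star (Poly_Mapping.single m c) = Poly_Mapping.single (swap_monom m) (cnj c)"
  by (rule poly_mapping_eqI) (auto simp: lookup_poly_star lookup_single when_def)

lemma poly_star_sum: "poly_star (\<Sum>i\<in>I. p i) = (\<Sum>i\<in>I. poly_star (p i))"
  by (induction I rule: infinite_finite_induct) (auto simp: poly_star_add)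

lemma cpoly_eq_sum_single:
  fixes p :: cpoly
  shows "p = (\<Sum>m\<in>Poly_Mapping.keys p. Poly_Mapping.single m (Poly_Mapping.lookup p m))"
  by (rule poly_mapping_eqI) (auto simp: lookup_sum lookup_single when_def in_keys_iff)

lemma poly_star_mult: "poly_star (p * q) = poly_star p * poly_star q"
proof -
  have "poly_star ((\<Sum>m\<in>I. Poly_Mapping.single m (a m)) * (\<Sum>n\<in>J. Poly_Mapping.single n (b n))) =
      poly_star (\<Sum>m\<in>I. Poly_Mapping.single m (a m)) * poly_star (\<Sum>n\<in>J. Poly_Mapping.single n (b n))"
    for I a J b
    by (simp add: sum_product mult_single poly_star_sum poly_star_single swap_monom_add)
  from this[where I = "Poly_Mapping.keys p" and a = "Poly_Mapping.lookup p"
      and J = "Poly_Mapping.keys q" and b = "Poly_Mapping.lookup q"]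
  show ?thesis
    by (simp only: cpoly_eq_sum_single[symmetric])
qed

lemma poly_star_pconst: "poly_star (pconst c) = pconst (cnj c)"
  by (simp add: pconst_def poly_star_single)

lemma poly_star_zvar: "poly_star (zvar j) = zbar j"
  by (simp add: zvar_def zbar_def poly_star_single swap_index_def)

lemma poly_star_zbar: "poly_star (zbar j) = zvar j"
  by (metis poly_star_invol poly_star_zvar)

type_synonym cfrac = "cpoly fract"

definition fconst :: "complex \<Rightarrow> cfrac" where
  "fconst c = to_fract (pconst c)"

definition fract_star :: "cfrac \<Rightarrow> cfrac" where
  "fract_star x =
     (THE y. \<exists>p q. q \<noteq> 0 \<and> x = Fract p q \<and> y = Fract (poly_star p) (poly_star q))"

lemma fract_star_Fract:
  "fract_star (Fract p q) = Fract (poly_star p) (poly_star q)"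
proof -
  have *: "fract_star (Fract a b) = Fract (poly_star a) (poly_star b)" if b: "b \<noteq> 0" for a b
    unfolding fract_star_def
  proof (rule the_equality)
    fix y
    assume "\<exists>p q. q \<noteq> 0 \<and> Fract a b = Fract p q \<and> y = Fract (poly_star p) (poly_star q)"
    then obtain p q where "q \<noteq> 0" "a * q = p * b" "y = Fract (poly_star p) (poly_star q)"
      using b by (auto simp: eq_fract)
    then show "y = Fract (poly_star a) (poly_star b)"
      using b by (simp add: eq_fract flip: poly_star_mult)
  qed (use b in blast)
  show ?thesis
  proof (cases "q = 0")
    case True
    then have "Fract p q = Fract 0 1" "Fract (poly_star p) (poly_star q) = Fract 0 1"
      by (simp_all add: eq_fract)
    with *[of 1 0] show ?thesis
      by (simp add: eq_fract)
  qed (rule *)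
qed

text \<open>
  The algebra \<open>\<complex>[z\<^sub>1,\<dots>,z\<^sub>d, z\<^sub>1\<^sup>*,\<dots>,z\<^sub>d\<^sup>*, f\<^sub>1\<^sup>-\<^sup>1,\<dots>,f\<^sub>m\<^sup>-\<^sup>1, (f\<^sub>1\<^sup>*)\<^sup>-\<^sup>1,\<dots>,(f\<^sub>m\<^sup>*)\<^sup>-\<^sup>1]\<close> inside the field of fractions.
\<close>

definition frac_generators :: "nat \<Rightarrow> nat \<Rightarrow> (nat \<Rightarrow> cpoly) \<Rightarrow> cfrac set" where
  "frac_generators d m f =
     (\<lambda>j. to_fract (zvar j)) ` {1..d} \<union> (\<lambda>j. to_fract (zbar j)) ` {1..d} \<union>
     (\<lambda>k. inverse (to_fract (f k))) ` {1..m} \<union>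
     (\<lambda>k. inverse (to_fract (poly_star (f k)))) ` {1..m}"

definition frac_algebra :: "nat \<Rightarrow> nat \<Rightarrow> (nat \<Rightarrow> cpoly) \<Rightarrow> cfrac set" where
  "frac_algebra d m f = generated_subalgebra fconst (frac_generators d m f)"

lemma fract_star_to_fract: "fract_star (to_fract p) = to_fract (poly_star p)"
proof -
  have "poly_star 1 = 1"
    using poly_star_pconst[of 1] by (simp add: pconst_def)
  then show ?thesis
    by (simp add: to_fract_def fract_star_Fract)
qed

lemma fract_star_add: "fract_star (x + y) = fract_star x + fract_star y"
  by (cases x; cases y) (simp add: fract_star_Fract poly_star_add poly_star_mult)

lemma fract_star_mult: "fract_star (x * y) = fract_star x * fract_star y"
  by (cases x; cases y) (simp add: fract_star_Fract poly_star_mult)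

lemma fract_star_inverse: "fract_star (inverse x) = inverse (fract_star x)"
  by (cases x) (simp add: fract_star_Fract)

lemma fract_star_invol: "fract_star (fract_star x) = x"
  by (cases x) (simp add: fract_star_Fract)

lemma fract_star_frac_generators:
  "g \<in> frac_generators d m f \<Longrightarrow> fract_star g \<in> frac_generators d m f"
  by (auto simp: frac_generators_def fract_star_inverse fract_star_to_fract
      poly_star_zvar poly_star_zbar)

lemma fract_star_fconst: "fract_star (fconst c) = fconst (cnj c)"
  by (simp add: fconst_def fract_star_to_fract poly_star_pconst)

lemma fconst_1: "fconst 1 = 1"
  by (simp add: fconst_def pconst_def)

lemma fconst_add: "fconst (b + c) = fconst b + fconst c"
  by (simp add: fconst_def pconst_def single_add)

lemma fconst_mult: "fconst (b * c) = fconst b * fconst c"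
  by (simp add: fconst_def pconst_def mult_single flip: to_fract_mult)

lemma comm_star_algebra_frac_algebra:
  "comm_star_algebra fconst fract_star (frac_algebra d m f)"
proof
  show "fract_star x \<in> frac_algebra d m f" if "x \<in> frac_algebra d m f" for x
    using that unfolding frac_algebra_def
    by induction (auto simp: fract_star_add fract_star_mult fract_star_fconst
        fract_star_frac_generators intro: generated_subalgebra.intros)
qed (auto simp: frac_algebra_def fconst_1 fconst_add fconst_mult fract_star_add fract_star_mult
    fract_star_invol fract_star_fconst intro: generated_subalgebra.intros)

end

theory Submission
  imports Defs "HOL-Probability.Probability" "HOL-Computational_Algebra.Fundamental_Theorem_Algebra"
begin

text \<open>
  For every generator \<open>f\<close> that is inverted, the phase \<open>f\<^sup>* / f\<close> is a unitary element of the algebra.  A positive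
  functional that is negative at some \<open>h\<close> can be replaced by one on an extreme ray of the cone of positive
  functionals that is still negative at \<open>h\<close>; on an extreme ray every unitary acts as a scalar.  So the phases of
  \<open>z\<^sub>j + u\<^sub>j\<close>, \<open>z\<^sub>j + v\<^sub>j\<close>, \<open>z\<^sub>j + w\<^sub>j\<close> become constants: \<open>z\<^sub>j\<close> lies on three given lines through \<open>-u\<^sub>j\<close>, \<open>-v\<^sub>j\<close>,
  \<open>-w\<^sub>j\<close>, which cannot all coincide, and hence \<open>z\<^sub>j\<close> is constant for \<open>j < d\<close>.  The phase of \<open>z\<^sub>d\<close> leaves one
  hermitian invertible coordinate \<open>r\<close>, and a Laurent polynomial in \<open>r\<close> that is nonnegative on the punctured line is a
  hermitian square.  Therefore positive functionals are nonnegative at all elements that are nonnegative on the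
  characters, and Haviland's theorem provides the measure.

  Haviland's theorem is obtained by extending the functional to all functions dominated by the algebra and
  parametrising the characters by a space-filling curve; on the real line, Helly's selection theorem yields a
  representing measure, and it is transported back along the curve.
\<close>

section \<open>Positive functionals on extreme rays\<close>

text \<open>Only one real parameter may survive the reduction: on the line nonnegative polynomials
  are hermitian squares, whereas in two real variables they need not be sums of squares. Hence all
  coordinates but the last must be frozen, and three shifts achieve this: one phase leaves a real
  line, two shifts can share the line through both points, but three noncollinear points share none.
  The cone of positive functionals need not have a compact base, so the extreme ray is sought in a
  compact cap containing a multiple of the given functional; minimising at \<open>h\<close> keeps
  the value negative and pushes the minimiser to the boundary of the cap. A unitary \<open>u\<close>
  then acts as a scalar because \<open>star (1 + u) * (1 + u) + star (1 - u) * (1 - u) = 4\<close>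
  splits the functional into two positive summands. In Haviland's theorem the obstacles are that
  elements of the algebra are unbounded on the characters and that mass could escape to infinity.
  One element of the algebra handles both: a constant plus the sum of the squared generators, which
  dominates every generator.\<close>

lemma exists_unimodular: "\<exists>c::complex. cmod c = 1 \<and> c * z = of_real (cmod z)"
proof (cases "z = 0")
  case False
  then show ?thesis
    by (intro exI[of _ "cnj z / of_real (cmod z)"])
      (simp add: norm_divide divide_simps, simp add: complex_norm_square[symmetric] power2_eq_square[symmetric] mult.commute[of "cnj z"])
qed (auto intro: exI[of _ 1])

context comm_star_algebra
begin

lemma sc_0 [simp]: "sc 0 = 0"
  using sc_add[of 0 0] by simp

lemma sc_minus: "sc (- c) = - sc c"
  using sc_add[of c "- c"] by (simp add: add_eq_0_iff)

lemma sc_diff: "sc (b - c) = sc b - sc c"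
  using sc_add[of b "- c"] by (simp add: sc_minus)

lemma one_closed: "1 \<in> A"
  using sc_closed[of 1] sc_one by simp

lemma zero_closed: "0 \<in> A"
  using sc_closed[of 0] by simp

lemma uminus_closed: "x \<in> A \<Longrightarrow> - x \<in> A"
  using mult_closed[OF sc_closed[of "-1"], of x] by (simp add: sc_minus sc_one)

lemma diff_closed: "x \<in> A \<Longrightarrow> y \<in> A \<Longrightarrow> x - y \<in> A"
  using add_closed[of x "- y"] uminus_closed[of y] by simp

lemma sum_closed: "(\<And>i. i \<in> I \<Longrightarrow> x i \<in> A) \<Longrightarrow> sum x I \<in> A"
  by (induction I rule: infinite_finite_induct) (auto simp: zero_closed add_closed)

lemma power_closed: "x \<in> A \<Longrightarrow> x ^ n \<in> A"
  by (induction n) (auto simp: one_closed mult_closed)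

lemmas closed = sc_closed add_closed mult_closed star_closed one_closed zero_closed
  uminus_closed diff_closed power_closed

lemma star_one [simp]: "star 1 = 1"
  using star_sc[of 1] by (simp add: sc_one)

lemma star_zero [simp]: "star 0 = 0"
  using star_sc[of 0] by simp

lemma star_uminus: "x \<in> A \<Longrightarrow> star (- x) = - star x"
  using star_mult[OF sc_closed[of "-1"], of x] star_sc[of "-1"] by (simp add: sc_minus sc_one)

lemma lin_add: "linear_functional L \<Longrightarrow> x \<in> A \<Longrightarrow> y \<in> A \<Longrightarrow> L (x + y) = L x + L y"
  by (simp add: linear_functional_def)

lemma lin_scale: "linear_functional L \<Longrightarrow> x \<in> A \<Longrightarrow> L (sc c * x) = c * L x"
  by (simp add: linear_functional_def)

lemma lin_sc: "linear_functional L \<Longrightarrow> L (sc c) = c * L 1"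
  using lin_scale[of L 1 c] by (simp add: one_closed)

lemma lin_zero: "linear_functional L \<Longrightarrow> L 0 = 0"
  using lin_sc[of L 0] by simp

lemma lin_uminus: "linear_functional L \<Longrightarrow> x \<in> A \<Longrightarrow> L (- x) = - L x"
  using lin_scale[of L x "-1"] by (simp add: sc_minus sc_one)

lemma lin_diff: "linear_functional L \<Longrightarrow> x \<in> A \<Longrightarrow> y \<in> A \<Longrightarrow> L (x - y) = L x - L y"
  using lin_add[of L x "- y"] lin_uminus[of L y] uminus_closed[of y] by simp

lemma pos_lin: "positive_functional L \<Longrightarrow> linear_functional L"
  by (simp add: positive_functional_def)

lemma pos_square: "positive_functional L \<Longrightarrow> a \<in> A \<Longrightarrow> L (star a * a) \<in> \<real>\<^sub>\<ge>\<^sub>0"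
  by (simp add: positive_functional_def)

lemma square_one_plus:
  assumes L: "linear_functional L" and a: "a \<in> A"
  shows "L (star (1 + sc c * a) * (1 + sc c * a)) =
    L 1 + c * L a + cnj c * L (star a) + cnj c * c * L (star a * a)"
proof -
  have "star (1 + sc c * a) * (1 + sc c * a)
      = 1 + sc c * a + sc (cnj c) * star a + sc (cnj c * c) * (star a * a)"
    using a by (simp add: star_add star_mult star_sc closed sc_mult algebra_simps)
  then show ?thesis
    using a L by (simp add: lin_add lin_scale closed)
qed

text \<open>Hermiticity is not part of positivity but follows from it: in the expansion of the
  square of \<open>1 + sc c * a\<close> the outer terms are real, so the cross terms add up to a
  real number. The case \<open>c = 1\<close> settles the imaginary parts, \<open>c = \<i>\<close>
  the real parts.\<close>

lemma pos_star:
  assumes L: "positive_functional L" and a: "a \<in> A"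
  shows "L (star a) = cnj (L a)"
proof -
  have "L (star (1 + sc c * a) * (1 + sc c * a)) \<in> \<real>\<^sub>\<ge>\<^sub>0" for c
    by (intro pos_square[OF L] closed a)
  then have *: "L 1 + c * L a + cnj c * L (star a) + cnj c * c * L (star a * a) \<in> \<real>\<^sub>\<ge>\<^sub>0" for c
    using square_one_plus[OF pos_lin[OF L] a] by simp
  have "L 1 \<in> \<real>\<^sub>\<ge>\<^sub>0" "L (star a * a) \<in> \<real>\<^sub>\<ge>\<^sub>0"
    using pos_square[OF L one_closed] pos_square[OF L a] by simp_all
  then show ?thesis
    using *[of 1] *[of \<i>] by (simp add: complex_nonneg_Reals_iff complex_eq_iff)
qed

text \<open>An additive form of Cauchy-Schwarz: positivity at \<open>1 - sc c * a\<close>, where the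
  unimodular \<open>c\<close> rotates \<open>L a\<close> to its modulus. The right-hand side is
  linear in \<open>L\<close>, so bounds on diagonal values bound all values at once.\<close>

lemma pos_bound:
  assumes L: "positive_functional L" and a: "a \<in> A"
  shows "2 * cmod (L a) \<le> Re (L 1) + Re (L (star a * a))"
proof -
  obtain c where c: "cmod c = 1" "c * L a = of_real (cmod (L a))"
    using exists_unimodular by blast
  have cc: "cnj c * c = 1"
    using c(1) by (simp add: complex_norm_square[symmetric] mult.commute)
  have "L (star (1 + sc (- c) * a) * (1 + sc (- c) * a)) \<in> \<real>\<^sub>\<ge>\<^sub>0"
    by (intro pos_square[OF L] closed a)
  then have "Re (L 1 + (- c) * L a + cnj (- c) * L (star a) + cnj (- c) * (- c) * L (star a * a)) \<ge> 0"
    using square_one_plus[OF pos_lin[OF L] a, of "- c"] by (simp add: complex_nonneg_Reals_iff)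
  moreover have "- c * L a = - of_real (cmod (L a))"
    using c(2) by simp
  moreover have "cnj (- c) * L (star a) = - of_real (cmod (L a))"
    using arg_cong[OF c(2), of cnj] by (simp add: pos_star[OF L a])
  moreover have "cnj (- c) * (- c) = 1"
    using cc by simp
  ultimately have "Re (L 1 + - of_real (cmod (L a)) + - of_real (cmod (L a)) + 1 * L (star a * a)) \<ge> 0"
    by (simp only:)
  then show ?thesis by simp
qed

end

section \<open>Countable spanning sequences\<close>

inductive_set scalar_span :: "(complex \<Rightarrow> 'a::comm_ring_1) \<Rightarrow> 'a set \<Rightarrow> 'a set"
  for sc :: "complex \<Rightarrow> 'a" and B :: "'a set"
where
  scale: "b \<in> B \<Longrightarrow> sc c * b \<in> scalar_span sc B"
| add: "x \<in> scalar_span sc B \<Longrightarrow> y \<in> scalar_span sc B \<Longrightarrow> x + y \<in> scalar_span sc B"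

context comm_star_algebra
begin

lemma scalar_span_mult:
  assumes B: "\<And>b b'. b \<in> B \<Longrightarrow> b' \<in> B \<Longrightarrow> b * b' \<in> B"
    and x: "x \<in> scalar_span sc B" and y: "y \<in> scalar_span sc B"
  shows "x * y \<in> scalar_span sc B"
  using x
proof (induction rule: scalar_span.induct)
  case (scale b c)
  from y show ?case
  proof (induction rule: scalar_span.induct)
    case (scale b' d)
    have "sc c * b * (sc d * b') = sc (c * d) * (b * b')"
      by (simp add: sc_mult algebra_simps)
    then show ?case using scalar_span.scale[OF B[OF \<open>b \<in> B\<close> scale]] by simp
  qed (auto simp: algebra_simps intro: scalar_span.add)
qed (auto simp: algebra_simps intro: scalar_span.add)

text \<open>Words in the generators span the algebra and are countable in number. The sequence lists
  \<open>1\<close> ahead of an enumeration of all words, because the bound on \<open>L a\<close>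
  also involves \<open>L 1\<close>.\<close>

lemma generated_spanning_sequence:
  assumes A: "A = generated_subalgebra sc G" and G: "countable G"
  obtains b :: "nat \<Rightarrow> 'a" where "range b \<subseteq> A" "b 0 = 1" "A \<subseteq> scalar_span sc (range b)"
proof -
  define B where "B = prod_list ` lists G"
  have cB: "countable B"
    unfolding B_def using G by (intro countable_image countable_lists)
  have 1: "1 \<in> B"
    unfolding B_def by (rule image_eqI[of _ _ "[]"]) auto
  have mB: "b * b' \<in> B" if bb: "b \<in> B" "b' \<in> B" for b b'
  proof -
    obtain xs ys where b: "b = prod_list xs" "b' = prod_list ys" and xs: "xs \<in> lists G" "ys \<in> lists G"
      using bb unfolding B_def by blast
    have "b * b' = prod_list (xs @ ys)"
      unfolding b by simp
    moreover have "xs @ ys \<in> lists G"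
      using xs by simp
    ultimately show ?thesis unfolding B_def by (rule image_eqI)
  qed
  have "a \<in> scalar_span sc B" if "a \<in> generated_subalgebra sc G" for a
    using that
  proof (induction rule: generated_subalgebra.induct)
    case (scalar c)
    show ?case using scalar_span.scale[OF 1, of sc c] by simp
  next
    case (generator g)
    then have "g \<in> B" unfolding B_def by (intro image_eqI[of _ _ "[g]"]) auto
    then show ?case using scalar_span.scale[of g B sc 1] by (simp add: sc_one)
  qed (auto intro: scalar_span.add scalar_span_mult mB)
  then have AB: "A \<subseteq> scalar_span sc B" using A by blast
  have GA: "G \<subseteq> A" using A by (auto intro: generated_subalgebra.generator)
  have BA: "B \<subseteq> A"
  proof
    fix b assume "b \<in> B"
    then obtain xs where "xs \<in> lists G" "b = prod_list xs" unfolding B_def by blast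
    moreover have "xs \<in> lists G \<Longrightarrow> prod_list xs \<in> A"
      by (induction xs) (use GA in \<open>auto intro: closed\<close>)
    ultimately show "b \<in> A" by simp
  qed
  define b where "b n = (if n = 0 then 1 else from_nat_into B (n - 1))" for n
  have "range b = B"
  proof
    show "range b \<subseteq> B" using from_nat_into[of B] 1 by (auto simp: b_def)
    show "B \<subseteq> range b"
    proof
      fix x assume "x \<in> B"
      then have "b (Suc (to_nat_on B x)) = x" using cB by (simp add: b_def)
      then show "x \<in> range b" by (metis rangeI)
    qed
  qed
  with AB BA show thesis by (intro that[of b]) (auto simp: b_def)
qed


text \<open>The factor 1/4 fits the choice \<open>c = 1 + u\<close> and \<open>c = 1 - u\<close>
  with \<open>u\<close> unitary: the two functionals obtained then add up to
  \<open>L\<close>.\<close>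

lemma pos_multiplied:
  assumes L: "positive_functional L" and c: "c \<in> A"
  shows "positive_functional (\<lambda>a. L (star c * c * a) / 4)"
  unfolding positive_functional_def linear_functional_def
proof (intro conjI ballI allI)
  have lin: "linear_functional L" by (rule pos_lin[OF L])
  fix x y d assume x: "x \<in> A" and y: "y \<in> A"
  show "L (star c * c * (x + y)) / 4 = L (star c * c * x) / 4 + L (star c * c * y) / 4"
    using lin_add[OF lin, of "star c * c * x" "star c * c * y"] c x y
    by (simp add: closed algebra_simps add_divide_distrib)
  show "L (star c * c * (sc d * x)) / 4 = d * (L (star c * c * x) / 4)"
    using lin_scale[OF lin, of "star c * c * x" d] c x by (simp add: closed mult.left_commute)
  have "L (star (c * x) * (c * x)) \<in> \<real>\<^sub>\<ge>\<^sub>0"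
    by (intro pos_square[OF L] closed c x)
  then show "L (star c * c * (star x * x)) / 4 \<in> \<real>\<^sub>\<ge>\<^sub>0"
    using c x by (simp add: star_mult mult_ac complex_nonneg_Reals_iff)
qed

lemma scalar_span_closed: "B \<subseteq> A \<Longrightarrow> x \<in> scalar_span sc B \<Longrightarrow> x \<in> A"
  by (rotate_tac, induction rule: scalar_span.induct) (auto intro: closed)

lemma lin_eq_on_scalar_span:
  assumes "linear_functional L" "linear_functional L'" "B \<subseteq> A" "\<And>b. b \<in> B \<Longrightarrow> L b = L' b"
    and "x \<in> scalar_span sc B"
  shows "L x = L' x"
  using assms(5)
proof (induction rule: scalar_span.induct)
  case (add x y)
  then show ?case using assms by (simp add: lin_add scalar_span_closed[OF assms(3)])
qed (use assms in \<open>auto simp: lin_scale\<close>)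

text \<open>Extremality is recorded only through its consequence for unitaries. The minimiser in the
  cap has weighted sum exactly 1, so a decomposition into positive functionals can be rescaled to a
  convex combination inside the cap, where lexicographic minimality makes both parts equal.\<close>

lemma extremal_functional:
  assumes A: "A = generated_subalgebra sc G" and G: "countable G"
    and L0: "positive_functional L0" and f: "f \<in> A" and neg: "Re (L0 f) < 0"
  obtains L where "positive_functional L" "Re (L f) < 0"
    "\<And>u. u \<in> A \<Longrightarrow> star u * u = 1 \<Longrightarrow> \<exists>l. cmod l = 1 \<and> (\<forall>a\<in>A. L (u * a) = l * L a)"
proof -
  obtain b :: "nat \<Rightarrow> 'a" where bA: "range b \<subseteq> A" and b0: "b 0 = 1" and Ab: "A \<subseteq> scalar_span sc (range b)"
    using generated_spanning_sequence[OF A G] .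
  have bA': "b n \<in> A" for n using bA by auto
  define sq where "sq L n = Re (L (star (b n) * b n))" for L :: "'a \<Rightarrow> complex" and n
  define w where "w n = (1/2)^Suc n / (1 + sq L0 n)" for n
  define T where "T = product_topology (\<lambda>_. euclidean :: complex topology) A"
  \<comment> \<open>\<open>K\<close> is a cap of the cone: the weighted sum is additive in \<open>L\<close>, controls all values of \<open>L\<close>, and the weights
    are chosen such that \<open>L0\<close> is in \<open>K\<close>.\<close>
  define K where "K = {L \<in> topspace T. positive_functional L \<and> (\<forall>n. (\<Sum>i<n. w i * sq L i) \<le> 1)}"
  have sq_ge0: "sq L n \<ge> 0" if "positive_functional L" for L n
    using pos_square[OF that bA'] by (simp add: sq_def complex_nonneg_Reals_iff)
  have w_pos: "w n > 0" for n
    using sq_ge0[OF L0, of n] by (simp add: w_def)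
  have topT: "topspace T = extensional A"
    by (simp add: T_def topspace_product_topology PiE_def)
  have wsq: "w n * sq L n \<ge> 0" if "positive_functional L" for L n
    using sq_ge0[OF that, of n] w_pos[of n] by simp

  have scaled: "restrict (\<lambda>a. L a / of_real s) A \<in> K"
    if L: "positive_functional L" and s: "s > 0" and le: "\<And>n. (\<Sum>i<n. w i * sq L i) \<le> s" for L s
  proof -
    have "linear_functional (restrict (\<lambda>a. L a / of_real s) A)"
      using pos_lin[OF L] by (auto simp: linear_functional_def closed add_divide_distrib)
    moreover have "L (star a * a) / of_real s \<in> \<real>\<^sub>\<ge>\<^sub>0" if "a \<in> A" for a
      using pos_square[OF L that] s by (simp add: complex_nonneg_Reals_iff)
    ultimately have "positive_functional (restrict (\<lambda>a. L a / of_real s) A)"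
      by (auto simp: positive_functional_def closed)
    moreover have "sq (restrict (\<lambda>a. L a / of_real s) A) i = sq L i / s" for i
      by (simp add: sq_def closed bA')
    moreover have "(\<Sum>i<n. w i * (sq L i / s)) \<le> 1" for n
      using le[of n] s by (simp add: sum_divide_distrib[symmetric])
    ultimately show ?thesis
      by (auto simp: K_def topT)
  qed

  \<comment> \<open>Since \<open>b 0 = 1\<close>, also \<open>L 1\<close> vanishes, and then
    \<open>pos_bound\<close> annihilates the spanning sequence.\<close>
  have vanish: "L a = 0" if L: "positive_functional L" and 0: "\<And>n. sq L n = 0" and a: "a \<in> A" for L a
  proof -
    have "Re (L 1) = 0" using 0[of 0] by (simp add: sq_def b0)
    then have "L (b n) = 0" for n
      using pos_bound[OF L bA', of n] 0[of n] by (simp add: sq_def)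
    then show ?thesis
      using lin_eq_on_scalar_span[OF pos_lin[OF L] _ bA, of "\<lambda>_. 0" a] a Ab
      by (auto simp: linear_functional_def)
  qed

  have K_pos: "positive_functional L" if "L \<in> K" for L
    using that by (simp add: K_def)
  have K_sq: "sq L n \<le> 1 / w n" if "L \<in> K" for L n
  proof -
    have "w n * sq L n \<le> (\<Sum>i<Suc n. w i * sq L i)"
      using wsq[OF K_pos[OF that]] by (simp add: sum_nonneg)
    also have "\<dots> \<le> 1" using that by (simp only: K_def mem_Collect_eq)
    finally show ?thesis using w_pos[of n] by (simp add: field_simps)
  qed
  \<comment> \<open>On each element of the span the functionals in \<open>K\<close> are uniformly
    bounded, which places \<open>K\<close> in a product of discs; that product is compact by
    Tychonoff's theorem.\<close>
  have "\<exists>R. \<forall>L\<in>K. cmod (L a) \<le> R" if "a \<in> scalar_span sc (range b)" for a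
    using that
  proof (induction rule: scalar_span.induct)
    case (scale x c)
    then obtain n where n: "x = b n" by auto
    have "cmod (L (sc c * x)) \<le> cmod c * ((1 / w 0 + 1 / w n) / 2)" if "L \<in> K" for L
    proof -
      have "2 * cmod (L (b n)) \<le> sq L 0 + sq L n"
        using pos_bound[OF K_pos[OF that] bA', of n] by (simp add: sq_def b0)
      also have "\<dots> \<le> 1 / w 0 + 1 / w n"
        using K_sq[OF that] by (intro add_mono) auto
      finally have "cmod (L (b n)) \<le> (1 / w 0 + 1 / w n) / 2" by simp
      then show ?thesis
        unfolding n lin_scale[OF pos_lin[OF K_pos[OF that]] bA'] norm_mult
        by (rule mult_left_mono) simp
    qed
    then show ?case by blast
  next
    case (add x y)
    then obtain Rx Ry where R: "\<forall>L\<in>K. cmod (L x) \<le> Rx" "\<forall>L\<in>K. cmod (L y) \<le> Ry" by blast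
    have "cmod (L (x + y)) \<le> Rx + Ry" if "L \<in> K" for L
    proof -
      have "L (x + y) = L x + L y"
        using add.hyps by (intro lin_add[OF pos_lin[OF K_pos[OF that]]] scalar_span_closed[OF bA])
      then show ?thesis using R that norm_triangle_mono[of "L x" Rx "L y" Ry] by simp
    qed
    then show ?case by blast
  qed
  then have "\<forall>a\<in>A. \<exists>R. \<forall>L\<in>K. cmod (L a) \<le> R" using Ab by blast
  then obtain R where R: "\<And>a L. a \<in> A \<Longrightarrow> L \<in> K \<Longrightarrow> cmod (L a) \<le> R a" by metis
  have Ksub: "K \<subseteq> PiE A (\<lambda>a. cball 0 (R a))"
    using R by (auto simp: K_def topT PiE_def)
  have comp: "compactin T (PiE A (\<lambda>a. cball 0 (R a)))"
    unfolding T_def compactin_PiE by (simp add: compactin_euclidean_iff)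

  have pr: "((\<lambda>L. L a) \<longlongrightarrow> x a) (atin T x)" if "a \<in> A" "x \<in> topspace T" for a x
    using continuous_map_product_projection[OF that(1), of "\<lambda>_. euclidean :: complex topology"] that(2)
    by (simp add: continuous_map_atin T_def)
  have clo: "closedin T {L \<in> topspace T. F L \<in> S}"
    if "\<And>x. x \<in> topspace T \<Longrightarrow> (F \<longlongrightarrow> F x) (atin T x)" "closed S"
    for F :: "('a \<Rightarrow> complex) \<Rightarrow> 'z::topological_space" and S
    using that by (intro closedin_continuous_map_preimage[where Y = euclidean])
      (auto simp: continuous_map_atin)
  \<comment> \<open>The cap is phrased with finite partial sums: every condition then involves
    finitely many coordinates and is closed for pointwise convergence.\<close>
  have K_eq: "K = topspace T \<inter> ((\<Inter>x\<in>A. \<Inter>y\<in>A. {L \<in> topspace T. L (x + y) - (L x + L y) \<in> {0}}) \<inter>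
      (\<Inter>c. \<Inter>x\<in>A. {L \<in> topspace T. L (sc c * x) - c * L x \<in> {0}}) \<inter>
      (\<Inter>a\<in>A. {L \<in> topspace T. L (star a * a) \<in> \<real>\<^sub>\<ge>\<^sub>0}) \<inter>
      (\<Inter>n. {L \<in> topspace T. (\<Sum>i<n. w i * sq L i) \<in> {..1}}))"
    using one_closed
    by (auto simp: K_def positive_functional_def linear_functional_def)
  have "closedin T K"
    unfolding K_eq sq_def
    by (intro closedin_Int closedin_topspace closedin_INT clo tendsto_intros pr closed bA' closed_atMost
        closed_singleton closed_nonneg_Reals_complex)
      (use one_closed in auto)

  \<comment> \<open>An extreme point of \<open>K\<close> at which \<open>Re (L f)\<close> is minimal is found by lexicographic minimisation of \<open>Re (L f)\<close> and of
    the real and imaginary parts of the values on the spanning sequence.\<close>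
  define h where "h n = (if n = 0 then f else if even n then b (n div 2 - 1) else sc \<i> * b (n div 2))" for n
  have hA: "h n \<in> A" for n
    using f bA' by (simp add: h_def closed)
  define C where "C = rec_nat K (\<lambda>n S. {L \<in> S. \<forall>L'\<in>S. Re (L (h n)) \<le> Re (L' (h n))})"
  have C0: "C 0 = K" by (simp add: C_def)
  have CS: "C (Suc n) = {L \<in> C n. \<forall>L'\<in>C n. Re (L (h n)) \<le> Re (L' (h n))}" for n
    by (simp add: C_def)
  have CK: "C n \<subseteq> K" for n by (induction n) (auto simp: C0 CS)
  have sq0: "(\<Sum>i<n. w i * sq L0 i) \<le> 1" for n
  proof -
    have "w i * sq L0 i \<le> (1/2)^Suc i" for i
    proof -
      have "w i * sq L0 i = (1/2)^Suc i * (sq L0 i / (1 + sq L0 i))" by (simp add: w_def)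
      also have "\<dots> \<le> (1/2)^Suc i"
        using sq_ge0[OF L0, of i] by (intro mult_left_le) auto
      finally show ?thesis .
    qed
    then have "(\<Sum>i<n. w i * sq L0 i) \<le> (\<Sum>i<n. (1/2)^Suc i)"
      by (rule sum_mono)
    also have "\<dots> = 1 - (1/2::real)^n"
      by (induction n) auto
    finally show ?thesis by (smt (verit) zero_le_power divide_nonneg_nonneg)
  qed
  have L0K: "restrict L0 A \<in> K"
    using scaled[OF L0, of 1] sq0 by simp
  have "closedin T (C n) \<and> C n \<noteq> {}" for n
  proof (induction n)
    case 0
    show ?case using L0K \<open>closedin T K\<close> by (auto simp: C0)
  next
    case (Suc n)
    have "compactin T (C n)"
      using closed_compactin[OF comp _ , of "C n"] Suc Ksub CK[of n] by blast
    then have "compactin euclidean ((\<lambda>L. Re (L (h n))) ` C n)"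
      by (rule image_compactin) (auto simp: continuous_map_atin intro!: tendsto_intros pr hA)
    then have "compact ((\<lambda>L. Re (L (h n))) ` C n)" by (simp add: compactin_euclidean_iff)
    from compact_attains_inf[OF this] Suc obtain M where
      M: "M \<in> C n" "\<And>L. L \<in> C n \<Longrightarrow> Re (M (h n)) \<le> Re (L (h n))" by auto
    have "C (Suc n) = C n \<inter> {L \<in> topspace T. Re (L (h n)) \<in> {..Re (M (h n))}}"
      using M CK[of n] by (auto simp: CS K_def intro: order_trans)
    moreover have "closedin T {L \<in> topspace T. Re (L (h n)) \<in> {..Re (M (h n))}}"
      by (intro clo tendsto_intros pr hA closed_atMost)
    moreover have "M \<in> C (Suc n)" using M by (auto simp: CS)
    ultimately show ?case using Suc by auto
  qed
  then have C_clo: "closedin T (C n)" and C_ne: "C n \<noteq> {}" for n by auto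
  have "(\<Inter>n. C n) \<noteq> {}"
  proof (rule compact_space_imp_nest[of "subtopology T (PiE A (\<lambda>a. cball 0 (R a)))"])
    show "compact_space (subtopology T (PiE A (\<lambda>a. cball 0 (R a))))"
      using comp by (simp add: compact_space_subtopology)
    show "closedin (subtopology T (PiE A (\<lambda>a. cball 0 (R a)))) (C n)" for n
      using C_clo CK[of n] Ksub by (intro closedin_subset_topspace) auto
    show "decseq C" by (rule decseq_SucI) (auto simp: CS)
  qed (rule C_ne)
  then obtain L where L: "\<And>n. L \<in> C n" by auto
  have LK: "L \<in> K" and Lp: "positive_functional L" using L[of 0] by (auto simp: C0 K_def)
  have L_min: "Re (L f) \<le> Re (M f)" if "M \<in> K" for M
    using L[of 1] that CS[of 0] by (auto simp: C0 h_def)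
  have L_neg: "Re (L f) < 0"
    using L_min[OF L0K] neg f by simp

  \<comment> \<open>The factor \<open>t\<close> is the weighted mass \<open>n1\<close> of
    \<open>L1\<close>. A summand of mass 0 vanishes. Otherwise \<open>L\<close> is the convex
    combination of \<open>L1 / n1\<close> and \<open>L2 / n2\<close>, both in the cap.\<close>
  have extremal: "\<exists>t::real. \<forall>a\<in>A. L1 a = of_real t * L a"
    if p: "positive_functional L1" "positive_functional L2" and s: "\<And>a. a \<in> A \<Longrightarrow> L a = L1 a + L2 a" for L1 L2
  proof -
    have sq_add: "sq L i = sq L1 i + sq L2 i" for i
      using s[of "star (b i) * b i"] bA' by (simp add: sq_def closed)
    have KL: "(\<Sum>i<n. w i * sq L i) \<le> 1" for n using LK by (simp add: K_def)
    have le: "(\<Sum>i<n. w i * sq L1 i) \<le> 1" "(\<Sum>i<n. w i * sq L2 i) \<le> 1" for n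
    proof -
      have "(\<Sum>i<n. w i * sq L1 i) + (\<Sum>i<n. w i * sq L2 i) \<le> 1"
        using KL[of n] by (simp add: sq_add distrib_left sum.distrib)
      moreover have "(\<Sum>i<n. w i * sq L1 i) \<ge> 0" "(\<Sum>i<n. w i * sq L2 i) \<ge> 0"
        using wsq[OF p(1)] wsq[OF p(2)] by (auto intro: sum_nonneg)
      ultimately show "(\<Sum>i<n. w i * sq L1 i) \<le> 1" "(\<Sum>i<n. w i * sq L2 i) \<le> 1"
        by linarith+
    qed
    have sm: "summable (\<lambda>i. w i * sq L1 i)" "summable (\<lambda>i. w i * sq L2 i)"
      using le wsq[OF p(1)] wsq[OF p(2)] by (auto intro!: summableI_nonneg_bounded)
    define n1 n2 where "n1 = suminf (\<lambda>i. w i * sq L1 i)" and "n2 = suminf (\<lambda>i. w i * sq L2 i)"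
    have n0: "n1 \<ge> 0" "n2 \<ge> 0"
      unfolding n1_def n2_def using sm wsq[OF p(1)] wsq[OF p(2)] by (auto intro: suminf_nonneg)
    have le1: "(\<Sum>i<n. w i * sq L1 i) \<le> n1" and le2: "(\<Sum>i<n. w i * sq L2 i) \<le> n2" for n
      unfolding n1_def n2_def using sm wsq[OF p(1)] wsq[OF p(2)] by (auto intro: sum_le_suminf)
    have van: "\<forall>a\<in>A. M a = 0" if M: "positive_functional M" "summable (\<lambda>i. w i * sq M i)" "suminf (\<lambda>i. w i * sq M i) = 0" for M
    proof -
      have "\<forall>i. w i * sq M i = 0"
        using suminf_eq_zero_iff[OF M(2) wsq[OF M(1)]] M(3) by simp
      then have "sq M i = 0" for i using w_pos[of i] by (metis less_irrefl mult_eq_0_iff)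
      then show ?thesis using vanish[OF M(1)] by blast
    qed
    show ?thesis
    proof (cases "n1 = 0 \<or> n2 = 0")
      case True
      then show ?thesis
      proof
        assume "n1 = 0"
        then have "\<forall>a\<in>A. L1 a = 0" using van[OF p(1) sm(1)] by (simp add: n1_def)
        then show ?thesis by (intro exI[of _ 0]) simp
      next
        assume "n2 = 0"
        then have "\<forall>a\<in>A. L2 a = 0" using van[OF p(2) sm(2)] by (simp add: n2_def)
        then show ?thesis using s by (intro exI[of _ 1]) simp
      qed
    next
      case False
      then have n_pos: "n1 > 0" "n2 > 0" using n0 by auto
      have n_le: "(\<Sum>i<n. w i * sq L i) \<le> n1 + n2" for n
        using le1[of n] le2[of n] by (simp add: sq_add distrib_left sum.distrib)
      \<comment> \<open>If the mass of \<open>L\<close> were below 1, dividing by it would stay in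
        the cap and make the negative number \<open>Re (L f)\<close> smaller still.\<close>
      have n12: "n1 + n2 = 1"
      proof -
        have "n1 + n2 = suminf (\<lambda>i. w i * sq L i)"
          unfolding n1_def n2_def using sm by (simp add: suminf_add sq_add distrib_left)
        also have "\<dots> \<le> 1"
        proof (rule suminf_le_const)
          show "summable (\<lambda>i. w i * sq L i)"
            using summable_add[OF sm] by (simp add: sq_add distrib_left)
        qed (rule KL)
        finally have "n1 + n2 \<le> 1" .
        moreover have "Re (L f) \<le> Re (L f) / (n1 + n2)"
          using L_min[OF scaled[OF Lp _ n_le]] n_pos f by simp
        then have "Re (L f) * (n1 + n2) \<le> Re (L f)"
          using n_pos by (simp add: pos_le_divide_eq)
        then have "Re (L f) * (n1 + n2 - 1) \<le> 0" by (simp add: algebra_simps)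
        then have "n1 + n2 \<ge> 1"
          using L_neg by (auto simp: mult_le_0_iff)
        ultimately show ?thesis by simp
      qed
      define M1 where "M1 = restrict (\<lambda>a. L1 a / of_real n1) A"
      define M2 where "M2 = restrict (\<lambda>a. L2 a / of_real n2) A"
      have M: "M1 \<in> K" "M2 \<in> K"
        unfolding M1_def M2_def using scaled[OF p(1) n_pos(1) le1] scaled[OF p(2) n_pos(2) le2] .
      have conv: "L a = of_real n1 * M1 a + of_real n2 * M2 a" if "a \<in> A" for a
        using that s n_pos by (simp add: M1_def M2_def)
      have eq: "Re (M1 (h n)) = Re (L (h n)) \<and> Re (M2 (h n)) = Re (L (h n))" if "M1 \<in> C n" "M2 \<in> C n" for n
      proof -
        have m: "Re (L (h n)) \<le> Re (M1 (h n))" "Re (L (h n)) \<le> Re (M2 (h n))"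
          using L[of "Suc n"] that by (auto simp: CS)
        have c: "Re (L (h n)) = n1 * Re (M1 (h n)) + n2 * Re (M2 (h n))"
          using conv[OF hA, of n] by simp
        have "n1 * (Re (M1 (h n)) - Re (L (h n))) + n2 * (Re (M2 (h n)) - Re (L (h n))) = 
           n1 * Re (M1 (h n)) + n2 * Re (M2 (h n)) - (n1 + n2) * Re (L (h n))"
          by (simp add: algebra_simps)
        also have "\<dots> = 0" using c n12 by simp
        finally have "n1 * (Re (M1 (h n)) - Re (L (h n))) = 0 \<and> n2 * (Re (M2 (h n)) - Re (L (h n))) = 0"
          using m n_pos by (subst (asm) add_nonneg_eq_0_iff) auto
        then show ?thesis using n_pos by auto
      qed
      have MC: "M1 \<in> C n \<and> M2 \<in> C n" for n
      proof (induction n)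
        case 0 show ?case using M by (simp add: C0)
      next
        case (Suc n)
        then show ?case using eq[of n] L[of "Suc n"] by (auto simp: CS)
      qed
      have M1p: "positive_functional M1" by (rule K_pos[OF M(1)])
      have "M1 (b k) = L (b k)" for k
      proof (rule complex_eqI)
        \<comment> \<open>In the sequence \<open>h\<close>, the index \<open>2 * k + 2\<close>
          belongs to \<open>b k\<close> and \<open>2 * k + 1\<close> to
          \<open>sc \<i> * b k\<close>, where the real part of the value is minus the imaginary part
          at \<open>b k\<close>.\<close>
        show "Re (M1 (b k)) = Re (L (b k))"
          using eq[of "2 * k + 2"] MC by (simp add: h_def)
        have "Re (M1 (sc \<i> * b k)) = Re (L (sc \<i> * b k))"
          using eq[of "2 * k + 1"] MC by (simp add: h_def)
        then show "Im (M1 (b k)) = Im (L (b k))"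
          by (simp add: lin_scale[OF pos_lin[OF M1p] bA'] lin_scale[OF pos_lin[OF Lp] bA'])
      qed
      then have "M1 a = L a" if "a \<in> A" for a
        using lin_eq_on_scalar_span[OF pos_lin[OF M1p] pos_lin[OF Lp] bA, of a] that Ab by auto
      then have "\<forall>a\<in>A. L1 a = of_real n1 * L a"
        using n_pos by (auto simp: M1_def field_simps)
      then show ?thesis by blast
    qed
  qed

  have lin: "linear_functional L" by (rule pos_lin[OF Lp])
  have unitary: "\<exists>l. cmod l = 1 \<and> (\<forall>a\<in>A. L (u * a) = l * L a)" if u: "u \<in> A" and uu: "star u * u = 1" for u
  proof -
    \<comment> \<open>Extremality applied to the splitting by \<open>1 + sc z * u\<close> and
      \<open>1 - sc z * u\<close>. The first quarter of \<open>L\<close> is half of \<open>L\<close>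
      plus a quarter of the expression in question, so this expression is a real multiple of
      \<open>L\<close> as well.\<close>
    have real_part: "\<exists>t::real. \<forall>a\<in>A. z * L (u * a) + cnj z * L (star u * a) = of_real t * L a"
      if z: "cnj z * z = 1" for z
    proof -
      define c where "c e = 1 + sc (e * z) * u" for e
      have cA: "c e \<in> A" for e using u by (simp add: c_def closed)
      have cc: "L (star (c e) * c e * a) = 2 * L a + e * (z * L (u * a) + cnj z * L (star u * a))"
        if a: "a \<in> A" and e: "e = 1 \<or> e = -1" for a e
      proof -
        have ee: "cnj (e * z) * (e * z) = 1" and ce: "cnj e = e"
          using e z by auto
        have "star (c e) * c e * a = a + sc (e * z) * (u * a) + sc (cnj (e * z)) * (star u * a)
            + sc (cnj (e * z) * (e * z)) * ((star u * u) * a)"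
          using u by (simp add: c_def star_add star_mult star_sc closed sc_mult algebra_simps)
        also have "\<dots> = a + sc (e * z) * (u * a) + sc (cnj (e * z)) * (star u * a) + a"
          by (simp only: ee uu sc_one mult_1_left)
        also have "L \<dots> = L a + e * z * L (u * a) + cnj (e * z) * L (star u * a) + L a"
          by (simp only: lin_add[OF lin] lin_scale[OF lin] closed a u)
        finally show ?thesis
          by (simp add: ce algebra_simps)
      qed
      have "\<exists>t::real. \<forall>a\<in>A. L (star (c 1) * c 1 * a) / 4 = of_real t * L a"
      proof (rule extremal)
        show "L a = L (star (c 1) * c 1 * a) / 4 + L (star (c (-1)) * c (-1) * a) / 4" if "a \<in> A" for a
          using cc[OF that, of 1] cc[OF that, of "-1"] by (simp add: field_simps)
      qed (intro pos_multiplied Lp cA)+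
      then obtain t :: real where t: "\<And>a. a \<in> A \<Longrightarrow> L (star (c 1) * c 1 * a) = 4 * (of_real t * L a)"
        by (auto simp: field_simps)
      have "z * L (u * a) + cnj z * L (star u * a) = of_real (4 * t - 2) * L a" if "a \<in> A" for a
        using t[OF that] cc[OF that, of 1] by (simp add: algebra_simps)
      then show ?thesis by blast
    qed
    obtain t1 :: real where t1: "\<And>a. a \<in> A \<Longrightarrow> L (u * a) + L (star u * a) = of_real t1 * L a"
      using real_part[of 1] by auto
    obtain t2 :: real where t2: "\<And>a. a \<in> A \<Longrightarrow> \<i> * L (u * a) - \<i> * L (star u * a) = of_real t2 * L a"
      using real_part[of \<i>] by auto
    \<comment> \<open>The choices \<open>z = 1\<close> and \<open>z = \<i>\<close> give twice the
      real part of the scalar and minus twice its imaginary part.\<close>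
    define l where "l = (of_real t1 - \<i> * of_real t2) / 2"
    have t2': "L (u * a) - L (star u * a) = - \<i> * of_real t2 * L a" if "a \<in> A" for a
      using arg_cong[OF t2[OF that], of "\<lambda>x. - \<i> * x"] by (simp add: algebra_simps)
    have l: "L (u * a) = l * L a" and l': "L (star u * a) = cnj l * L a" if "a \<in> A" for a
    proof -
      have "2 * L (u * a) = (L (u * a) + L (star u * a)) + (L (u * a) - L (star u * a))"
        by simp
      then show "L (u * a) = l * L a"
        unfolding t1[OF that] t2'[OF that] by (simp add: l_def field_simps)
      have "2 * L (star u * a) = (L (u * a) + L (star u * a)) - (L (u * a) - L (star u * a))"
        by simp
      then show "L (star u * a) = cnj l * L a"
        unfolding t1[OF that] t2'[OF that] by (simp add: l_def field_simps)
    qed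
    \<comment> \<open>Evaluating at \<open>star u * (u * f) = f\<close>, where \<open>L f\<close> is
      nonzero, shows that the scalar is unimodular.\<close>
    have "L f = cnj l * l * L f"
      using l'[of "u * f"] l[of f] u f uu by (simp add: closed mult.assoc[symmetric])
    then have "cnj l * l = 1" using L_neg by auto
    then have "of_real ((cmod l)\<^sup>2) = (1::complex)"
      by (subst complex_norm_square) (simp add: mult.commute)
    then have "(cmod l)\<^sup>2 = 1" by (simp only: of_real_eq_1_iff)
    then have "cmod l = 1"
      using power2_eq_1_iff[of "cmod l"] norm_ge_zero[of l] by linarith
    then show ?thesis using l by blast
  qed
  show thesis
    by (rule that[OF Lp L_neg unitary])
qed

end

section \<open>Nonnegative polynomials on the real line\<close>

text \<open>A closed condition passes to the endpoint by continuity. This supplies the missing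
  values at a cancelled root and at the puncture \<open>t = 0\<close>.\<close>

lemma poly_of_real_at_right:
  fixes P :: "complex poly"
  assumes "closed S" "\<And>t. t > a \<Longrightarrow> poly P (of_real t) \<in> S"
  shows "poly P (of_real a) \<in> S"
proof (rule Lim_in_closed_set[OF assms(1)])
  show "\<forall>\<^sub>F t in at_right a. poly P (of_real t) \<in> S"
    using assms(2) by (auto simp: eventually_at_right[of a "a + 1"] intro: exI[of _ "a + 1"])
  have "isCont (\<lambda>t. poly P (of_real t)) a"
    by (intro isCont_o2[OF _ poly_isCont] continuous_intros)
  then show "((\<lambda>t. poly P (of_real t)) \<longlongrightarrow> poly P (of_real a)) (at_right a)"
    unfolding isCont_def by (rule filterlim_mono[OF _ order_refl]) (simp add: at_le)
qed simp

lemma poly_of_real_at_left: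
  fixes P :: "complex poly"
  assumes "closed S" "\<And>t. t < a \<Longrightarrow> poly P (of_real t) \<in> S"
  shows "poly P (of_real a) \<in> S"
  using poly_of_real_at_right[OF assms(1), of "- a" "pcompose P [:0, -1:]"] assms(2)
  by (simp add: poly_pcompose minus_less_iff flip: of_real_minus)

lemma poly_map_poly_cnj: "poly (map_poly cnj p) z = cnj (poly p (cnj z))"
  by (induction p) (auto simp: map_poly_pCons)

lemma poly_cnj_of_real_on_reals:
  fixes Q :: "complex poly"
  assumes "\<And>t::real. poly Q (of_real t) \<in> \<real>"
  shows "poly Q (cnj z) = cnj (poly Q z)"
proof -
  have "map_poly cnj Q - Q = 0"
  proof (rule ccontr)
    assume "map_poly cnj Q - Q \<noteq> 0"
    then have "finite {x. poly (map_poly cnj Q - Q) x = 0}" by (rule poly_roots_finite)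
    moreover have "range of_real \<subseteq> {x. poly (map_poly cnj Q - Q) x = 0}"
      using assms by (auto simp: poly_map_poly_cnj Reals_cnj_iff)
    ultimately have "finite (range (of_real :: real \<Rightarrow> complex))" by (rule rev_finite_subset)
    then show False
      using finite_imageD[of "of_real :: real \<Rightarrow> complex" UNIV] by (simp add: inj_def infinite_UNIV_char_0)
  qed
  then show ?thesis using poly_map_poly_cnj[of Q "cnj z"] by simp
qed

text \<open>A nonreal root comes with its conjugate, and a real root is at least double because
  there is no sign change. Either way \<open>(X - \<alpha>) (X - cnj \<alpha>)\<close> splits off,
  which is nonnegative on the line, and the cofactor has smaller degree. With complex coefficients a
  single hermitian square suffices.\<close>

theorem nonneg_poly_on_reals_is_square:
  fixes Q :: "complex poly"
  assumes "\<And>t::real. poly Q (of_real t) \<in> \<real>\<^sub>\<ge>\<^sub>0"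
  obtains q where "Q = q * map_poly cnj q"
proof -
  have "\<exists>q. \<forall>z. poly Q z = poly q z * cnj (poly q (cnj z))"
    using assms
  proof (induction "degree Q" arbitrary: Q rule: less_induct)
    case less
    have real: "poly Q (of_real t) \<in> \<real>" for t :: real
      using less.prems[of t] nonneg_Reals_subset_Reals by blast
    note cnj_Q = poly_cnj_of_real_on_reals[OF real]
    show ?case
    proof (cases "degree Q = 0")
      case True
      then obtain c where Q: "Q = [:c:]" by (rule degree_eq_zeroE)
      with less.prems[of 0] have "c \<in> \<real>\<^sub>\<ge>\<^sub>0" by simp
      then obtain r where r: "c = of_real r" "r \<ge> 0" by (rule nonneg_Reals_cases)
      then show ?thesis
        by (intro exI[of _ "[:of_real (sqrt r):]"]) (simp add: Q flip: of_real_mult)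
    next
      case False
      then obtain \<alpha> where \<alpha>: "poly Q \<alpha> = 0"
        using fundamental_theorem_of_algebra[of Q] by (auto simp: constant_degree)
      then obtain Q' where Q': "Q = [:- \<alpha>, 1:] * Q'" by (auto simp: poly_eq_0_iff_dvd)
      have "poly Q' (cnj \<alpha>) = 0"
      proof (cases "\<alpha> \<in> \<real>")
        case False
        then have "\<alpha> \<noteq> cnj \<alpha>" by (metis Reals_cnj_iff)
        moreover have "poly Q (cnj \<alpha>) = 0" using cnj_Q[of \<alpha>] \<alpha> by simp
        ultimately show ?thesis by (auto simp: Q')
      next
        case True
        then obtain a where a: "\<alpha> = of_real a" by (rule Reals_cases)
        \<comment> \<open>After division by \<open>X - a\<close> the quotient is nonnegative to the
          right of \<open>a\<close> and nonpositive to the left, hence zero at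
          \<open>a\<close>.\<close>
        have *: "poly Q' (of_real t) = of_real (Re (poly Q (of_real t)) / (t - a))" if "t \<noteq> a" for t
        proof -
          have "of_real (t - a) * poly Q' (of_real t) = of_real (Re (poly Q (of_real t)))"
            using of_real_Re[OF real[of t]] by (auto simp add: Q' a left_diff_distrib[symmetric])
          then show ?thesis using that by (simp add: field_simps)
        qed
        have Re0: "Re (poly Q (of_real t)) \<ge> 0" for t using less.prems[of t] by (simp add: complex_nonneg_Reals_iff)
        have "poly Q' (of_real a) \<in> \<real>\<^sub>\<ge>\<^sub>0"
          by (rule poly_of_real_at_right) (use * Re0 in \<open>auto simp: complex_nonneg_Reals_iff simp del: of_real_divide\<close>)
        moreover have "poly Q' (of_real a) \<in> \<real>\<^sub>\<le>\<^sub>0"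
          by (rule poly_of_real_at_left)
            (use * Re0 in \<open>auto simp: complex_nonpos_Reals_iff divide_nonneg_neg simp del: of_real_divide\<close>)
        ultimately show ?thesis
          by (simp add: a complex_nonneg_Reals_iff complex_nonpos_Reals_iff complex_eq_iff)
      qed
      then obtain Q1 where Q1: "Q' = [:- cnj \<alpha>, 1:] * Q1" by (auto simp: poly_eq_0_iff_dvd)
      have Q0: "Q \<noteq> 0" using False by auto
      then have "degree Q = degree Q1 + 2"
        unfolding Q' Q1 by (subst degree_mult_eq; (subst degree_mult_eq)?) auto
      moreover have nn: "poly Q1 (of_real t) \<in> \<real>\<^sub>\<ge>\<^sub>0" if "of_real t \<noteq> \<alpha>" for t :: real
      proof -
        have e: "(of_real t - \<alpha>) * (of_real t - cnj \<alpha>) = of_real ((cmod (of_real t - \<alpha>))\<^sup>2)"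
          by (subst complex_norm_square) simp
        have "poly Q (of_real t) = ((of_real t - \<alpha>) * (of_real t - cnj \<alpha>)) * poly Q1 (of_real t)"
          by (simp add: Q' Q1 algebra_simps)
        then have "poly Q (of_real t) = of_real ((cmod (of_real t - \<alpha>))\<^sup>2) * poly Q1 (of_real t)"
          by (simp only: e)
        then have "of_real ((cmod (of_real t - \<alpha>))\<^sup>2) * poly Q1 (of_real t) \<in> \<real>\<^sub>\<ge>\<^sub>0"
          using less.prems[of t] by simp
        moreover have "(cmod (of_real t - \<alpha>))\<^sup>2 > 0" using that by simp
        ultimately show ?thesis
          by (auto simp: complex_nonneg_Reals_iff zero_le_mult_iff simp del: of_real_power)
      qed
      moreover have "poly Q1 (of_real t) \<in> \<real>\<^sub>\<ge>\<^sub>0" for t :: real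
      proof (cases "of_real t = \<alpha>")
        case True
        show ?thesis
        proof (rule poly_of_real_at_right)
          show "poly Q1 (of_real s) \<in> \<real>\<^sub>\<ge>\<^sub>0" if "s > t" for s
            using nn[of s] that True by auto
        qed simp
      qed (use nn in simp)
      ultimately obtain q where q: "\<And>z. poly Q1 z = poly q z * cnj (poly q (cnj z))"
        using less.hyps[of Q1] by auto
      show ?thesis
        by (intro exI[of _ "[:- \<alpha>, 1:] * q"]) (simp add: Q' Q1 q algebra_simps)
    qed
  qed
  then obtain q where q: "\<And>z. poly Q z = poly q z * cnj (poly q (cnj z))" by blast
  have "poly Q = poly (q * map_poly cnj q)"
    by (rule ext) (simp add: q poly_map_poly_cnj)
  then show thesis by (intro that[of q]) (simp add: poly_eq_poly_eq_iff)
qed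

section \<open>Point evaluations\<close>

definition coord :: "(nat \<Rightarrow> complex) \<Rightarrow> nat \<Rightarrow> complex" where
  "coord Z i = (if even i then Z (i div 2) else cnj (Z (i div 2)))"

definition monom_eval :: "(nat \<Rightarrow> complex) \<Rightarrow> (nat \<Rightarrow>\<^sub>0 nat) \<Rightarrow> complex" where
  "monom_eval Z m = (\<Prod>i\<in>Poly_Mapping.keys m. coord Z i ^ Poly_Mapping.lookup m i)"

definition poly_eval :: "(nat \<Rightarrow> complex) \<Rightarrow> cpoly \<Rightarrow> complex" where
  "poly_eval Z p = (\<Sum>m\<in>Poly_Mapping.keys p. Poly_Mapping.lookup p m * monom_eval Z m)"

lemma monom_eval_superset:
  assumes "finite S" "Poly_Mapping.keys m \<subseteq> S"
  shows "monom_eval Z m = (\<Prod>i\<in>S. coord Z i ^ Poly_Mapping.lookup m i)"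
  unfolding monom_eval_def
  by (rule prod.mono_neutral_left) (use assms in \<open>auto simp: in_keys_iff\<close>)

lemma monom_eval_add: "monom_eval Z (m + n) = monom_eval Z m * monom_eval Z n"
proof -
  let ?S = "Poly_Mapping.keys m \<union> Poly_Mapping.keys n"
  have "monom_eval Z (m + n) = (\<Prod>i\<in>?S. coord Z i ^ Poly_Mapping.lookup (m + n) i)"
    by (rule monom_eval_superset) (auto simp: Poly_Mapping.keys_add)
  also have "\<dots> = monom_eval Z m * monom_eval Z n"
    by (simp add: monom_eval_superset[of ?S] lookup_add power_add prod.distrib)
  finally show ?thesis .
qed

lemma monom_eval_0 [simp]: "monom_eval Z 0 = 1"
  by (simp add: monom_eval_def)

lemma monom_eval_single: "monom_eval Z (Poly_Mapping.single i k) = coord Z i ^ k"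
  by (simp add: monom_eval_superset[of "{i}"])

lemma coord_swap_index: "coord Z (swap_index i) = cnj (coord Z i)"
  by (auto simp: coord_def swap_index_def elim!: oddE)

lemma monom_eval_swap: "monom_eval Z (swap_monom m) = cnj (monom_eval Z m)"
proof -
  have "monom_eval Z (swap_monom m)
      = (\<Prod>i\<in>swap_index ` Poly_Mapping.keys m. coord Z i ^ Poly_Mapping.lookup (swap_monom m) i)"
    by (rule monom_eval_superset)
      (auto simp: in_keys_iff lookup_swap_monom intro!: image_eqI[of _ swap_index "swap_index _"])
  also have "\<dots> = cnj (monom_eval Z m)"
    using inj_swap_index
    by (subst prod.reindex) (auto simp: inj_on_def monom_eval_def lookup_swap_monom coord_swap_index)
  finally show ?thesis .
qed

lemma poly_eval_superset:
  assumes "finite S" "Poly_Mapping.keys p \<subseteq> S"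
  shows "poly_eval Z p = (\<Sum>m\<in>S. Poly_Mapping.lookup p m * monom_eval Z m)"
  unfolding poly_eval_def
  by (rule sum.mono_neutral_left) (use assms in \<open>auto simp: in_keys_iff\<close>)

lemma poly_eval_add: "poly_eval Z (p + q) = poly_eval Z p + poly_eval Z q"
proof -
  let ?S = "Poly_Mapping.keys p \<union> Poly_Mapping.keys q"
  have "poly_eval Z (p + q) = (\<Sum>m\<in>?S. Poly_Mapping.lookup (p + q) m * monom_eval Z m)"
    by (rule poly_eval_superset) (auto simp: Poly_Mapping.keys_add)
  also have "\<dots> = poly_eval Z p + poly_eval Z q"
    by (simp add: poly_eval_superset[of ?S] lookup_add algebra_simps sum.distrib)
  finally show ?thesis .
qed

lemma poly_eval_0 [simp]: "poly_eval Z 0 = 0"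
  by (simp add: poly_eval_def)

lemma poly_eval_single: "poly_eval Z (Poly_Mapping.single m c) = c * monom_eval Z m"
  by (simp add: poly_eval_superset[of "{m}"])

lemma poly_eval_sum: "poly_eval Z (\<Sum>i\<in>I. p i) = (\<Sum>i\<in>I. poly_eval Z (p i))"
  by (induction I rule: infinite_finite_induct) (auto simp: poly_eval_add)

lemma poly_eval_mult: "poly_eval Z (p * q) = poly_eval Z p * poly_eval Z q"
proof -
  have "poly_eval Z ((\<Sum>m\<in>I. Poly_Mapping.single m (a m)) * (\<Sum>n\<in>J. Poly_Mapping.single n (b n))) =
      poly_eval Z (\<Sum>m\<in>I. Poly_Mapping.single m (a m)) * poly_eval Z (\<Sum>n\<in>J. Poly_Mapping.single n (b n))"
    for I a J b
    by (simp add: sum_product mult_single poly_eval_sum poly_eval_single monom_eval_add mult_ac)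
  from this[where I = "Poly_Mapping.keys p" and a = "Poly_Mapping.lookup p"
      and J = "Poly_Mapping.keys q" and b = "Poly_Mapping.lookup q"]
  show ?thesis
    by (simp only: cpoly_eq_sum_single[symmetric])
qed

lemma poly_eval_star: "poly_eval Z (poly_star p) = cnj (poly_eval Z p)"
proof -
  have "poly_eval Z (poly_star (\<Sum>m\<in>I. Poly_Mapping.single m (a m))) =
      cnj (poly_eval Z (\<Sum>m\<in>I. Poly_Mapping.single m (a m)))" for I a
    by (simp add: poly_star_sum poly_star_single poly_eval_sum poly_eval_single monom_eval_swap)
  from this[where I = "Poly_Mapping.keys p" and a = "Poly_Mapping.lookup p"] show ?thesis
    by (simp only: cpoly_eq_sum_single[symmetric])
qed

lemma poly_eval_pconst: "poly_eval Z (pconst c) = c"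
  by (simp add: pconst_def poly_eval_single)

lemma poly_eval_1 [simp]: "poly_eval Z 1 = 1"
  using poly_eval_pconst[of Z 1] by (simp add: pconst_def)

lemma poly_eval_zvar: "poly_eval Z (zvar j) = Z j"
  by (simp add: zvar_def poly_eval_single monom_eval_single coord_def)

section \<open>Values of fractions at regular points\<close>

definition regular_at :: "(nat \<Rightarrow> complex) \<Rightarrow> cfrac \<Rightarrow> bool" where
  "regular_at Z a \<longleftrightarrow> (\<exists>p q. poly_eval Z q \<noteq> 0 \<and> a = Fract p q)"

text \<open>Any representation with nonvanishing denominator may be used, not just a reduced one;
  the description is unique at regular points, since such representations agree after cross
  multiplication.\<close>

definition frac_eval :: "(nat \<Rightarrow> complex) \<Rightarrow> cfrac \<Rightarrow> complex" where
  "frac_eval Z a = (THE c. \<exists>p q. poly_eval Z q \<noteq> 0 \<and> a = Fract p q \<and> c = poly_eval Z p / poly_eval Z q)"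

lemma regular_at_Fract: "poly_eval Z q \<noteq> 0 \<Longrightarrow> regular_at Z (Fract p q)"
  by (auto simp: regular_at_def)

lemma frac_eval_Fract:
  assumes q: "poly_eval Z q \<noteq> 0"
  shows "frac_eval Z (Fract p q) = poly_eval Z p / poly_eval Z q"
  unfolding frac_eval_def
proof (rule the_equality)
  fix c assume "\<exists>p' q'. poly_eval Z q' \<noteq> 0 \<and> Fract p q = Fract p' q' \<and> c = poly_eval Z p' / poly_eval Z q'"
  then obtain p' q' where *: "poly_eval Z q' \<noteq> 0" "Fract p q = Fract p' q'" "c = poly_eval Z p' / poly_eval Z q'"
    by blast
  then have "q \<noteq> 0" "q' \<noteq> 0" using q by auto
  with * have "p * q' = p' * q" by (simp add: eq_fract)
  then have "poly_eval Z p * poly_eval Z q' = poly_eval Z p' * poly_eval Z q"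
    by (metis poly_eval_mult)
  with * q show "c = poly_eval Z p / poly_eval Z q" by (simp add: frac_eq_eq)
qed (use q in blast)

lemma poly_eval_nz: "poly_eval Z q \<noteq> 0 \<Longrightarrow> q \<noteq> 0"
  by auto

lemma frac_eval_add:
  assumes "regular_at Z a" "regular_at Z b"
  shows "regular_at Z (a + b)" "frac_eval Z (a + b) = frac_eval Z a + frac_eval Z b"
proof -
  obtain p q p' q' where *: "poly_eval Z q \<noteq> 0" "a = Fract p q" "poly_eval Z q' \<noteq> 0" "b = Fract p' q'"
    using assms unfolding regular_at_def by blast
  have e: "a + b = Fract (p * q' + p' * q) (q * q')"
    using * by (simp add: poly_eval_nz)
  show "regular_at Z (a + b)"
    unfolding e using * by (intro regular_at_Fract) (simp add: poly_eval_mult)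
  show "frac_eval Z (a + b) = frac_eval Z a + frac_eval Z b"
    unfolding e using * by (simp add: frac_eval_Fract poly_eval_mult poly_eval_add field_simps)
qed

lemma frac_eval_mult:
  assumes "regular_at Z a" "regular_at Z b"
  shows "regular_at Z (a * b)" "frac_eval Z (a * b) = frac_eval Z a * frac_eval Z b"
proof -
  obtain p q p' q' where *: "poly_eval Z q \<noteq> 0" "a = Fract p q" "poly_eval Z q' \<noteq> 0" "b = Fract p' q'"
    using assms unfolding regular_at_def by blast
  have e: "a * b = Fract (p * p') (q * q')"
    using * by simp
  show "regular_at Z (a * b)"
    unfolding e using * by (intro regular_at_Fract) (simp add: poly_eval_mult)
  show "frac_eval Z (a * b) = frac_eval Z a * frac_eval Z b"
    unfolding e using * by (simp add: frac_eval_Fract poly_eval_mult)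
qed

lemma frac_eval_to_fract: "regular_at Z (to_fract p)" "frac_eval Z (to_fract p) = poly_eval Z p"
proof -
  have "poly_eval Z 1 \<noteq> 0" by simp
  then show "regular_at Z (to_fract p)" "frac_eval Z (to_fract p) = poly_eval Z p"
    unfolding to_fract_def using frac_eval_Fract[of Z 1 p] by (simp_all add: regular_at_Fract)
qed

lemma frac_eval_inverse:
  assumes "poly_eval Z p \<noteq> 0"
  shows "regular_at Z (inverse (to_fract p))" "frac_eval Z (inverse (to_fract p)) = inverse (poly_eval Z p)"
proof -
  have e: "inverse (to_fract p) = Fract 1 p" by (simp add: to_fract_def)
  show "regular_at Z (inverse (to_fract p))"
    unfolding e using assms by (rule regular_at_Fract)
  show "frac_eval Z (inverse (to_fract p)) = inverse (poly_eval Z p)"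
    unfolding e using frac_eval_Fract[OF assms, of 1] by (simp add: field_simps)
qed

lemma frac_eval_star:
  assumes "regular_at Z a"
  shows "frac_eval Z (fract_star a) = cnj (frac_eval Z a)"
proof -
  obtain p q where *: "poly_eval Z q \<noteq> 0" "a = Fract p q"
    using assms unfolding regular_at_def by blast
  then have "poly_eval Z (poly_star q) \<noteq> 0" by (simp add: poly_eval_star)
  with * show ?thesis by (simp add: fract_star_Fract frac_eval_Fract poly_eval_star)
qed

lemma frac_algebra_regular:
  assumes Z: "\<And>k. k \<in> {1..m} \<Longrightarrow> poly_eval Z (f k) \<noteq> 0" and a: "a \<in> frac_algebra d m f"
  shows "regular_at Z a"
  using a unfolding frac_algebra_def
proof (induction rule: generated_subalgebra.induct)
  case (scalar c)
  show ?case by (simp add: fconst_def frac_eval_to_fract)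
next
  case (generator g)
  then show ?case
    using Z by (auto simp: frac_generators_def frac_eval_to_fract poly_eval_star intro!: frac_eval_inverse)
qed (auto simp: frac_eval_add frac_eval_mult)

text \<open>Supplies the characters at which the nonnegativity of an element will be tested. The
  restriction to \<open>A\<close> meets the extensionality required of characters.\<close>

lemma point_evaluation_character:
  assumes Z: "\<And>k. k \<in> {1..m} \<Longrightarrow> poly_eval Z (f k) \<noteq> 0"
    and A: "A = frac_algebra d m f"
  shows "restrict (frac_eval Z) A \<in> comm_star_algebra.characters fconst fract_star A"
proof -
  interpret comm_star_algebra fconst fract_star A
    unfolding A by (rule comm_star_algebra_frac_algebra)
  have reg: "regular_at Z a" if "a \<in> A" for a
    using frac_algebra_regular[of m Z f a d] Z that unfolding A by blast
  have c: "frac_eval Z (fconst c) = c" for c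
    by (simp add: fconst_def frac_eval_to_fract poly_eval_pconst)
  then have 1: "frac_eval Z 1 = 1" by (metis fconst_1)
  show ?thesis
    unfolding characters_def linear_functional_def
    by (auto simp: closed reg frac_eval_add frac_eval_mult frac_eval_star c 1)
qed

section \<open>Positive functionals on which unitaries act as scalars\<close>

context comm_star_algebra
begin

text \<open>Congruence modulo the ideal of all \<open>a\<close> for which \<open>c \<mapsto> L (a c)\<close> vanishes.\<close>

definition cong_mod :: "('a \<Rightarrow> complex) \<Rightarrow> 'a \<Rightarrow> 'a \<Rightarrow> bool" where
  "cong_mod L a b \<longleftrightarrow> a \<in> A \<and> b \<in> A \<and> (\<forall>c\<in>A. L (a * c) = L (b * c))"

lemma cong_refl: "a \<in> A \<Longrightarrow> cong_mod L a a"
  by (simp add: cong_mod_def)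

lemma cong_sym: "cong_mod L a b \<Longrightarrow> cong_mod L b a"
  by (simp add: cong_mod_def)

lemma cong_trans [trans]: "cong_mod L a b \<Longrightarrow> cong_mod L b c \<Longrightarrow> cong_mod L a c"
  by (simp add: cong_mod_def)

lemma cong_value: "cong_mod L a b \<Longrightarrow> L a = L b"
  using one_closed by (auto simp: cong_mod_def dest: bspec[of _ _ 1])

lemma cong_add: "linear_functional L \<Longrightarrow> cong_mod L a b \<Longrightarrow> cong_mod L a' b' \<Longrightarrow> cong_mod L (a + a') (b + b')"
  by (simp add: cong_mod_def closed distrib_right lin_add)

lemma cong_diff: "linear_functional L \<Longrightarrow> cong_mod L a b \<Longrightarrow> cong_mod L a' b' \<Longrightarrow> cong_mod L (a - a') (b - b')"
  by (simp add: cong_mod_def closed left_diff_distrib lin_diff)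

lemma cong_mult:
  assumes "cong_mod L a b" "cong_mod L a' b'"
  shows "cong_mod L (a * a') (b * b')"
proof -
  have "L (a * a' * c) = L (b * b' * c)" if c: "c \<in> A" for c
  proof -
    have "L (a * (a' * c)) = L (b * (a' * c))"
      using assms c by (simp add: cong_mod_def closed)
    also have "\<dots> = L (a' * (b * c))" by (simp add: mult.left_commute)
    also have "\<dots> = L (b' * (b * c))"
      using assms c by (simp add: cong_mod_def closed)
    finally show ?thesis by (simp add: mult_ac)
  qed
  then show ?thesis using assms by (simp add: cong_mod_def closed)
qed

lemma cong_power: "cong_mod L a b \<Longrightarrow> cong_mod L (a ^ n) (b ^ n)"
  by (induction n) (auto intro: cong_mult cong_refl one_closed)

text \<open>Hermiticity of \<open>L\<close> makes its ideal stable under the involution.\<close>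

lemma cong_star:
  assumes L: "positive_functional L" and ab: "cong_mod L a b"
  shows "cong_mod L (star a) (star b)"
proof -
  have *: "L (star x * c) = cnj (L (x * star c))" if "x \<in> A" "c \<in> A" for x c
    using pos_star[OF L, of "x * star c"] that by (simp add: closed star_mult star_star)
  show ?thesis using ab by (simp add: cong_mod_def closed *)
qed

lemma cong_sc_imp_eq:
  assumes "linear_functional L" "f \<in> A" "L f \<noteq> 0" "cong_mod L (sc x) (sc y)"
  shows "x = y"
proof -
  have "L (sc x * f) = L (sc y * f)" using assms by (simp add: cong_mod_def)
  then show ?thesis using assms by (simp add: lin_scale)
qed

text \<open>An invertible element cannot become 0 modulo a proper ideal. This is why the point found
  from \<open>L\<close> avoids the zeros of the inverted polynomials and yields a character.\<close>

lemma cong_inverse: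
  assumes L: "linear_functional L" "f \<in> A" "L f \<noteq> 0"
    and g: "cong_mod L g (sc x)" "i \<in> A" "g * i = 1"
  shows "x \<noteq> 0" "cong_mod L i (sc (inverse x))"
proof -
  have 1: "cong_mod L 1 (sc x * i)"
    using cong_mult[OF g(1) cong_refl[OF g(2)]] g(3) by simp
  show "x \<noteq> 0"
  proof
    assume "x = 0"
    then have "cong_mod L (sc 1) (sc 0)" using 1 by (simp add: sc_one)
    then show False using cong_sc_imp_eq[OF L] by fastforce
  qed
  then have "sc (inverse x) * (sc x * i) = i"
    by (simp add: mult.assoc[symmetric] sc_mult[symmetric] sc_one)
  then show "cong_mod L i (sc (inverse x))"
    using cong_mult[OF cong_refl[OF sc_closed, of L "inverse x"] 1] by (simp add: cong_sym)
qed

text \<open>With \<open>i\<close> the inverse of \<open>g\<close>, the unitary is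
  \<open>star g * i\<close>. Its being a scalar \<open>l\<close> confines \<open>g\<close> to a
  fixed real line through the origin.\<close>

lemma cong_phase:
  assumes unit: "\<And>u. u \<in> A \<Longrightarrow> star u * u = 1 \<Longrightarrow> \<exists>l. cmod l = 1 \<and> (\<forall>a\<in>A. L (u * a) = l * L a)"
    and L: "linear_functional L" and g: "g \<in> A" "i \<in> A" "g * i = 1"
  obtains l where "cmod l = 1" "cong_mod L (star g) (sc l * g)"
proof -
  define u where "u = star g * i"
  have "star g * star i = 1"
    using star_mult[OF g(1,2)] g(3) by simp
  then have "star u * u = 1"
    using g by (simp add: u_def closed star_mult star_star) (metis mult.assoc mult.commute mult_1_right)
  then obtain l where l: "cmod l = 1" "\<forall>a\<in>A. L (u * a) = l * L a"
    using unit[of u] g by (auto simp: u_def closed)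
  then have "cong_mod L u (sc l)"
    using g L by (simp add: cong_mod_def u_def closed lin_scale)
  from cong_mult[OF this cong_refl[OF g(1)]] have "cong_mod L (u * g) (sc l * g)" .
  moreover have "u * g = star g"
    using g(3) by (simp add: u_def mult.assoc mult.commute[of i])
  ultimately show thesis using l by (intro that[of l]) auto
qed

text \<open>The phase of \<open>z + sc p\<close> gives an affine relation: \<open>star z\<close> is
  congruent to \<open>l p * z + (l p * p - cnj p)\<close>. Two relations of different slope
  eliminate \<open>star z\<close> and determine \<open>z\<close>. If all three slopes agree, so do
  the three constants, and that places \<open>u\<close>, \<open>v\<close>, \<open>w\<close> on one
  line.\<close>

lemma cong_point_of_phases:
  assumes unit: "\<And>u. u \<in> A \<Longrightarrow> star u * u = 1 \<Longrightarrow> \<exists>l. cmod l = 1 \<and> (\<forall>a\<in>A. L (u * a) = l * L a)"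
    and L: "linear_functional L" "f \<in> A" "L f \<noteq> 0"
    and z: "z \<in> A" and nc: "\<not> collinear {u, v, w}"
    and inv: "\<And>p. p \<in> {u, v, w} \<Longrightarrow> \<exists>i\<in>A. (z + sc p) * i = 1"
  obtains c where "cong_mod L z (sc c)"
proof -
  have "\<exists>l. cong_mod L (star z) (sc l * z + sc (l * p - cnj p))" if p: "p \<in> {u, v, w}" for p
  proof -
    obtain i where i: "i \<in> A" "(z + sc p) * i = 1" using inv[OF p] by blast
    have zp: "z + sc p \<in> A" using z by (simp add: closed)
    obtain l where "cong_mod L (star (z + sc p)) (sc l * (z + sc p))"
      using cong_phase[OF unit L(1) zp i] by blast
    from cong_diff[OF L(1) this cong_refl[OF sc_closed[of "cnj p"]]]
    have "cong_mod L (star z) (sc l * z + sc (l * p - cnj p))"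
      using z by (simp add: star_add star_sc closed sc_diff sc_mult algebra_simps)
    then show ?thesis by blast
  qed
  then obtain l where l: "\<And>p. p \<in> {u, v, w} \<Longrightarrow> cong_mod L (star z) (sc (l p) * z + sc (l p * p - cnj p))"
    by metis
  have dif: "cong_mod L (sc (l p - l q) * z) (sc ((l q * q - cnj q) - (l p * p - cnj p)))"
    if "p \<in> {u, v, w}" "q \<in> {u, v, w}" for p q
  proof -
    have "cong_mod L (sc (l p) * z + sc (l p * p - cnj p)) (sc (l q) * z + sc (l q * q - cnj q))"
      using l[OF that(1)] l[OF that(2)] cong_sym cong_trans by blast
    from cong_diff[OF L(1) this cong_refl[of "sc (l p * p - cnj p) + sc (l q) * z"]]
    show ?thesis using z by (simp add: closed sc_diff sc_add algebra_simps)
  qed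
  show thesis
  proof (cases "l u = l v \<and> l u = l w")
    case True
    have k0: "l u * q - cnj q = l u * p - cnj p" if "p \<in> {u, v, w}" "q \<in> {u, v, w}" for p q
    proof -
      have "cong_mod L (sc 0) (sc ((l q * q - cnj q) - (l p * p - cnj p)))"
        using dif[OF that] that True by auto
      from cong_sc_imp_eq[OF L this] show ?thesis using that True by auto
    qed
    have k: "l u * q - cnj q - (l u * p - cnj p) = 0" if "p \<in> {u, v, w}" "q \<in> {u, v, w}" for p q
      by (simp only: k0[OF that] diff_self)
    have h: "l u * (q - p) = cnj (q - p)" if "p \<in> {u, v, w}" "q \<in> {u, v, w}" for p q
      using k[OF that] by (simp add: algebra_simps)
    have "l u * (u - v) = cnj (u - v)" "l u * (w - v) = cnj (w - v)"
      by (rule h; simp)+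
    \<comment> \<open>Conjugation multiplies both differences by the same number \<open>l u\<close>,
      so their quotient is real.\<close>
    then have e: "cnj (u - v) * (w - v) = (u - v) * cnj (w - v)"
      by (metis mult.assoc mult.commute)
    have "collinear {0, u - v, w - v}"
    proof (cases "u = v")
      case False
      then have "cnj ((w - v) / (u - v)) = (w - v) / (u - v)"
        using e by (simp add: field_simps)
      then have "(w - v) / (u - v) \<in> \<real>" by (simp only: Reals_cnj_iff)
      then show ?thesis by (simp add: collinear_iff_Reals)
    qed simp
    then have "collinear {u, v, w}" by (simp add: collinear_3[symmetric])
    then show ?thesis using nc by blast
  next
    case False
    then obtain p q where pq: "p \<in> {u, v, w}" "q \<in> {u, v, w}" "l p \<noteq> l q" by auto
    let ?k = "inverse (l p - l q)"
    have "cong_mod L (sc ?k * (sc (l p - l q) * z)) (sc ?k * sc ((l q * q - cnj q) - (l p * p - cnj p)))"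
      by (intro cong_mult dif pq cong_refl sc_closed)
    moreover have "sc ?k * (sc (l p - l q) * z) = z"
      using pq(3) by (simp add: mult.assoc[symmetric] sc_mult[symmetric] sc_one)
    ultimately show ?thesis
      by (intro that) (simp add: sc_mult[symmetric])
  qed
qed

section \<open>Polynomials in one element of the algebra\<close>

lemma map_poly_sc_pCons: "map_poly sc (pCons c p) = pCons (sc c) (map_poly sc p)"
  by (simp add: map_poly_pCons)

definition sc_poly :: "complex poly \<Rightarrow> 'a \<Rightarrow> 'a" where
  "sc_poly p r = poly (map_poly sc p) r"

lemma sc_poly_pCons [simp]: "sc_poly (pCons c p) r = sc c + r * sc_poly p r"
  by (simp add: sc_poly_def map_poly_sc_pCons)

lemma sc_poly_0 [simp]: "sc_poly 0 r = 0"
  by (simp add: sc_poly_def)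

lemma sc_poly_closed: "r \<in> A \<Longrightarrow> sc_poly p r \<in> A"
  by (induction p) (auto simp: closed)

lemma sc_poly_add: "sc_poly (p + q) r = sc_poly p r + sc_poly q r"
proof (induction p arbitrary: q)
  case (pCons c p)
  obtain d q' where "q = pCons d q'" by (rule pCons_cases)
  then show ?case using pCons.IH[of q'] by (simp add: sc_add algebra_simps)
qed simp

lemma sc_poly_smult: "sc_poly (smult c p) r = sc c * sc_poly p r"
  by (induction p) (auto simp: sc_mult algebra_simps)

lemma sc_poly_mult: "sc_poly (p * q) r = sc_poly p r * sc_poly q r"
  by (induction p) (auto simp: sc_poly_add sc_poly_smult algebra_simps)

lemma sc_poly_monom: "sc_poly (monom 1 n) r = r ^ n"
  by (induction n) (auto simp: monom_0 monom_Suc sc_one)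

text \<open>Only a congruence, because \<open>r\<close> is hermitian merely modulo the ideal of
  \<open>L\<close>.\<close>

lemma sc_poly_cnj_cong:
  assumes L: "positive_functional L" and r: "cong_mod L (star r) r"
  shows "cong_mod L (star (sc_poly p r)) (sc_poly (map_poly cnj p) r)"
proof (induction p)
  case 0
  show ?case using cong_refl[OF zero_closed] by simp
next
  case (pCons c p)
  have rA: "r \<in> A" using r by (simp add: cong_mod_def)
  have "cong_mod L (sc (cnj c) + star r * star (sc_poly p r)) (sc (cnj c) + r * sc_poly (map_poly cnj p) r)"
    by (intro cong_add cong_mult pos_lin L r pCons.IH cong_refl sc_closed)
  then show ?case
    using rA by (simp add: map_poly_pCons star_add star_mult star_sc closed sc_poly_closed)
qed

end

section \<open>Laurent polynomials in one hermitian unit\<close>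

lemma (in comm_star_algebra) star_power: "x \<in> A \<Longrightarrow> star (x ^ n) = star x ^ n"
  by (induction n) (auto simp: star_mult closed)

text \<open>Here \<open>a\<close> behaves like \<open>Q / X ^ N\<close> at \<open>r\<close>. A
  further factor \<open>X ^ N\<close> turns \<open>Q\<close> into \<open>X ^ (2 * N)\<close> times
  the values of \<open>a\<close>, so the sign of \<open>t ^ N\<close> drops out and the product is
  nonnegative on the whole line. If it equals \<open>q * map_poly cnj q\<close>, then
  \<open>b = s ^ N * sc_poly q r\<close> gives \<open>a\<close> as \<open>star b * b\<close> modulo
  the ideal.\<close>

lemma (in comm_star_algebra) laurent_nonneg:
  assumes L: "positive_functional L" and r: "cong_mod L (star r) r" and s: "s \<in> A" "r * s = 1"
    and a: "a \<in> A" and Q: "cong_mod L (r ^ N * a) (sc_poly Q r)"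
    and nonneg: "\<And>t::real. t \<noteq> 0 \<Longrightarrow> \<exists>x\<in>\<real>\<^sub>\<ge>\<^sub>0. of_real t ^ N * x = poly Q (of_real t)"
  shows "L a \<in> \<real>\<^sub>\<ge>\<^sub>0"
proof -
  note lin = pos_lin[OF L]
  have rA: "r \<in> A" using r by (simp add: cong_mod_def)
  define P where "P = monom 1 N * Q"
  have nn: "poly P (of_real t) \<in> \<real>\<^sub>\<ge>\<^sub>0" if t: "t \<noteq> 0" for t
  proof -
    obtain x where x: "x \<in> \<real>\<^sub>\<ge>\<^sub>0" "of_real t ^ N * x = poly Q (of_real t)"
      using nonneg[OF t] by blast
    then have "poly P (of_real t) = of_real ((t ^ N)\<^sup>2) * x"
      by (simp add: P_def poly_monom power2_eq_square flip: x(2))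
    moreover have "of_real ((t ^ N)\<^sup>2) \<in> (\<real>\<^sub>\<ge>\<^sub>0 :: complex set)"
      by (simp only: nonneg_Reals_of_real_iff zero_le_power2)
    ultimately show ?thesis using x(1) by (simp only: nonneg_Reals_mult_I)
  qed
  have "poly P (of_real t) \<in> \<real>\<^sub>\<ge>\<^sub>0" for t
  proof (cases "t = 0")
    case True
    show ?thesis
      by (rule poly_of_real_at_right) (use nn True in auto)
  qed (rule nn)
  then obtain q where q: "P = q * map_poly cnj q"
    using nonneg_poly_on_reals_is_square by blast
  \<comment> \<open>Inverses are unique also modulo the ideal, so the inverse \<open>s\<close> of
    \<open>r\<close> is hermitian there too.\<close>
  have "cong_mod L (star (r * s)) (r * star s)"
    unfolding star_mult[OF rA s(1)] by (intro cong_mult r cong_refl star_closed s)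
  then have 1: "cong_mod L 1 (r * star s)" using s by simp
  have "cong_mod L (s * 1) (s * (r * star s))"
    by (intro cong_mult cong_refl 1 s)
  then have ss: "cong_mod L s (star s)"
    using s by (simp add: mult.assoc[symmetric] mult.commute[of s])
  define b where "b = s ^ N * sc_poly q r"
  have bA: "b \<in> A" by (simp add: b_def closed sc_poly_closed rA s)
  have "a = s ^ N * s ^ N * (r ^ N * (r ^ N * a))"
  proof -
    have "s ^ N * s ^ N * (r ^ N * (r ^ N * a)) = (r * s) ^ N * ((r * s) ^ N * a)"
      by (simp add: power_mult_distrib mult_ac)
    then show ?thesis by (simp add: s)
  qed
  moreover have "cong_mod L (s ^ N * s ^ N * (r ^ N * (r ^ N * a))) (star s ^ N * s ^ N * (r ^ N * sc_poly Q r))"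
    by (intro cong_mult cong_power ss cong_refl Q) (simp_all add: closed s rA)
  ultimately have "cong_mod L a (star s ^ N * s ^ N * (r ^ N * sc_poly Q r))" by simp
  moreover have "r ^ N * sc_poly Q r = sc_poly q r * sc_poly (map_poly cnj q) r"
    by (simp add: q[unfolded P_def, symmetric] sc_poly_monom flip: sc_poly_mult) (simp add: sc_poly_mult sc_poly_monom)
  ultimately have "cong_mod L a (star s ^ N * s ^ N * (sc_poly q r * sc_poly (map_poly cnj q) r))" by simp
  moreover have "cong_mod L (star s ^ N * s ^ N * (sc_poly q r * sc_poly (map_poly cnj q) r)) (star s ^ N * s ^ N * (sc_poly q r * star (sc_poly q r)))"
    by (intro cong_mult cong_refl cong_sym[OF sc_poly_cnj_cong[OF L r]]) (simp_all add: closed s rA sc_poly_closed)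
  moreover have "star s ^ N * s ^ N * (sc_poly q r * star (sc_poly q r)) = star b * b"
    by (simp add: b_def star_mult star_power closed sc_poly_closed rA s mult_ac)
  ultimately have "cong_mod L a (star b * b)" using cong_trans by metis
  then have "L a = L (star b * b)" by (rule cong_value)
  then show ?thesis using pos_square[OF L bA] by simp
qed

text \<open>The extremal functional \<open>L\<close> and the characters are linked by one Laurent
  polynomial, which describes both the class of \<open>h\<close> modulo the ideal of
  \<open>L\<close> and the values of \<open>h\<close> at the points \<open>Z t\<close>.
  Nonnegativity at these points thereby becomes a statement about \<open>L h\<close>.\<close>

lemma nonneg_on_characters_imp_Re_nonneg:
  fixes d m :: nat and u v w :: "nat \<Rightarrow> complex" and f :: "nat \<Rightarrow> cpoly"
  assumes d: "d \<ge> 2" and m: "m = 3 * d - 2"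
    and nc: "\<forall>j\<in>{1..d-1}. \<not> collinear {u j, v j, w j}"
    and fu: "\<forall>j\<in>{1..d-1}. f (3 * j - 2) = zvar j + pconst (u j)"
    and fv: "\<forall>j\<in>{1..d-1}. f (3 * j - 1) = zvar j + pconst (v j)"
    and fw: "\<forall>j\<in>{1..d-1}. f (3 * j) = zvar j + pconst (w j)"
    and fd: "f (3 * d - 2) = zvar d"
    and A: "A = frac_algebra d m f"
    and L0: "comm_star_algebra.positive_functional fconst fract_star A L0"
    and h: "h \<in> A" and nonneg: "\<And>\<phi>. \<phi> \<in> comm_star_algebra.characters fconst fract_star A \<Longrightarrow> \<phi> h \<in> \<real>\<^sub>\<ge>\<^sub>0"
  shows "Re (L0 h) \<ge> 0"
proof (rule ccontr)
  assume neg: "\<not> Re (L0 h) \<ge> 0"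
  interpret comm_star_algebra fconst fract_star A
    unfolding A by (rule comm_star_algebra_frac_algebra)
  define G where "G = frac_generators d m f"
  have AG: "A = generated_subalgebra fconst G" by (simp add: A frac_algebra_def G_def)
  have GA: "g \<in> A" if "g \<in> G" for g using that by (simp add: AG generated_subalgebra.generator)
  have "countable G" by (simp add: G_def frac_generators_def countable_finite)
  then obtain L where L: "positive_functional L" "Re (L h) < 0" and
    unit: "\<And>u. u \<in> A \<Longrightarrow> fract_star u * u = 1 \<Longrightarrow> \<exists>l. cmod l = 1 \<and> (\<forall>a\<in>A. L (u * a) = l * L a)"
    using extremal_functional[OF AG _ L0 h] neg by (auto simp: not_le)
  note lin = pos_lin[OF L(1)]
  have Lh: "L h \<noteq> 0" using L(2) by auto

  define zz where "zz j = to_fract (zvar j)" for j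
  define iv where "iv k = inverse (to_fract (f k))" for k
  have zzA: "zz j \<in> A" if "j \<in> {1..d}" for j
    using that by (intro GA) (auto simp: G_def frac_generators_def zz_def)
  have ivA: "iv k \<in> A" if "k \<in> {1..m}" for k
    using that by (intro GA) (auto simp: G_def frac_generators_def iv_def)
  have k_cases: "k = 3 * d - 2 \<or> (\<exists>j\<in>{1..d-1}. \<exists>p\<in>{u j, v j, w j}. f k = zvar j + pconst p)"
    if k: "k \<in> {1..m}" for k
  proof (cases "k = 3 * d - 2")
    case False
    \<comment> \<open>The three indices \<open>3 * j - 2\<close>, \<open>3 * j - 1\<close>,
      \<open>3 * j\<close> of block \<open>j\<close> are exactly those with
      \<open>(k + 2) div 3 = j\<close>.\<close>
    define j where "j = (k + 2) div 3"
    have "k = 3 * j - 2 \<or> k = 3 * j - 1 \<or> k = 3 * j" "j \<ge> 1" "j \<le> d - 1"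
      using k m d False unfolding j_def by (simp_all, presburger+)
    then show ?thesis using fu fv fw by (intro disjI2 bexI[of _ j]) auto
  qed simp
  have p_index: "\<exists>k\<in>{1..m}. f k = zvar j + pconst p" if "j \<in> {1..d-1}" "p \<in> {u j, v j, w j}" for j p
  proof -
    have "3 * j - 2 \<in> {1..m}" "3 * j - 1 \<in> {1..m}" "3 * j \<in> {1..m}"
      using that(1) m d by auto
    then show ?thesis using that fu fv fw by (metis insertE singletonD)
  qed
  \<comment> \<open>Each polynomial takes the value 1 at an explicit point, so it can be inverted in
    the field of fractions.\<close>
  have f_nz: "to_fract (f k) \<noteq> 0" if "k \<in> {1..m}" for k
  proof -
    have "\<exists>Z. poly_eval Z (f k) \<noteq> 0"
      using k_cases[OF that]
    proof (elim disjE bexE)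
      assume "k = 3 * d - 2"
      then show ?thesis using fd by (intro exI[of _ "\<lambda>_. 1"]) (simp add: poly_eval_zvar)
    next
      fix j p assume "f k = zvar j + pconst p"
      then show ?thesis
        by (intro exI[of _ "\<lambda>_. 1 - p"]) (simp add: poly_eval_zvar poly_eval_add poly_eval_pconst)
    qed
    then show ?thesis using poly_eval_nz by auto
  qed
  have f_iv: "to_fract (f k) * iv k = 1" if "k \<in> {1..m}" for k
    using f_nz[OF that] by (simp add: iv_def)
  have zp: "to_fract (f k) = zz j + fconst p" if "f k = zvar j + pconst p" for j p k
    by (simp add: that zz_def fconst_def)
  have dm: "3 * d - 2 \<in> {1..m}" using m d by auto
  have zd_iv: "zz d * iv (3 * d - 2) = 1"
    using f_iv[OF dm] fd by (simp add: zz_def)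

  have "\<exists>c. cong_mod L (zz j) (fconst c)" if j: "j \<in> {1..d-1}" for j
  proof -
    have "\<exists>i\<in>A. (zz j + fconst p) * i = 1" if p: "p \<in> {u j, v j, w j}" for p
    proof -
      obtain k where k: "k \<in> {1..m}" "f k = zvar j + pconst p" using p_index[OF j p] by blast
      show ?thesis using f_iv[OF k(1)] ivA[OF k(1)] unfolding zp[OF k(2)] by blast
    qed
    moreover have "zz j \<in> A" using j by (intro zzA) auto
    ultimately show ?thesis
      using cong_point_of_phases[OF unit lin h Lh, of "zz j" "u j" "v j" "w j"] nc j by blast
  qed
  then obtain c where c: "\<And>j. j \<in> {1..d-1} \<Longrightarrow> cong_mod L (zz j) (fconst (c j))" by metis
  have cp: "c j + p \<noteq> 0 \<and> cong_mod L (iv k) (fconst (inverse (c j + p)))"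
    if "j \<in> {1..d-1}" "k \<in> {1..m}" "f k = zvar j + pconst p" for j k p
  proof -
    have "cong_mod L (zz j + fconst p) (fconst (c j + p))"
      unfolding fconst_add by (intro cong_add lin c that cong_refl sc_closed)
    from cong_inverse[OF lin h Lh this ivA[OF that(2)] f_iv[OF that(2), unfolded zp[OF that(3)]]]
    show ?thesis by blast
  qed

  have dd: "d \<in> {1..d}" using d by simp
  obtain l where l: "cmod l = 1" "cong_mod L (fract_star (zz d)) (fconst l * zz d)"
    using cong_phase[OF unit lin zzA[OF dd] ivA[OF dm] zd_iv] by blast
  \<comment> \<open>Half of the phase is moved into the coordinate: \<open>fract_star (zz d)\<close>
    is congruent to \<open>l * zz d\<close>, so multiplying \<open>zz d\<close> by a square root of
    \<open>l\<close> produces an element that is hermitian modulo the ideal.\<close>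
  define \<omega> where "\<omega> = csqrt l"
  have \<omega>2: "\<omega> * \<omega> = l" by (simp add: \<omega>_def flip: power2_eq_square)
  have "(cmod \<omega>)\<^sup>2 = 1" using l(1) by (simp add: \<omega>_def flip: norm_power)
  then have "\<omega> * cnj \<omega> = 1" by (simp add: complex_norm_square[symmetric])
  then have \<omega>: "cnj \<omega> * \<omega> = 1" by (simp add: mult.commute)
  define r where "r = fconst \<omega> * zz d"
  define s where "s = fconst (cnj \<omega>) * iv (3 * d - 2)"
  have rA: "r \<in> A" and sA: "s \<in> A"
    by (simp_all add: r_def s_def closed zzA[OF dd] ivA[OF dm])
  have rs: "r * s = 1"
  proof -
    have "r * s = fconst (cnj \<omega> * \<omega>) * (zz d * iv (3 * d - 2))"
      unfolding r_def s_def fconst_mult by (simp only: mult_ac)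
    then show ?thesis by (simp only: \<omega> zd_iv fconst_1 mult_1)
  qed
  have zd_r: "zz d = fconst (cnj \<omega>) * r"
    using \<omega> by (simp add: r_def fconst_1 mult.assoc[symmetric] flip: fconst_mult)
  have star_r: "cong_mod L (fract_star r) r"
  proof -
    have "cong_mod L (fconst (cnj \<omega>) * fract_star (zz d)) (fconst (cnj \<omega>) * (fconst l * zz d))"
      by (intro cong_mult cong_refl sc_closed l)
    moreover have "fconst (cnj \<omega>) * (fconst l * zz d) = r"
      using \<omega> by (simp add: r_def mult.assoc[symmetric] flip: fconst_mult \<omega>2)
    moreover have "fconst (cnj \<omega>) * fract_star (zz d) = fract_star r"
      by (simp add: r_def fract_star_mult fract_star_fconst)
    ultimately show ?thesis by simp
  qed

  \<comment> \<open>The punctured line that is left: the first \<open>d - 1\<close> coordinates are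
    frozen at \<open>c j\<close>, and the last is chosen such that \<open>r\<close> takes the value
    \<open>t\<close>.\<close>
  define Z where "Z t j = (if j = d then cnj \<omega> * of_real t else c j)" for t :: real and j
  have \<omega>0: "\<omega> \<noteq> 0" using \<omega> by auto
  have Z_nz: "poly_eval (Z t) (f k) \<noteq> 0" if "t \<noteq> 0" "k \<in> {1..m}" for t k
    using k_cases[OF that(2)]
  proof (elim disjE bexE)
    assume "k = 3 * d - 2"
    then show ?thesis using fd \<omega>0 that by (simp add: poly_eval_zvar Z_def)
  next
    fix j p assume "j \<in> {1..d-1}" "f k = zvar j + pconst p"
    then show ?thesis
      using cp[of j k p] that by (auto simp: poly_eval_zvar poly_eval_add poly_eval_pconst Z_def)
  qed
  have char: "restrict (frac_eval (Z t)) A \<in> characters" if "t \<noteq> 0" for t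
    using point_evaluation_character[of m "Z t" f A d] Z_nz[OF that] A by blast
  have reg: "regular_at (Z t) a" if "t \<noteq> 0" "a \<in> A" for a t
    using frac_algebra_regular[of m "Z t" f a d] Z_nz[OF that(1)] that(2) A by blast

  \<comment> \<open>The same \<open>N\<close> and \<open>Q\<close> must serve the congruence and the
    point values, so the induction over the algebra carries both together; \<open>N\<close> bounds
    the order of the pole at 0.\<close>
  define lau where "lau a \<longleftrightarrow> (\<exists>N Q. cong_mod L (r ^ N * a) (sc_poly Q r) \<and>
      (\<forall>t. t \<noteq> 0 \<longrightarrow> of_real t ^ N * frac_eval (Z t) a = poly Q (of_real t)))" for a
  have lau_const: "lau a" if "cong_mod L a (fconst x)" "\<And>t. t \<noteq> 0 \<Longrightarrow> frac_eval (Z t) a = x" for a x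
    unfolding lau_def using that by (intro exI[of _ 0] exI[of _ "[:x:]"]) auto
  have lau_star: "lau (fract_star a)" if "lau a" "a \<in> A" for a
  proof -
    obtain N Q where NQ: "cong_mod L (r ^ N * a) (sc_poly Q r)"
      "\<And>t. t \<noteq> 0 \<Longrightarrow> of_real t ^ N * frac_eval (Z t) a = poly Q (of_real t)"
      using \<open>lau a\<close> unfolding lau_def by blast
    have "cong_mod L (r ^ N * fract_star a) (fract_star r ^ N * fract_star a)"
      by (intro cong_mult cong_power cong_sym[OF star_r] cong_refl star_closed that)
    also have "fract_star r ^ N * fract_star a = fract_star (r ^ N * a)"
      using rA that by (simp add: star_mult star_power closed)
    also have "cong_mod L (fract_star (r ^ N * a)) (fract_star (sc_poly Q r))"
      by (rule cong_star[OF L(1) NQ(1)])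
    also have "cong_mod L (fract_star (sc_poly Q r)) (sc_poly (map_poly cnj Q) r)"
      by (rule sc_poly_cnj_cong[OF L(1) star_r])
    finally have "cong_mod L (r ^ N * fract_star a) (sc_poly (map_poly cnj Q) r)" .
    moreover have "of_real t ^ N * frac_eval (Z t) (fract_star a) = poly (map_poly cnj Q) (of_real t)"
      if t: "t \<noteq> 0" for t
      using arg_cong[OF NQ(2)[OF t], of cnj] reg[OF t \<open>a \<in> A\<close>]
      by (simp add: frac_eval_star poly_map_poly_cnj)
    ultimately show ?thesis unfolding lau_def by blast
  qed
  have lau_z: "lau (zz j)" if j: "j \<in> {1..d}" for j
  proof (cases "j = d")
    case True
    have "cong_mod L (zz d) (sc_poly [:0, cnj \<omega>:] r)"
      using cong_refl[OF zzA[OF dd]] zd_r by (simp add: mult.commute)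
    then show ?thesis
      unfolding lau_def True
      by (intro exI[of _ 0] exI[of _ "[:0, cnj \<omega>:]"])
        (auto simp: zz_def frac_eval_to_fract poly_eval_zvar Z_def)
  next
    case False
    then show ?thesis
      using c[of j] j by (intro lau_const[of _ "c j"])
        (auto simp: zz_def frac_eval_to_fract poly_eval_zvar Z_def)
  qed
  have lau_iv: "lau (iv k)" if k: "k \<in> {1..m}" for k
    using k_cases[OF k]
  proof (elim disjE bexE)
    assume kd: "k = 3 * d - 2"
    have "r * iv k = fconst \<omega>"
      using zd_iv by (simp add: r_def kd mult.assoc)
    then have "cong_mod L (r ^ 1 * iv k) (sc_poly [:\<omega>:] r)"
      using cong_refl[OF sc_closed] by simp
    moreover have "of_real t ^ 1 * frac_eval (Z t) (iv k) = poly [:\<omega>:] (of_real t)" if t: "t \<noteq> 0" for t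
    proof -
      have "frac_eval (Z t) (iv k) = inverse (cnj \<omega> * of_real t)"
        using Z_nz[OF t k] fd by (simp add: iv_def frac_eval_inverse kd poly_eval_zvar Z_def)
      moreover have "inverse (cnj \<omega>) = \<omega>" using \<omega> by (rule inverse_unique)
      ultimately show ?thesis using t by simp
    qed
    ultimately show ?thesis unfolding lau_def by blast
  next
    fix j p assume j: "j \<in> {1..d-1}" "f k = zvar j + pconst p"
    have "frac_eval (Z t) (iv k) = inverse (c j + p)" if t: "t \<noteq> 0" for t
    proof -
      have "j \<noteq> d" using j d by auto
      then show ?thesis
        using frac_eval_inverse(2)[OF Z_nz[OF t k]]
        by (simp add: iv_def j(2) poly_eval_zvar poly_eval_add poly_eval_pconst Z_def del: to_fract_add)
    qed
    then show ?thesis using cp[OF j(1) k j(2)] by (intro lau_const[of _ "inverse (c j + p)"]) auto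
  qed
  have "lau a" if "a \<in> generated_subalgebra fconst G" for a
    using that
  proof (induction rule: generated_subalgebra.induct)
    case (scalar x)
    show ?case
    proof (rule lau_const[OF cong_refl[OF sc_closed]])
      show "frac_eval (Z t) (fconst x) = x" for t
        by (simp add: fconst_def frac_eval_to_fract poly_eval_pconst)
    qed
  next
    case (generator g)
    then consider j where "j \<in> {1..d}" "g = zz j" | j where "j \<in> {1..d}" "g = fract_star (zz j)"
      | k where "k \<in> {1..m}" "g = iv k" | k where "k \<in> {1..m}" "g = fract_star (iv k)"
      by (auto simp: G_def frac_generators_def zz_def iv_def fract_star_to_fract fract_star_inverse poly_star_zvar)
    then show ?case
    proof cases
      case 1 then show ?thesis using lau_z by simp
    next
      case 2 then show ?thesis using lau_star[OF lau_z zzA] by simp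
    next
      case 3 then show ?thesis using lau_iv by simp
    next
      case 4 then show ?thesis using lau_star[OF lau_iv ivA] by simp
    qed
  next
    case (add x y)
    then have xy: "x \<in> A" "y \<in> A" by (simp_all add: AG)
    obtain N Q where NQ: "cong_mod L (r ^ N * x) (sc_poly Q r)"
      "\<And>t. t \<noteq> 0 \<Longrightarrow> of_real t ^ N * frac_eval (Z t) x = poly Q (of_real t)"
      using add.IH(1) unfolding lau_def by blast
    obtain M P where MP: "cong_mod L (r ^ M * y) (sc_poly P r)"
      "\<And>t. t \<noteq> 0 \<Longrightarrow> of_real t ^ M * frac_eval (Z t) y = poly P (of_real t)"
      using add.IH(2) unfolding lau_def by blast
    have "cong_mod L (r ^ M * (r ^ N * x) + r ^ N * (r ^ M * y)) (r ^ M * sc_poly Q r + r ^ N * sc_poly P r)"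
      by (intro cong_add lin cong_mult cong_refl power_closed rA NQ MP)
    then have "cong_mod L (r ^ (N + M) * (x + y)) (sc_poly (monom 1 M * Q + monom 1 N * P) r)"
      by (simp add: sc_poly_add sc_poly_mult sc_poly_monom power_add algebra_simps)
    moreover have "of_real t ^ (N + M) * frac_eval (Z t) (x + y) = poly (monom 1 M * Q + monom 1 N * P) (of_real t)"
      if t: "t \<noteq> 0" for t
      using reg[OF t xy(1)] reg[OF t xy(2)]
      by (simp add: frac_eval_add poly_monom power_add algebra_simps flip: NQ(2)[OF t] MP(2)[OF t])
    ultimately show ?case unfolding lau_def by blast
  next
    case (mult x y)
    then have xy: "x \<in> A" "y \<in> A" by (simp_all add: AG)
    obtain N Q where NQ: "cong_mod L (r ^ N * x) (sc_poly Q r)"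
      "\<And>t. t \<noteq> 0 \<Longrightarrow> of_real t ^ N * frac_eval (Z t) x = poly Q (of_real t)"
      using mult.IH(1) unfolding lau_def by blast
    obtain M P where MP: "cong_mod L (r ^ M * y) (sc_poly P r)"
      "\<And>t. t \<noteq> 0 \<Longrightarrow> of_real t ^ M * frac_eval (Z t) y = poly P (of_real t)"
      using mult.IH(2) unfolding lau_def by blast
    have "cong_mod L ((r ^ N * x) * (r ^ M * y)) (sc_poly Q r * sc_poly P r)"
      by (intro cong_mult NQ MP)
    then have "cong_mod L (r ^ (N + M) * (x * y)) (sc_poly (Q * P) r)"
      by (simp add: sc_poly_mult power_add mult_ac)
    moreover have "of_real t ^ (N + M) * frac_eval (Z t) (x * y) = poly (Q * P) (of_real t)"
      if t: "t \<noteq> 0" for t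
      using reg[OF t xy(1)] reg[OF t xy(2)]
      by (simp add: frac_eval_mult power_add mult_ac flip: NQ(2)[OF t] MP(2)[OF t])
    ultimately show ?case unfolding lau_def by blast
  qed
  then have "lau h" using h AG by simp
  then obtain N Q where NQ: "cong_mod L (r ^ N * h) (sc_poly Q r)"
    "\<And>t. t \<noteq> 0 \<Longrightarrow> of_real t ^ N * frac_eval (Z t) h = poly Q (of_real t)"
    unfolding lau_def by blast
  have "L h \<in> \<real>\<^sub>\<ge>\<^sub>0"
  proof (rule laurent_nonneg[OF L(1) star_r sA rs h NQ(1)])
    fix t :: real assume t: "t \<noteq> 0"
    show "\<exists>x\<in>\<real>\<^sub>\<ge>\<^sub>0. of_real t ^ N * x = poly Q (of_real t)"
      using nonneg[OF char[OF t]] NQ(2)[OF t] h by auto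
  qed
  then show False using L(2) by (simp add: complex_nonneg_Reals_iff)
qed


text \<open>Such an \<open>h\<close> is real on the characters, so \<open>h - fract_star h\<close>
  vanishes there. The previous result applied to \<open>\<i>\<close> and \<open>- \<i>\<close> times
  this difference makes \<open>L0 h\<close> real.\<close>

lemma nonneg_on_characters_imp_nonneg:
  fixes d m :: nat and u v w :: "nat \<Rightarrow> complex" and f :: "nat \<Rightarrow> cpoly"
  assumes d: "d \<ge> 2" and m: "m = 3 * d - 2"
    and nc: "\<forall>j\<in>{1..d-1}. \<not> collinear {u j, v j, w j}"
    and fu: "\<forall>j\<in>{1..d-1}. f (3 * j - 2) = zvar j + pconst (u j)"
    and fv: "\<forall>j\<in>{1..d-1}. f (3 * j - 1) = zvar j + pconst (v j)"
    and fw: "\<forall>j\<in>{1..d-1}. f (3 * j) = zvar j + pconst (w j)"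
    and fd: "f (3 * d - 2) = zvar d"
    and A: "A = frac_algebra d m f"
    and L0: "comm_star_algebra.positive_functional fconst fract_star A L0"
    and h: "h \<in> A" and nonneg: "\<And>\<phi>. \<phi> \<in> comm_star_algebra.characters fconst fract_star A \<Longrightarrow> \<phi> h \<in> \<real>\<^sub>\<ge>\<^sub>0"
  shows "L0 h \<in> \<real>\<^sub>\<ge>\<^sub>0"
proof -
  interpret comm_star_algebra fconst fract_star A
    unfolding A by (rule comm_star_algebra_frac_algebra)
  note Re_nonneg = nonneg_on_characters_imp_Re_nonneg[OF d m nc fu fv fw fd A L0]
  note lin = pos_lin[OF L0]
  have "Re (L0 (fconst c * (h - fract_star h))) \<ge> 0" for c
  proof (rule Re_nonneg)
    fix \<phi> assume \<phi>: "\<phi> \<in> characters"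
    then have "linear_functional \<phi>" "\<phi> (fract_star h) = cnj (\<phi> h)"
      using h by (auto simp: characters_def)
    then show "\<phi> (fconst c * (h - fract_star h)) \<in> \<real>\<^sub>\<ge>\<^sub>0"
      using nonneg[OF \<phi>] h by (simp add: lin_scale lin_diff closed complex_nonneg_Reals_iff complex_eq_iff)
  qed (simp add: closed h)
  from this[of \<i>] this[of "- \<i>"] have "Im (L0 h) = 0"
    using h by (simp add: lin_scale[OF lin] lin_diff[OF lin] closed pos_star[OF L0])
  moreover have "Re (L0 h) \<ge> 0"
    by (rule Re_nonneg) (use h nonneg in auto)
  ultimately show ?thesis by (simp add: complex_nonneg_Reals_iff)
qed

section \<open>A space-filling curve\<close>

text \<open>A continuous function of period 2 that is 0 on [0, 1/3] and 1 on [2/3, 1]. On the Cantor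
  set it reads off whether the leading ternary digit is 0 or 2.\<close>

definition clipped_cosine :: "real \<Rightarrow> real" where
  "clipped_cosine x = min 1 (max 0 (1/2 - cos (pi * x)))"

lemma clipped_cosine_bounds: "0 \<le> clipped_cosine x" "clipped_cosine x \<le> 1"
  by (auto simp: clipped_cosine_def)

lemma clipped_cosine_periodic: "clipped_cosine (2 * of_nat n + x) = clipped_cosine x"
proof -
  have "cos (pi * (2 * of_nat n + x)) = cos (2 * of_nat n * pi + pi * x)"
    by (simp add: algebra_simps)
  also have "\<dots> = cos (pi * x)" by (subst cos_add) (simp add: cos_2npi sin_2npi)
  finally show ?thesis by (simp add: clipped_cosine_def)
qed

lemma cos_pi_mult_ge:
  assumes "0 \<le> x" "x \<le> 1/3"
  shows "cos (pi * x) \<ge> 1/2"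
proof -
  have "cos (pi / 3) \<le> cos (pi * x)"
    using assms by (intro cos_monotone_0_pi_le) (auto simp: field_simps)
  then show ?thesis by (simp add: cos_60)
qed

lemma clipped_cosine_digit:
  assumes "d \<in> {0, 1}" "0 \<le> x" "x \<le> 1"
  shows "clipped_cosine (2 * d / 3 + x / 3) = d"
proof (cases "d = 0")
  case True
  then show ?thesis
    using cos_pi_mult_ge[of "x / 3"] assms by (simp add: clipped_cosine_def)
next
  case False
  then have d: "d = 1" using assms by simp
  have "cos (pi * (1/3 - x/3)) \<ge> 1/2"
    using assms by (intro cos_pi_mult_ge) auto
  moreover have "pi * (2/3 + x/3) = pi - pi * (1/3 - x/3)" by (simp add: algebra_simps)
  then have "cos (pi * (2/3 + x/3)) = - cos (pi * (1/3 - x/3))" by (simp only: cos_pi_minus)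
  ultimately show ?thesis by (simp add: d clipped_cosine_def)
qed

definition ternary :: "(nat \<Rightarrow> real) \<Rightarrow> real" where
  "ternary a = suminf (\<lambda>k. 2 * a k / 3 ^ Suc k)"

lemma ternary_props:
  assumes a: "\<And>k. a k \<in> {0, 1}"
  shows "ternary a = 2 * a 0 / 3 + ternary (\<lambda>k. a (Suc k)) / 3" "0 \<le> ternary a" "ternary a \<le> 1"
proof -
  have g: "(\<lambda>k. 2 / 3 ^ Suc k :: real) sums 1"
    using sums_mult[OF geometric_sums[of "1/3::real"], of "2/3"] by (simp add: power_divide)
  have le: "0 \<le> 2 * x / 3 ^ Suc k" "2 * x / 3 ^ Suc k \<le> 2 / 3 ^ Suc k" if "x \<in> {0, 1}" for x :: real and k
    using that by auto
  have sm: "summable (\<lambda>k. 2 * b k / 3 ^ Suc k :: real)" if b: "\<And>k. b k \<in> {0, 1}" for b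
  proof (rule summable_comparison_test'[OF sums_summable[OF g]])
    show "norm (2 * b k / 3 ^ Suc k) \<le> 2 / 3 ^ Suc k" for k
      unfolding real_norm_def abs_of_nonneg[OF le(1)[OF b]] by (rule le(2)[OF b])
  qed
  show "ternary a = 2 * a 0 / 3 + ternary (\<lambda>k. a (Suc k)) / 3"
  proof -
    have "suminf (\<lambda>k. 2 * a (Suc k) / 3 ^ Suc k / 3) = suminf (\<lambda>k. 2 * a (Suc k) / 3 ^ Suc (Suc k))"
      by (simp add: mult_ac)
    also have "\<dots> = ternary a - 2 * a 0 / 3"
      unfolding ternary_def using suminf_split_head[OF sm[of a]] a by (simp only: power_Suc0_right)
    finally show ?thesis
      using suminf_divide[OF sm[of "\<lambda>k. a (Suc k)"], where c = 3] a unfolding ternary_def by simp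
  qed
  show "0 \<le> ternary a" unfolding ternary_def by (rule suminf_nonneg[OF sm[OF a] le(1)[OF a]])
  show "ternary a \<le> 1"
    unfolding ternary_def using suminf_le[OF le(2)[OF a] sm[OF a] sums_summable[OF g]]
    by (simp only: sums_unique[OF g, symmetric])
qed

text \<open>Multiplication by 3 shifts the digits. The integer split off is twice a digit, hence
  even, and it stays even under further multiplication by \<open>3 ^ n\<close>, so periodicity
  removes it.\<close>

lemma clipped_cosine_ternary:
  assumes "\<And>k. a k \<in> {0, 1}"
  shows "clipped_cosine (3 ^ n * ternary a) = a n"
  using assms
proof (induction n arbitrary: a)
  case 0
  then show ?case
    using clipped_cosine_digit[of "a 0" "ternary (\<lambda>k. a (Suc k))"] ternary_props[of a]
      ternary_props(2,3)[of "\<lambda>k. a (Suc k)"] by simp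
next
  case (Suc n)
  define e :: nat where "e = (if a 0 = 0 then 0 else 1)"
  have e: "a 0 = of_nat e" using Suc.prems[of 0] by (auto simp: e_def)
  have "3 ^ Suc n * ternary a = 3 ^ n * (3 * ternary a)" by simp
  also have "3 * ternary a = 2 * a 0 + ternary (\<lambda>k. a (Suc k))"
    using ternary_props(1)[of a, OF Suc.prems] by simp
  also have "3 ^ n * \<dots> = 2 * of_nat (3 ^ n * e) + 3 ^ n * ternary (\<lambda>k. a (Suc k))"
    by (simp add: e algebra_simps)
  finally show ?case
    using Suc.IH[of "\<lambda>k. a (Suc k)"] Suc.prems by (simp only: clipped_cosine_periodic)
qed

definition binary_digit :: "real \<Rightarrow> nat \<Rightarrow> real" where
  "binary_digit y k = of_int (\<lfloor>2 ^ Suc k * y\<rfloor> mod 2)"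

lemma binary_digit_01: "binary_digit y k \<in> {0, 1}"
proof -
  have "\<lfloor>2 ^ Suc k * y\<rfloor> mod 2 = 0 \<or> \<lfloor>2 ^ Suc k * y\<rfloor> mod 2 = 1" by presburger
  then show ?thesis by (auto simp: binary_digit_def)
qed

lemma binary_expansion:
  assumes "0 \<le> y" "y < 1"
  shows "(\<lambda>k. binary_digit y k / 2 ^ Suc k) sums y"
proof -
  \<comment> \<open>As \<open>0 \<le> y < 1\<close> there is no integer part, and the partial sums
    are the dyadic truncations of \<open>y\<close>.\<close>
  have partial: "(\<Sum>k<n. binary_digit y k / 2 ^ Suc k) = of_int \<lfloor>2 ^ n * y\<rfloor> / 2 ^ n" for n
  proof (induction n)
    case 0
    then show ?case using assms by (simp add: floor_eq_iff)
  next
    case (Suc n)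
    have fl: "\<lfloor>2 * x\<rfloor> = 2 * \<lfloor>x\<rfloor> + \<lfloor>2 * x\<rfloor> mod 2" for x :: real
    proof -
      have "\<lfloor>2 * x\<rfloor> = 2 * \<lfloor>x\<rfloor> \<or> \<lfloor>2 * x\<rfloor> = 2 * \<lfloor>x\<rfloor> + 1" by linarith
      then show ?thesis by presburger
    qed
    have "of_int \<lfloor>2 ^ Suc n * y\<rfloor> = 2 * of_int \<lfloor>2 ^ n * y\<rfloor> + binary_digit y n"
      using arg_cong[OF fl[of "2 ^ n * y"], of "of_int :: int \<Rightarrow> real"]
      by (simp add: binary_digit_def mult.assoc)
    then show ?case using Suc by (simp add: field_simps)
  qed
  have "(\<lambda>n. of_int \<lfloor>2 ^ n * y\<rfloor> / 2 ^ n) \<longlonglongrightarrow> y"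
  proof (rule tendsto_sandwich[of "\<lambda>n. y - (1/2) ^ n" _ _ "\<lambda>n. y"])
    show "\<forall>\<^sub>F n in sequentially. y - (1/2) ^ n \<le> of_int \<lfloor>2 ^ n * y\<rfloor> / 2 ^ n"
    proof (rule always_eventually, rule allI)
      fix n
      have "2 ^ n * y - 1 \<le> of_int \<lfloor>2 ^ n * y\<rfloor>" by linarith
      then have "(2 ^ n * y - 1) / 2 ^ n \<le> of_int \<lfloor>2 ^ n * y\<rfloor> / 2 ^ n"
        by (rule divide_right_mono) simp
      moreover have "(2 ^ n * y - 1) / 2 ^ n = y - (1/2) ^ n"
        by (simp add: diff_divide_distrib power_one_over)
      ultimately show "y - (1/2) ^ n \<le> of_int \<lfloor>2 ^ n * y\<rfloor> / 2 ^ n"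
        by (simp only:)
    qed
    show "\<forall>\<^sub>F n in sequentially. of_int \<lfloor>2 ^ n * y\<rfloor> / 2 ^ n \<le> y"
      by (intro always_eventually allI) (simp add: divide_le_eq mult.commute)
    have "(\<lambda>n. y - (1/2::real) ^ n) \<longlonglongrightarrow> y - 0"
      by (intro tendsto_intros LIMSEQ_realpow_zero) auto
    then show "(\<lambda>n. y - (1/2::real) ^ n) \<longlonglongrightarrow> y" by simp
  qed simp
  then show ?thesis unfolding sums_def partial .
qed

text \<open>
  Schoenberg's space-filling curve: if \<open>s\<close> has only the ternary digits \<open>0\<close> and \<open>2\<close>, then the \<open>k\<close>-th binary digit of the
  \<open>i\<close>-th coordinate is half of the ternary digit of \<open>s\<close> number \<open>prod_encode (i, k)\<close>.
\<close>

definition schoenberg :: "real \<Rightarrow> nat \<Rightarrow> real" where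
  "schoenberg s i = suminf (\<lambda>k. clipped_cosine (3 ^ prod_encode (i, k) * s) / 2 ^ Suc k)"

lemma schoenberg_curve:
  shows continuous_on_schoenberg: "continuous_on UNIV (\<lambda>s. schoenberg s i)"
    and schoenberg_nonneg: "0 \<le> schoenberg s i"
    and schoenberg_le_1: "schoenberg s i \<le> 1"
    and schoenberg_surj: "(\<And>i. 0 \<le> y i) \<Longrightarrow> (\<And>i. y i < 1) \<Longrightarrow> \<exists>s\<in>{0..1}. \<forall>i. schoenberg s i = y i"
proof -
  have g: "(\<lambda>k. 1 / 2 ^ Suc k :: real) sums 1"
    using power_half_series by (simp add: power_divide)
  let ?f = "\<lambda>k s. clipped_cosine (3 ^ prod_encode (i, k) * s) / 2 ^ Suc k"
  have le: "0 \<le> ?f k s" "?f k s \<le> 1 / 2 ^ Suc k" for k s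
    using clipped_cosine_bounds[of "3 ^ prod_encode (i, k) * s"] by (auto intro!: divide_right_mono)
  have nle: "norm (?f k s) \<le> 1 / 2 ^ Suc k" for k s
    unfolding real_norm_def abs_of_nonneg[OF le(1)] by (rule le(2))
  have sm: "summable (\<lambda>k. ?f k s)" for s
    by (rule summable_comparison_test'[OF sums_summable[OF g]]) (rule nle)
  have "uniform_limit UNIV (\<lambda>n s. \<Sum>k<n. ?f k s) (\<lambda>s. suminf (\<lambda>k. ?f k s)) sequentially"
    by (rule Weierstrass_m_test[OF nle sums_summable[OF g]])
  moreover have "continuous_on UNIV (\<lambda>s. ?f k s)" for k
    unfolding clipped_cosine_def by (intro continuous_intros) simp
  then have "\<forall>\<^sub>F n in sequentially. continuous_on UNIV (\<lambda>s. \<Sum>k<n. ?f k s)"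
    by (intro always_eventually allI continuous_on_sum)
  ultimately have "continuous_on UNIV (\<lambda>s. suminf (\<lambda>k. ?f k s))"
    by (intro uniform_limit_theorem[OF _ _ sequentially_bot])
  then show "continuous_on UNIV (\<lambda>s. schoenberg s i)" by (simp add: schoenberg_def)
  show "0 \<le> schoenberg s i" unfolding schoenberg_def by (rule suminf_nonneg[OF sm le(1)])
  show "schoenberg s i \<le> 1"
    unfolding schoenberg_def using suminf_le[OF le(2) sm sums_summable[OF g]]
    by (simp only: sums_unique[OF g, symmetric])
  show "\<exists>s\<in>{0..1}. \<forall>i. schoenberg s i = y i" if y: "\<And>i. 0 \<le> y i" "\<And>i. y i < 1"
  proof -
    define a where "a n = (case prod_decode n of (i, k) \<Rightarrow> binary_digit (y i) k)" for n
    have a: "a n \<in> {0, 1}" for n by (simp add: a_def binary_digit_01[simplified] split: prod.split)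
    have "schoenberg (ternary a) i = y i" for i
    proof -
      have "schoenberg (ternary a) i = suminf (\<lambda>k. binary_digit (y i) k / 2 ^ Suc k)"
        unfolding schoenberg_def clipped_cosine_ternary[of a, OF a] by (simp add: a_def)
      also have "\<dots> = y i" by (rule sums_unique[OF binary_expansion[of "y i"], symmetric]) (rule y)+
      finally show ?thesis .
    qed
    then show ?thesis using ternary_props(2,3)[of a] a by (intro bexI[of _ "ternary a"]) auto
  qed
qed

text \<open>Even and odd Schoenberg coordinates, stretched from [0, 1] to [-1, 1], serve as real and
  imaginary parts. The bound 2 is that of a square containing the unit disc.\<close>

corollary complex_space_filling_curve:
  obtains \<Gamma> :: "real \<Rightarrow> nat \<Rightarrow> complex" where
    "\<And>i. continuous_on UNIV (\<lambda>s. \<Gamma> s i)" "\<And>s i. cmod (\<Gamma> s i) \<le> 2"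
    "\<And>y. (\<And>i. cmod (y i) < 1) \<Longrightarrow> \<exists>s\<in>{0..1}. \<forall>i. \<Gamma> s i = y i"
proof
  let ?\<Gamma> = "\<lambda>s i. Complex (2 * schoenberg s (2 * i) - 1) (2 * schoenberg s (2 * i + 1) - 1)"
  show "continuous_on UNIV (\<lambda>s. ?\<Gamma> s i)" for i
    unfolding Complex_eq by (intro continuous_intros continuous_on_schoenberg)
  show "cmod (?\<Gamma> s i) \<le> 2" for s i
  proof -
    have "cmod (?\<Gamma> s i) \<le> \<bar>2 * schoenberg s (2 * i) - 1\<bar> + \<bar>2 * schoenberg s (2 * i + 1) - 1\<bar>"
      using cmod_le[of "?\<Gamma> s i"] by simp
    also have "\<dots> \<le> 1 + 1"
      using schoenberg_nonneg[of s "2 * i"] schoenberg_le_1[of s "2 * i"]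
        schoenberg_nonneg[of s "2 * i + 1"] schoenberg_le_1[of s "2 * i + 1"]
      by (intro add_mono) (simp_all add: abs_le_iff)
    finally show ?thesis by simp
  qed
  show "\<exists>s\<in>{0..1}. \<forall>i. ?\<Gamma> s i = y i" if y: "\<And>i. cmod (y i) < 1" for y
  proof -
    define x where "x n = ((if even n then Re (y (n div 2)) else Im (y (n div 2))) + 1) / 2" for n
    have b: "\<bar>Re (y i)\<bar> < 1" "\<bar>Im (y i)\<bar> < 1" for i
      using y[of i] abs_Re_le_cmod[of "y i"] abs_Im_le_cmod[of "y i"] by linarith+
    have "0 \<le> x n" "x n < 1" for n
      using b[of "n div 2"] by (auto simp: x_def abs_less_iff)
    then obtain s where s: "s \<in> {0..1}" "\<And>n. schoenberg s n = x n"
      using schoenberg_surj[of x] by blast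
    have x: "x (2 * i) = (Re (y i) + 1) / 2" "x (2 * i + 1) = (Im (y i) + 1) / 2" for i
      by (simp_all add: x_def)
    have "?\<Gamma> s i = y i" for i
      unfolding s(2) x by (rule complex_eqI) (simp_all add: add_divide_distrib)
    then have "\<forall>i. ?\<Gamma> s i = y i" ..
    then show ?thesis by (rule bexI[OF _ s(1)])
  qed
qed

section \<open>The Hahn--Banach theorem\<close>

definition fun_subspace :: "('x \<Rightarrow> real) set \<Rightarrow> bool" where
  "fun_subspace E \<longleftrightarrow> (\<lambda>_. 0) \<in> E \<and> (\<forall>f\<in>E. \<forall>g\<in>E. (\<lambda>x. f x + g x) \<in> E) \<and> (\<forall>c. \<forall>f\<in>E. (\<lambda>x. c * f x) \<in> E)"

definition sublinear_on :: "('x \<Rightarrow> real) set \<Rightarrow> (('x \<Rightarrow> real) \<Rightarrow> real) \<Rightarrow> bool" where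
  "sublinear_on E q \<longleftrightarrow> (\<forall>f\<in>E. \<forall>g\<in>E. q (\<lambda>x. f x + g x) \<le> q f + q g) \<and>
     (\<forall>c\<ge>0. \<forall>f\<in>E. q (\<lambda>x. c * f x) = c * q f)"

lemma sublinear_add: "sublinear_on E q \<Longrightarrow> f \<in> E \<Longrightarrow> g \<in> E \<Longrightarrow> q (\<lambda>x. f x + g x) \<le> q f + q g"
  and sublinear_scale: "sublinear_on E q \<Longrightarrow> c \<ge> 0 \<Longrightarrow> f \<in> E \<Longrightarrow> q (\<lambda>x. c * f x) = c * q f"
  by (auto simp: sublinear_on_def)

lemma fun_subspace_add: "fun_subspace E \<Longrightarrow> f \<in> E \<Longrightarrow> g \<in> E \<Longrightarrow> (\<lambda>x. f x + g x) \<in> E"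
  and fun_subspace_scale: "fun_subspace E \<Longrightarrow> f \<in> E \<Longrightarrow> (\<lambda>x. c * f x) \<in> E"
  and fun_subspace_zero: "fun_subspace E \<Longrightarrow> (\<lambda>_. 0) \<in> E"
  by (auto simp: fun_subspace_def)

lemma sublinear_zero: "sublinear_on E q \<Longrightarrow> fun_subspace E \<Longrightarrow> q (\<lambda>_. 0) = 0"
  using sublinear_scale[of E q 0 "\<lambda>_. 0"] fun_subspace_zero[of E] by simp

lemma sublinear_neg:
  assumes "fun_subspace E" "sublinear_on E q" "f \<in> E"
  shows "- q (\<lambda>x. - f x) \<le> q f"
  using sublinear_add[OF assms(2,3) fun_subspace_scale[OF assms(1,3), of "-1"]]
    sublinear_zero[OF assms(2,1)] by simp

text \<open>A minimal sublinear functional equals all its tilts \<open>q'\<close>, which forces it to be additive.\<close>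

lemma sublinear_tilt:
  assumes E: "fun_subspace E" and q: "sublinear_on E q" and y: "y \<in> E"
  defines "q' \<equiv> \<lambda>f. if f \<in> E then INF t\<in>{0..}. q (\<lambda>x. f x + t * y x) - t * q y else 0"
  shows "sublinear_on E q'" "\<And>f. f \<in> E \<Longrightarrow> q' f \<le> q f" "\<And>f. f \<in> E \<Longrightarrow> q' f \<le> q (\<lambda>x. f x + y x) - q y"
proof -
  note add = fun_subspace_add[OF E] and scale = fun_subspace_scale[OF E]
  let ?v = "\<lambda>f t. q (\<lambda>x. f x + t * y x) - t * q y"
  have bdd: "bdd_below (?v f ` {0..})" if f: "f \<in> E" for f
  proof (rule bdd_belowI2)
    fix t :: real assume t: "t \<in> {0..}"
    have nf: "(\<lambda>x. -1 * f x) \<in> E" by (rule scale[OF f])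
    have "q (\<lambda>x. (f x + t * y x) + -1 * f x) \<le> q (\<lambda>x. f x + t * y x) + q (\<lambda>x. -1 * f x)"
      by (intro sublinear_add[OF q] add f scale y)
    then show "- q (\<lambda>x. -1 * f x) \<le> ?v f t"
      using sublinear_scale[OF q, of t y] t y by simp
  qed
  have le: "q' f \<le> ?v f t" if "f \<in> E" "t \<ge> 0" for f t
    unfolding q'_def using that by (auto intro!: cINF_lower bdd)
  have ge: "c \<le> q' f" if "f \<in> E" "\<And>t. t \<ge> 0 \<Longrightarrow> c \<le> ?v f t" for f c
    unfolding q'_def using that by (auto intro!: cINF_greatest)
  show "q' f \<le> q f" if "f \<in> E" for f using le[OF that, of 0] by simp
  show "q' f \<le> q (\<lambda>x. f x + y x) - q y" if "f \<in> E" for f using le[OF that, of 1] by simp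
  show "sublinear_on E q'"
    unfolding sublinear_on_def
  proof (intro conjI ballI allI impI)
    fix f g assume f: "f \<in> E" and g: "g \<in> E"
    have "q' (\<lambda>x. f x + g x) \<le> ?v f t + ?v g s" if "t \<ge> 0" "s \<ge> 0" for t s
    proof -
      have "q' (\<lambda>x. f x + g x) \<le> ?v (\<lambda>x. f x + g x) (t + s)"
        using that by (intro le add f g) auto
      also have "(\<lambda>x. f x + g x + (t + s) * y x) = (\<lambda>x. (f x + t * y x) + (g x + s * y x))"
        by (simp add: algebra_simps)
      also have "q \<dots> - (t + s) * q y \<le> ?v f t + ?v g s"
        using sublinear_add[OF q add[OF f scale[OF y, of t]] add[OF g scale[OF y, of s]]]
        by (simp add: algebra_simps)
      finally show ?thesis .
    qed
    then have "q' (\<lambda>x. f x + g x) - ?v g s \<le> q' f" if "s \<ge> 0" for s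
      using that by (intro ge f) (auto simp: algebra_simps)
    then have "q' (\<lambda>x. f x + g x) - q' f \<le> q' g"
      by (intro ge g) (auto simp: algebra_simps)
    then show "q' (\<lambda>x. f x + g x) \<le> q' f + q' g" by simp
  next
    fix c :: real and f assume c: "c \<ge> 0" and f: "f \<in> E"
    have half: "q' (\<lambda>x. c * f x) \<le> c * q' f" if c: "c > 0" and f: "f \<in> E" for c f
    proof -
      have "q' (\<lambda>x. c * f x) / c \<le> q' f"
      proof (intro ge f)
        fix t :: real assume t: "t \<ge> 0"
        have "q' (\<lambda>x. c * f x) \<le> ?v (\<lambda>x. c * f x) (c * t)"
          using c t f by (intro le scale) auto
        also have "(\<lambda>x. c * f x + c * t * y x) = (\<lambda>x. c * (f x + t * y x))"
          by (simp add: algebra_simps)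
        also have "q \<dots> - c * t * q y = c * ?v f t"
          using sublinear_scale[OF q _ add[OF f scale[OF y, of t]], of c] c by (simp add: algebra_simps)
        finally show "q' (\<lambda>x. c * f x) / c \<le> ?v f t" using c by (simp add: field_simps)
      qed
      then show ?thesis using c by (simp add: field_simps)
    qed
    show "q' (\<lambda>x. c * f x) = c * q' f"
    proof (cases "c = 0")
      case True
      have "q' (\<lambda>x. 0) = 0"
      proof (rule antisym)
        show "q' (\<lambda>x. 0) \<le> 0"
          using le[OF fun_subspace_zero[OF E], of 0] sublinear_zero[OF q E] by simp
        show "0 \<le> q' (\<lambda>x. 0)"
          using sublinear_scale[OF q _ y] by (intro ge fun_subspace_zero[OF E]) auto
      qed
      then show ?thesis using True by simp
    next
      case False
      then have c: "c > 0" using c by simp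
      have "q' (\<lambda>x. inverse c * (c * f x)) \<le> inverse c * q' (\<lambda>x. c * f x)"
        by (rule half) (use c scale[OF f] in auto)
      then have "c * q' f \<le> q' (\<lambda>x. c * f x)"
        using c by (simp add: field_simps)
      then show ?thesis using half[OF c f] by simp
    qed
  qed
qed

text \<open>Zorn's lemma is applied downwards to the sublinear functionals below \<open>p\<close>,
  not to partial linear extensions. No functional on a subspace is prescribed; \<open>p\<close> will
  be chosen so that domination alone forces the desired values. Fixing the value 0 off
  \<open>E\<close> lets the pointwise order express comparison on \<open>E\<close>.\<close>

theorem hahn_banach_functions:
  assumes E: "fun_subspace E" and p: "sublinear_on E p"
  obtains l where "\<And>f g. f \<in> E \<Longrightarrow> g \<in> E \<Longrightarrow> l (\<lambda>x. f x + g x) = l f + l g"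
    "\<And>c f. f \<in> E \<Longrightarrow> l (\<lambda>x. c * f x) = c * l f" "\<And>f. f \<in> E \<Longrightarrow> l f \<le> p f"
proof -
  note add = fun_subspace_add[OF E] and scale = fun_subspace_scale[OF E]
  define S where "S = {q. sublinear_on E q \<and> (\<forall>f\<in>E. q f \<le> p f) \<and> (\<forall>f. f \<notin> E \<longrightarrow> q f = 0)}"
  have cutoff: "sublinear_on E (\<lambda>f. if f \<in> E then q f else 0)" if "sublinear_on E q" for q
    using that by (simp add: sublinear_on_def add scale)
  have "\<exists>q\<in>S. \<forall>q'\<in>S. (\<forall>f. q' f \<le> q f) \<longrightarrow> q' = q"
  proof (rule predicate_Zorn[where P = "\<lambda>q q'. \<forall>f. q' f \<le> q f"])
    show "partial_order_on S (relation_of (\<lambda>q q'. \<forall>f. q' f \<le> q f) S)"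
      by (rule partial_order_on_relation_ofI) (auto intro: order_trans intro!: ext antisym)
    fix C assume C: "C \<in> Chains (relation_of (\<lambda>q q'. \<forall>f. q' f \<le> q f) S)"
    then have CS: "C \<subseteq> S" by (auto simp: Chains_def relation_of_def)
    have chain: "(\<forall>f. q' f \<le> q f) \<or> (\<forall>f. q f \<le> q' f)" if "q \<in> C" "q' \<in> C" for q q'
      using C that by (auto simp: Chains_def relation_of_def)
    show "\<exists>u\<in>S. \<forall>q\<in>C. \<forall>f. u f \<le> q f"
    proof (cases "C = {}")
      case True
      then show ?thesis using cutoff[OF p] by (auto simp: S_def intro!: bexI[of _ "\<lambda>f. if f \<in> E then p f else 0"])
    next
      case False
      define u where "u f = (if f \<in> E then INF q\<in>C. q f else 0)" for f
      have sub: "sublinear_on E q" and qp: "f \<in> E \<Longrightarrow> q f \<le> p f" if "q \<in> C" for q f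
        using that CS by (auto simp: S_def)
      have bdd: "bdd_below ((\<lambda>q. q f) ` C)" if f: "f \<in> E" for f
      proof (rule bdd_belowI2)
        fix q assume q: "q \<in> C"
        have "q (\<lambda>x. -1 * f x) \<le> p (\<lambda>x. -1 * f x)" by (intro qp q scale f)
        then show "- p (\<lambda>x. -1 * f x) \<le> q f"
          using sublinear_neg[OF E sub[OF q] f] by simp
      qed
      have le: "u f \<le> q f" if "f \<in> E" "q \<in> C" for f q
        unfolding u_def using that by (auto intro!: cINF_lower bdd)
      have ge: "c \<le> u f" if "f \<in> E" "\<And>q. q \<in> C \<Longrightarrow> c \<le> q f" for f c
        unfolding u_def using that False by (auto intro!: cINF_greatest)
      have "sublinear_on E u"
        unfolding sublinear_on_def
      proof (intro conjI ballI allI impI)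
        fix f g assume f: "f \<in> E" and g: "g \<in> E"
        \<comment> \<open>One of two members of the chain lies below the other, and its
          subadditivity gives the mixed bound required for the infimum.\<close>
        have "u (\<lambda>x. f x + g x) \<le> q f + q' g" if q: "q \<in> C" "q' \<in> C" for q q'
          using chain[OF q]
        proof
          assume "\<forall>f. q' f \<le> q f"
          then show ?thesis
            using le[OF add[OF f g] q(2)] sublinear_add[OF sub[OF q(2)] f g] by (smt (verit))
        next
          assume "\<forall>f. q f \<le> q' f"
          then show ?thesis
            using le[OF add[OF f g] q(1)] sublinear_add[OF sub[OF q(1)] f g] by (smt (verit))
        qed
        then have "u (\<lambda>x. f x + g x) - q' g \<le> u f" if "q' \<in> C" for q'
          using that by (intro ge f) (auto simp: algebra_simps)
        then have "u (\<lambda>x. f x + g x) - u f \<le> u g"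
          by (intro ge g) (auto simp: algebra_simps)
        then show "u (\<lambda>x. f x + g x) \<le> u f + u g" by simp
      next
        fix c :: real and f assume c: "c \<ge> 0" and f: "f \<in> E"
        have "(INF q\<in>C. c * q f) = c * (INF q\<in>C. q f)"
        proof (cases "c = 0")
          case True
          then show ?thesis using False by simp
        next
          case c0: False
          show ?thesis
          proof (rule antisym)
            have "(INF q\<in>C. c * q f) / c \<le> (INF q\<in>C. q f)"
            proof (rule cINF_greatest[OF False])
              fix q assume "q \<in> C"
              have "bdd_below ((\<lambda>q. c * q f) ` C)"
                using bdd[OF f] c by (auto simp: bdd_below_def intro!: mult_left_mono)
              then have "(INF q\<in>C. c * q f) \<le> c * q f" using \<open>q \<in> C\<close> by (rule cINF_lower)
              then show "(INF q\<in>C. c * q f) / c \<le> q f" using c c0 by (simp add: field_simps)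
            qed
            then show "(INF q\<in>C. c * q f) \<le> c * (INF q\<in>C. q f)" using c c0 by (simp add: field_simps)
            show "c * (INF q\<in>C. q f) \<le> (INF q\<in>C. c * q f)"
              using c bdd[OF f] by (intro cINF_greatest[OF False] mult_left_mono cINF_lower) auto
          qed
        qed
        then show "u (\<lambda>x. c * f x) = c * u f"
          using f c scale[OF f, of c] sublinear_scale[OF sub] by (simp add: u_def cong: INF_cong_simp)
      qed
      moreover obtain q0 where "q0 \<in> C" using False by blast
      then have "\<forall>f\<in>E. u f \<le> p f" using le qp by (meson order_trans)
      ultimately have "u \<in> S" by (simp add: S_def u_def)
      moreover have "\<forall>q\<in>C. \<forall>f. u f \<le> q f"
        using le CS by (auto simp: u_def S_def)
      ultimately show ?thesis by blast
    qed
  qed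
  then obtain q where q: "q \<in> S" and min: "\<And>q'. q' \<in> S \<Longrightarrow> (\<And>f. q' f \<le> q f) \<Longrightarrow> q' = q" by blast
  have sub: "sublinear_on E q" and qp: "\<And>f. f \<in> E \<Longrightarrow> q f \<le> p f" and q0: "\<And>f. f \<notin> E \<Longrightarrow> q f = 0"
    using q by (auto simp: S_def)
  have qadd: "q (\<lambda>x. f x + y x) = q f + q y" if f: "f \<in> E" and y: "y \<in> E" for f y
  proof -
    define q' where "q' f = (if f \<in> E then INF t\<in>{0..}. q (\<lambda>x. f x + t * y x) - t * q y else 0)" for f
    note tilt = sublinear_tilt[OF E sub y, folded q'_def]
    have "q' = q"
    proof (rule min)
      have "q' f \<le> p f" if "f \<in> E" for f using tilt(2)[OF that] qp[OF that] by simp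
      moreover have "q' f = 0" if "f \<notin> E" for f using that by (simp add: q'_def)
      ultimately show "q' \<in> S" using tilt(1) by (simp add: S_def)
      show "q' f \<le> q f" for f using tilt(2) q0 by (cases "f \<in> E") (auto simp: q'_def)
    qed
    then have "q f \<le> q (\<lambda>x. f x + y x) - q y" using tilt(3)[OF f] by simp
    then show ?thesis using sublinear_add[OF sub f y] by simp
  qed
  have "q (\<lambda>x. c * f x) = c * q f" if f: "f \<in> E" for c f
  proof (cases "c \<ge> 0")
    case False
    have "q (\<lambda>x. c * f x + - c * f x) = q (\<lambda>x. c * f x) + q (\<lambda>x. - c * f x)"
      by (intro qadd scale f)
    then show ?thesis
      using sublinear_scale[OF sub, of "- c" f] f False sublinear_zero[OF sub E] by simp
  qed (use sublinear_scale[OF sub] f in auto)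
  with qadd qp show thesis by (intro that[of q]) auto
qed

section \<open>Haviland's theorem\<close>

text \<open>The functional assigns masses to the cells of a partition of [0, 1] pulled back along
  \<open>t\<close>, giving discrete distributions on the line; a weak limit of a subsequence
  represents \<open>l\<close> on continuous functions of \<open>t\<close>. It matters that
  \<open>l\<close> is defined on all bounded functions: cell indicators are not continuous, and
  \<open>t\<close> need not be measurable.\<close>

lemma representing_distribution:
  fixes l :: "('x \<Rightarrow> real) \<Rightarrow> real" and t :: "'x \<Rightarrow> real"
  defines "B \<equiv> \<lambda>X. {f. \<exists>b. \<forall>x\<in>X. \<bar>f x\<bar> \<le> b}"
  assumes add: "\<And>f g. f \<in> B X \<Longrightarrow> g \<in> B X \<Longrightarrow> l (\<lambda>x. f x + g x) = l f + l g"
    and scale: "\<And>c f. f \<in> B X \<Longrightarrow> l (\<lambda>x. c * f x) = c * l f"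
    and nonneg: "\<And>f. f \<in> B X \<Longrightarrow> (\<And>x. x \<in> X \<Longrightarrow> 0 \<le> f x) \<Longrightarrow> 0 \<le> l f"
    and one: "l (\<lambda>_. 1) = 1" and t: "\<And>x. x \<in> X \<Longrightarrow> t x \<in> {0..1}"
  obtains \<nu> where "real_distribution \<nu>"
    "\<And>h b. continuous_on UNIV h \<Longrightarrow> (\<And>s. \<bar>h s\<bar> \<le> b) \<Longrightarrow> l (\<lambda>x. h (t x)) = (LINT s|\<nu>. h s)"
proof -
  have BI: "f \<in> B X" if "\<And>x. x \<in> X \<Longrightarrow> \<bar>f x\<bar> \<le> b" for f and b :: real
    using that by (auto simp: B_def)
  have addB: "(\<lambda>x. f x + g x) \<in> B X" if fg: "f \<in> B X" "g \<in> B X" for f g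
  proof -
    obtain b c where "\<forall>x\<in>X. \<bar>f x\<bar> \<le> b" "\<forall>x\<in>X. \<bar>g x\<bar> \<le> c"
      using fg by (auto simp: B_def)
    then show ?thesis by (intro BI[of _ "b + c"]) (auto intro: order_trans[OF abs_triangle_ineq] add_mono)
  qed
  have scaleB: "(\<lambda>x. c * f x) \<in> B X" if f: "f \<in> B X" for f c
  proof -
    obtain b where "\<forall>x\<in>X. \<bar>f x\<bar> \<le> b" using f by (auto simp: B_def)
    then show ?thesis by (intro BI[of _ "\<bar>c\<bar> * b"]) (auto simp: abs_mult mult_left_mono)
  qed
  have constB: "(\<lambda>_. c) \<in> B X" for c by (rule BI[of _ "\<bar>c\<bar>"]) simp
  have const: "l (\<lambda>_. c) = c" for c
    using scale[OF constB, of c 1] one by simp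
  have mono: "l f \<le> l g" if fg: "f \<in> B X" "g \<in> B X" and le: "\<And>x. x \<in> X \<Longrightarrow> f x \<le> g x" for f g
  proof -
    have "0 \<le> l (\<lambda>x. g x + -1 * f x)"
      using le by (intro nonneg addB scaleB fg) auto
    also have "\<dots> = l g + -1 * l f"
      by (simp only: add[OF fg(2) scaleB[OF fg(1)]] scale[OF fg(1)])
    finally show ?thesis by simp
  qed
  have cong: "l f = l g" if "f \<in> B X" "g \<in> B X" "\<And>x. x \<in> X \<Longrightarrow> f x = g x" for f g
    using that by (intro antisym mono) auto
  have sum: "(\<lambda>x. \<Sum>i\<in>I. f i x) \<in> B X \<and> l (\<lambda>x. \<Sum>i\<in>I. f i x) = (\<Sum>i\<in>I. l (f i))"
    if "finite I" "\<And>i. f i \<in> B X" for I :: "nat set" and f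
    using that(1) by induction (use that(2) in \<open>auto simp: constB const add intro: addB\<close>)

  \<comment> \<open>Cells of width \<open>1 / Suc n\<close>. The value \<open>t x = 1\<close> falls
    into an additional cell with index \<open>Suc n\<close>, so all sums run up to
    \<open>Suc n\<close> inclusively.\<close>
  define ind where "ind n i x = (if nat \<lfloor>real (Suc n) * t x\<rfloor> = i then 1 else 0 :: real)" for n i x
  have indB: "ind n i \<in> B X" for n i by (rule BI[of _ 1]) (simp add: ind_def)
  define w where "w n i = l (ind n i)" for n i
  have w0: "0 \<le> w n i" for n i unfolding w_def by (intro nonneg indB) (simp add: ind_def)
  have cell: "nat \<lfloor>real (Suc n) * t x\<rfloor> \<le> Suc n"
    "\<bar>t x - real (nat \<lfloor>real (Suc n) * t x\<rfloor>) / real (Suc n)\<bar> \<le> 1 / real (Suc n)" if x: "x \<in> X" for n x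
  proof -
    let ?N = "real (Suc n)"
    have tx: "0 \<le> t x" "t x \<le> 1" using t[OF x] by auto
    have "?N * t x \<le> ?N" using mult_left_le[OF tx(2), of ?N] by simp
    then have "\<lfloor>?N * t x\<rfloor> \<le> int (Suc n)" by linarith
    then show "nat \<lfloor>?N * t x\<rfloor> \<le> Suc n" by (simp only: nat_le_iff)
    have p: "0 \<le> ?N * t x" using tx by simp
    then have r: "real (nat \<lfloor>?N * t x\<rfloor>) = of_int \<lfloor>?N * t x\<rfloor>" by simp
    have "\<bar>?N * t x - real (nat \<lfloor>?N * t x\<rfloor>)\<bar> \<le> 1" unfolding r by linarith
    then have "\<bar>?N * t x - real (nat \<lfloor>?N * t x\<rfloor>)\<bar> / ?N \<le> 1 / ?N" by (rule divide_right_mono) simp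
    moreover have "t x - real (nat \<lfloor>?N * t x\<rfloor>) / ?N = (?N * t x - real (nat \<lfloor>?N * t x\<rfloor>)) / ?N"
      by (simp add: diff_divide_distrib)
    ultimately show "\<bar>t x - real (nat \<lfloor>?N * t x\<rfloor>) / ?N\<bar> \<le> 1 / ?N"
      by (simp only: abs_divide abs_of_nat)
  qed
  have step: "(\<Sum>i\<le>Suc n. c i * ind n i x) = c (nat \<lfloor>real (Suc n) * t x\<rfloor>)" if "x \<in> X" for n x c
  proof -
    have "(\<Sum>i\<le>Suc n. c i * ind n i x) = (\<Sum>i\<le>Suc n. if nat \<lfloor>real (Suc n) * t x\<rfloor> = i then c i else 0)"
      by (intro sum.cong) (simp_all add: ind_def)
    also have "\<dots> = c (nat \<lfloor>real (Suc n) * t x\<rfloor>)"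
      using cell(1)[OF that, of n] by (subst sum.delta') auto
    finally show ?thesis .
  qed
  have l_step: "l (\<lambda>x. \<Sum>i\<le>Suc n. c i * ind n i x) = (\<Sum>i\<le>Suc n. c i * w n i)" for n c
    using sum[of "{..Suc n}" "\<lambda>i x. c i * ind n i x"] by (simp add: scaleB indB scale w_def)
  have stepB: "(\<lambda>x. \<Sum>i\<le>Suc n. c i * ind n i x) \<in> B X" for n c
    using sum[of "{..Suc n}" "\<lambda>i x. c i * ind n i x"] by (simp add: scaleB indB)
  have w1: "(\<Sum>i\<le>Suc n. w n i) = 1" for n
  proof -
    have "(\<Sum>i\<le>Suc n. w n i) = (\<Sum>i\<le>Suc n. (\<lambda>_. 1) i * w n i)" by simp
    also have "\<dots> = l (\<lambda>x. \<Sum>i\<le>Suc n. (\<lambda>_. 1) i * ind n i x)" by (rule l_step[symmetric])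
    also have "\<dots> = l (\<lambda>_. 1)" by (rule cong[OF stepB constB]) (rule step)
    finally show ?thesis using one by simp
  qed

  define PM where "PM n = point_measure {..Suc n} (\<lambda>i. ennreal (w n i))" for n
  define \<mu> where "\<mu> n = distr (PM n) borel (\<lambda>i. real i / real (Suc n))" for n
  have spPM: "space (PM n) = {..Suc n}" for n by (simp add: PM_def space_point_measure)
  have PM: "prob_space (PM n)" for n
    by (rule prob_spaceI) (simp only: spPM, simp add: PM_def emeasure_point_measure_finite w0 w1 sum_ennreal del: sum.atMost_Suc)
  have meas: "(\<lambda>i. real i / real (Suc n)) \<in> borel_measurable (PM n)" for n
    by (simp add: PM_def)
  have \<mu>: "real_distribution (\<mu> n)" for n
    unfolding \<mu>_def using prob_space.real_distribution_distr[OF PM meas] .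
  have int: "(LINT s|\<mu> n. h s) = (\<Sum>i\<le>Suc n. h (real i / real (Suc n)) * w n i)"
    if "continuous_on UNIV h" for h :: "real \<Rightarrow> real" and n
  proof -
    have "(LINT s|\<mu> n. h s) = (LINT i|PM n. h (real i / real (Suc n)))"
      unfolding \<mu>_def using borel_measurable_continuous_onI[OF that] by (intro integral_distr meas) auto
    also have "\<dots> = (\<Sum>i\<le>Suc n. w n i * h (real i / real (Suc n)))"
      unfolding PM_def by (subst lebesgue_integral_point_measure_finite) (auto simp: w0)
    finally show ?thesis by (simp add: mult.commute)
  qed
  have "tight \<mu>"
    unfolding tight_def
  proof (intro conjI allI impI \<mu>)
    fix e :: real assume e: "e > 0"
    \<comment> \<open>Tightness is stated with intervals open on the left; the endpoint -1 keeps a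
      possible atom at 0.\<close>
    have "measure (\<mu> n) {-1<..1} = 1" for n
    proof -
      have "measure (\<mu> n) {-1<..1} = measure (PM n) ((\<lambda>i. real i / real (Suc n)) -` {-1<..1} \<inter> space (PM n))"
        unfolding \<mu>_def by (rule measure_distr[OF meas]) simp
      also have "(\<lambda>i. real i / real (Suc n)) -` {-1<..1} \<inter> space (PM n) = space (PM n)"
      proof (intro Int_absorb1 subsetI vimageI2)
        fix i assume "i \<in> space (PM n)"
        then have "real i / real (Suc n) \<le> 1" "0 \<le> real i / real (Suc n)"
          unfolding spPM by (simp_all del: of_nat_Suc)
        then show "real i / real (Suc n) \<in> {-1<..1}"
          unfolding greaterThanAtMost_iff by linarith
      qed
      finally show ?thesis using prob_space.prob_space[OF PM] by simp
    qed
    then show "\<exists>a b. a < b \<and> (\<forall>n. measure (\<mu> n) {a<..b} > 1 - e)"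
      using e by (intro exI[of _ "-1"] exI[of _ 1]) auto
  qed
  from tight_imp_convergent_subsubsequence[OF this strict_mono_id]
  obtain r \<nu> where r: "strict_mono r" and \<nu>: "real_distribution \<nu>" and wc: "weak_conv_m (\<mu> \<circ> id \<circ> r) \<nu>"
    by blast
  show thesis
  proof (rule that[OF \<nu>])
    fix h :: "real \<Rightarrow> real" and b :: real assume h: "continuous_on UNIV h" and b: "\<And>s. \<bar>h s\<bar> \<le> b"
    have hB: "(\<lambda>x. h (t x)) \<in> B X" using b by (intro BI)
    have lim1: "(\<lambda>n. LINT s|(\<mu> \<circ> id \<circ> r) n. h s) \<longlonglongrightarrow> (LINT s|\<nu>. h s)"
    proof (rule weak_conv_imp_integral_bdd_continuous_conv[OF _ \<nu> wc])
      show "isCont h x" for x using h by (simp add: continuous_on_eq_continuous_at)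
      show "norm (h x) \<le> b" for x using b by simp
    qed (simp add: \<mu>)
    \<comment> \<open>By uniform continuity the step functions approach \<open>h\<close> composed
      with \<open>t\<close> uniformly on \<open>X\<close>, and \<open>l\<close> is monotone. So the
      whole sequence converges, in particular along the subsequence.\<close>
    have "(\<lambda>n. LINT s|\<mu> n. h s) \<longlonglongrightarrow> l (\<lambda>x. h (t x))"
    proof (rule LIMSEQ_I)
      fix e :: real assume e: "e > 0"
      have "uniformly_continuous_on {0..1} h"
        using h by (intro compact_uniformly_continuous) (auto intro: continuous_on_subset)
      then obtain \<delta> where \<delta>: "\<delta> > 0" "\<And>x y. x \<in> {0..1} \<Longrightarrow> y \<in> {0..1} \<Longrightarrow> \<bar>y - x\<bar> < \<delta> \<Longrightarrow> \<bar>h y - h x\<bar> < e / 2"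
        using e unfolding uniformly_continuous_on_def dist_real_def by (metis half_gt_zero)
      obtain n0 where n0: "1 / real (Suc n0) < \<delta>" using nat_approx_posE[OF \<delta>(1)] .
      have "norm ((LINT s|\<mu> n. h s) - l (\<lambda>x. h (t x))) < e" if n: "n \<ge> n0" for n
      proof -
        let ?c = "\<lambda>i. h (real i / real (Suc n))"
        have n1: "1 / real (Suc n) < \<delta>"
          using n by (intro le_less_trans[OF _ n0]) (simp add: frac_le)
        have close: "\<bar>h (t x) - ?c (nat \<lfloor>real (Suc n) * t x\<rfloor>)\<bar> \<le> e / 2" if x: "x \<in> X" for x
        proof (rule less_imp_le, rule \<delta>(2))
          show "t x \<in> {0..1}" by (rule t[OF x])
          show "real (nat \<lfloor>real (Suc n) * t x\<rfloor>) / real (Suc n) \<in> {0..1}"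
            using cell(1)[OF x, of n] by (auto simp del: of_nat_Suc simp: divide_le_eq of_nat_le_iff)
          show "\<bar>t x - real (nat \<lfloor>real (Suc n) * t x\<rfloor>) / real (Suc n)\<bar> < \<delta>"
            using cell(2)[OF x, of n] n1 by linarith
        qed
        have "l (\<lambda>x. h (t x)) \<le> l (\<lambda>x. (\<Sum>i\<le>Suc n. ?c i * ind n i x) + e / 2)"
        proof (intro mono hB addB stepB constB)
          show "h (t x) \<le> (\<Sum>i\<le>Suc n. ?c i * ind n i x) + e / 2" if "x \<in> X" for x
            unfolding step[OF that] using close[OF that] by linarith
        qed
        moreover have "l (\<lambda>x. \<Sum>i\<le>Suc n. ?c i * ind n i x) \<le> l (\<lambda>x. h (t x) + e / 2)"
        proof (intro mono hB addB stepB constB)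
          show "(\<Sum>i\<le>Suc n. ?c i * ind n i x) \<le> h (t x) + e / 2" if "x \<in> X" for x
            unfolding step[OF that] using close[OF that] by linarith
        qed
        ultimately have "\<bar>l (\<lambda>x. \<Sum>i\<le>Suc n. ?c i * ind n i x) - l (\<lambda>x. h (t x))\<bar> \<le> e / 2"
          unfolding add[OF stepB constB] add[OF hB constB] const by linarith
        then show ?thesis
          unfolding int[OF h] l_step using e by simp
      qed
      then show "\<exists>n0. \<forall>n\<ge>n0. norm ((LINT s|\<mu> n. h s) - l (\<lambda>x. h (t x))) < e" by blast
    qed
    then have "(\<lambda>n. LINT s|(\<mu> \<circ> id \<circ> r) n. h s) \<longlonglongrightarrow> l (\<lambda>x. h (t x))"
      using LIMSEQ_subseq_LIMSEQ[OF _ r] by (fastforce simp: o_def)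
    then show "l (\<lambda>x. h (t x)) = (LINT s|\<nu>. h s)"
      using lim1 LIMSEQ_unique by blast
  qed
qed

section \<open>Extension to functions dominated by the algebra\<close>

context comm_star_algebra
begin

text \<open>The domain of the extension: it contains the real parts of all evaluations and every
  function bounded on the characters. Values off the characters are unrestricted.\<close>

definition dominated :: "(('a \<Rightarrow> complex) \<Rightarrow> real) set" where
  "dominated = {h. \<exists>a\<in>A. \<forall>\<phi>\<in>characters. \<bar>h \<phi>\<bar> \<le> Re (\<phi> a)}"

lemma character_lin: "\<phi> \<in> characters \<Longrightarrow> linear_functional \<phi>"
  and character_one: "\<phi> \<in> characters \<Longrightarrow> \<phi> 1 = 1"
  and character_mult: "\<phi> \<in> characters \<Longrightarrow> x \<in> A \<Longrightarrow> y \<in> A \<Longrightarrow> \<phi> (x * y) = \<phi> x * \<phi> y"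
  and character_star: "\<phi> \<in> characters \<Longrightarrow> x \<in> A \<Longrightarrow> \<phi> (star x) = cnj (\<phi> x)"
  by (auto simp: characters_def)

lemma character_sc: "\<phi> \<in> characters \<Longrightarrow> \<phi> (sc c) = c"
  using lin_sc[OF character_lin, of \<phi> c] by (simp add: character_one)

text \<open>The majorant is \<open>P h\<close>, the infimum of \<open>Re (L a)\<close> over elements
  \<open>a\<close> lying above \<open>h\<close> on the characters. A linear \<open>l\<close> below
  \<open>P\<close> is positive because 0 lies above \<open>- f\<close> for nonnegative
  \<open>f\<close>, and it agrees with \<open>Re (L a)\<close> because \<open>a\<close> and
  \<open>- a\<close> are admissible for their own real parts.\<close>

lemma positive_extension:
  assumes L: "positive_functional L"
    and nonneg: "\<And>a. a \<in> A \<Longrightarrow> (\<And>\<phi>. \<phi> \<in> characters \<Longrightarrow> \<phi> a \<in> \<real>\<^sub>\<ge>\<^sub>0) \<Longrightarrow> L a \<in> \<real>\<^sub>\<ge>\<^sub>0"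
  obtains l where "fun_subspace dominated"
    "\<And>f g. f \<in> dominated \<Longrightarrow> g \<in> dominated \<Longrightarrow> l (\<lambda>x. f x + g x) = l f + l g"
    "\<And>c f. f \<in> dominated \<Longrightarrow> l (\<lambda>x. c * f x) = c * l f"
    "\<And>f. f \<in> dominated \<Longrightarrow> (\<And>\<phi>. \<phi> \<in> characters \<Longrightarrow> 0 \<le> f \<phi>) \<Longrightarrow> 0 \<le> l f"
    "\<And>a. a \<in> A \<Longrightarrow> (\<lambda>\<phi>. Re (\<phi> a)) \<in> dominated"
    "\<And>a. a \<in> A \<Longrightarrow> l (\<lambda>\<phi>. Re (\<phi> a)) = Re (L a)"
proof -
  note lin = pos_lin[OF L]
  let ?X = characters
  \<comment> \<open>The hypothesis asks for real values on the characters; passing to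
    \<open>a + star a\<close> achieves this at the cost of a factor 2.\<close>
  have pos: "0 \<le> Re (L a)" if a: "a \<in> A" "\<And>\<phi>. \<phi> \<in> ?X \<Longrightarrow> 0 \<le> Re (\<phi> a)" for a
  proof -
    have "L (a + star a) \<in> \<real>\<^sub>\<ge>\<^sub>0"
    proof (rule nonneg)
      show "\<phi> (a + star a) \<in> \<real>\<^sub>\<ge>\<^sub>0" if "\<phi> \<in> ?X" for \<phi>
        using a that by (simp add: lin_add[OF character_lin] character_star closed complex_nonneg_Reals_iff)
    qed (simp add: closed a)
    then show ?thesis using a by (simp add: lin_add[OF lin] closed pos_star[OF L] complex_nonneg_Reals_iff)
  qed
  have mono: "Re (L a) \<le> Re (L b)" if "a \<in> A" "b \<in> A" "\<And>\<phi>. \<phi> \<in> ?X \<Longrightarrow> Re (\<phi> a) \<le> Re (\<phi> b)" for a b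
    using pos[of "b - a"] that by (simp add: closed lin_diff[OF lin] lin_diff[OF character_lin])
  have E: "fun_subspace dominated"
    unfolding fun_subspace_def
  proof (intro conjI ballI allI)
    show "(\<lambda>_. 0) \<in> dominated"
      by (auto simp: dominated_def intro!: bexI[of _ 0] zero_closed simp: lin_zero[OF character_lin])
  next
    fix f g assume "f \<in> dominated" "g \<in> dominated"
    then obtain a b where ab: "a \<in> A" "\<forall>\<phi>\<in>?X. \<bar>f \<phi>\<bar> \<le> Re (\<phi> a)" "b \<in> A" "\<forall>\<phi>\<in>?X. \<bar>g \<phi>\<bar> \<le> Re (\<phi> b)"
      by (auto simp: dominated_def)
    have "\<bar>f \<phi> + g \<phi>\<bar> \<le> Re (\<phi> (a + b))" if "\<phi> \<in> ?X" for \<phi>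
      using ab that abs_triangle_ineq[of "f \<phi>" "g \<phi>"] by (fastforce simp: lin_add[OF character_lin])
    then show "(\<lambda>x. f x + g x) \<in> dominated"
      unfolding dominated_def using ab by (auto intro!: bexI[of _ "a + b"] closed)
  next
    fix c f assume "f \<in> dominated"
    then obtain a where ab: "a \<in> A" "\<forall>\<phi>\<in>?X. \<bar>f \<phi>\<bar> \<le> Re (\<phi> a)"
      by (auto simp: dominated_def)
    have "\<bar>c * f \<phi>\<bar> \<le> Re (\<phi> (sc (of_real \<bar>c\<bar>) * a))" if "\<phi> \<in> ?X" for \<phi>
      using ab that by (simp add: lin_scale[OF character_lin] abs_mult mult_left_mono)
    then show "(\<lambda>x. c * f x) \<in> dominated"
      unfolding dominated_def using ab by (auto intro!: bexI[of _ "sc (of_real \<bar>c\<bar>) * a"] closed)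
  qed
  define above where "above h = {a \<in> A. \<forall>\<phi>\<in>?X. h \<phi> \<le> Re (\<phi> a)}" for h
  define P where "P h = (INF a\<in>above h. Re (L a))" for h
  have bdd: "bdd_below ((\<lambda>a. Re (L a)) ` above h)" and ne: "above h \<noteq> {}" if h: "h \<in> dominated" for h
  proof -
    obtain b where b: "b \<in> A" "\<forall>\<phi>\<in>?X. \<bar>h \<phi>\<bar> \<le> Re (\<phi> b)" using h by (auto simp: dominated_def)
    have "Re (L (- b)) \<le> Re (L a)" if "a \<in> above h" for a
    proof (rule mono)
      show "Re (\<phi> (- b)) \<le> Re (\<phi> a)" if "\<phi> \<in> ?X" for \<phi>
        using b \<open>a \<in> above h\<close> that by (fastforce simp: above_def lin_uminus[OF character_lin])
    qed (use b that in \<open>auto simp: above_def closed\<close>)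
    then show "bdd_below ((\<lambda>a. Re (L a)) ` above h)" unfolding bdd_below_def by auto
    have "b \<in> above h" using b by (auto simp: above_def)
    then show "above h \<noteq> {}" by blast
  qed
  have le: "P h \<le> Re (L a)" if "h \<in> dominated" "a \<in> above h" for h a
    unfolding P_def using bdd[OF that(1)] that(2) by (rule cINF_lower)
  have ge: "c \<le> P h" if "h \<in> dominated" "\<And>a. a \<in> above h \<Longrightarrow> c \<le> Re (L a)" for h c
    unfolding P_def by (intro cINF_greatest ne that)
  have "sublinear_on dominated P"
    unfolding sublinear_on_def
  proof (intro conjI ballI allI impI)
    fix f g assume f: "f \<in> dominated" and g: "g \<in> dominated"
    have "P (\<lambda>x. f x + g x) \<le> Re (L a) + Re (L b)" if ab: "a \<in> above f" "b \<in> above g" for a b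
    proof -
      have AA: "a \<in> A" "b \<in> A" using ab by (auto simp: above_def)
      have "a + b \<in> above (\<lambda>x. f x + g x)"
        using ab by (auto simp: above_def closed lin_add[OF character_lin] add_mono)
      from le[OF fun_subspace_add[OF E f g] this] show ?thesis
        by (simp add: lin_add[OF lin] AA)
    qed
    then have "P (\<lambda>x. f x + g x) - Re (L b) \<le> P f" if "b \<in> above g" for b
      using that by (intro ge f) (auto simp: algebra_simps)
    then have "P (\<lambda>x. f x + g x) - P f \<le> P g"
      by (intro ge g) (auto simp: algebra_simps)
    then show "P (\<lambda>x. f x + g x) \<le> P f + P g" by simp
  next
    fix c :: real and f assume c: "c \<ge> 0" and f: "f \<in> dominated"
    have half: "P (\<lambda>x. c * f x) \<le> c * P f" if c: "c > 0" and f: "f \<in> dominated" for c f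
    proof -
      have "P (\<lambda>x. c * f x) / c \<le> P f"
      proof (rule ge[OF f])
        fix a assume a: "a \<in> above f"
        have "sc (of_real c) * a \<in> above (\<lambda>x. c * f x)"
          using a c by (auto simp: above_def closed lin_scale[OF character_lin])
        from le[OF fun_subspace_scale[OF E f] this] have "P (\<lambda>x. c * f x) \<le> c * Re (L a)"
          using a by (simp add: above_def lin_scale[OF lin])
        then show "P (\<lambda>x. c * f x) / c \<le> Re (L a)"
          using c by (simp add: pos_divide_le_eq mult.commute)
      qed
      then show ?thesis using c by (simp add: field_simps)
    qed
    show "P (\<lambda>x. c * f x) = c * P f"
    proof (cases "c = 0")
      case True
      have z: "(\<lambda>_. 0) \<in> dominated" by (rule fun_subspace_zero[OF E])
      have "0 \<in> above (\<lambda>_. 0)" by (auto simp: above_def zero_closed lin_zero[OF character_lin])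
      from le[OF z this] have "P (\<lambda>_. 0) \<le> 0" by (simp add: lin_zero[OF lin])
      moreover have "0 \<le> P (\<lambda>_. 0)" by (rule ge[OF z]) (auto simp: above_def intro: pos)
      ultimately show ?thesis using True by simp
    next
      case False
      then have c: "c > 0" using c by simp
      have "P (\<lambda>x. inverse c * (c * f x)) \<le> inverse c * P (\<lambda>x. c * f x)"
        by (rule half) (use c fun_subspace_scale[OF E f] in auto)
      then have "c * P f \<le> P (\<lambda>x. c * f x)"
        using c by (simp add: field_simps)
      then show ?thesis using half[OF c f] by simp
    qed
  qed
  from hahn_banach_functions[OF E this] obtain l where
    add: "\<And>f g. f \<in> dominated \<Longrightarrow> g \<in> dominated \<Longrightarrow> l (\<lambda>x. f x + g x) = l f + l g" and
    scale: "\<And>c f. f \<in> dominated \<Longrightarrow> l (\<lambda>x. c * f x) = c * l f" and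
    lP: "\<And>f. f \<in> dominated \<Longrightarrow> l f \<le> P f" by blast
  have lpos: "0 \<le> l f" if f: "f \<in> dominated" "\<And>\<phi>. \<phi> \<in> ?X \<Longrightarrow> 0 \<le> f \<phi>" for f
  proof -
    have "l (\<lambda>x. -1 * f x) \<le> P (\<lambda>x. -1 * f x)" by (intro lP fun_subspace_scale[OF E] f)
    also have "\<dots> \<le> Re (L 0)"
      using f by (intro le fun_subspace_scale[OF E]) (auto simp: above_def zero_closed lin_zero[OF character_lin])
    finally show ?thesis using scale[OF f(1), of "-1"] by (simp add: lin_zero[OF lin])
  qed
  have evE: "(\<lambda>\<phi>. Re (\<phi> a)) \<in> dominated" if a: "a \<in> A" for a
  proof -
    \<comment> \<open>A hermitian square plus 1 bounds the modulus, by
      \<open>x \<le> 1 + x ^ 2\<close>.\<close>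
    have "\<bar>Re (\<phi> a)\<bar> \<le> Re (\<phi> (1 + star a * a))" if "\<phi> \<in> ?X" for \<phi>
    proof -
      have "\<phi> (1 + star a * a) = 1 + cnj (\<phi> a) * \<phi> a"
        using that a by (simp add: lin_add[OF character_lin] character_mult character_star closed character_one)
      also have "\<dots> = of_real (1 + (cmod (\<phi> a))\<^sup>2)"
        by (simp only: of_real_add of_real_1 complex_norm_square mult.commute)
      finally have "Re (\<phi> (1 + star a * a)) = 1 + (cmod (\<phi> a))\<^sup>2"
        by (simp only: Re_complex_of_real)
      moreover have "cmod (\<phi> a) \<le> 1 + (cmod (\<phi> a))\<^sup>2"
        by (rule order_trans[OF _ sum_squares_bound[of 1 "cmod (\<phi> a)", simplified]]) simp
      ultimately show ?thesis using abs_Re_le_cmod[of "\<phi> a"] by linarith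
    qed
    then show ?thesis unfolding dominated_def using a by (auto intro!: bexI[of _ "1 + star a * a"] closed)
  qed
  have half: "l (\<lambda>\<phi>. Re (\<phi> a)) \<le> Re (L a)" if a: "a \<in> A" for a
    using lP[OF evE[OF a]] le[OF evE[OF a], of a] a by (simp add: above_def)
  have val: "l (\<lambda>\<phi>. Re (\<phi> a)) = Re (L a)" if a: "a \<in> A" for a
  proof (rule antisym[OF half[OF a]])
    have "0 \<le> l (\<lambda>\<phi>. Re (\<phi> (-a)) + Re (\<phi> a))"
      using a by (intro lpos fun_subspace_add[OF E] evE) (auto simp: closed lin_uminus[OF character_lin])
    also have "\<dots> = l (\<lambda>\<phi>. Re (\<phi> (-a))) + l (\<lambda>\<phi>. Re (\<phi> a))"
      using a by (intro add evE closed)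
    finally show "Re (L a) \<le> l (\<lambda>\<phi>. Re (\<phi> a))"
      using half[of "- a"] a by (simp add: closed lin_uminus[OF lin])
  qed
  show thesis
    by (rule that[OF E add scale lpos evE val])
qed


text \<open>Convergence on the generators propagates to sums and products, and the conditions on a
  character survive pointwise limits. In other words, the characters form a closed set in the space
  of values on \<open>G\<close>.\<close>

lemma generated_tendsto_character:
  assumes A: "A = generated_subalgebra sc G" and x: "\<And>n::nat. x n \<in> characters"
    and conv: "\<And>g. g \<in> G \<Longrightarrow> (\<lambda>n. x n g) \<longlonglongrightarrow> y g"
  obtains \<phi> where "\<phi> \<in> characters" "\<And>g. g \<in> G \<Longrightarrow> \<phi> g = y g"
proof -
  have "convergent (\<lambda>n. x n a)" if "a \<in> generated_subalgebra sc G" for a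
    using that
  proof (induction rule: generated_subalgebra.induct)
    case (scalar c)
    show ?case by (simp add: character_sc[OF x] convergent_const)
  next
    case (generator g)
    then show ?case using conv by (auto simp: convergent_def)
  next
    case (add a b)
    then have "a \<in> A" "b \<in> A" by (simp_all only: A)
    then show ?case using convergent_add[OF add.IH] by (simp add: lin_add[OF character_lin[OF x]])
  next
    case (mult a b)
    then have "a \<in> A" "b \<in> A" by (simp_all only: A)
    then show ?case using convergent_mult[OF mult.IH] by (simp add: character_mult[OF x])
  qed
  then have cv: "(\<lambda>n. x n a) \<longlonglongrightarrow> lim (\<lambda>n. x n a)" if "a \<in> A" for a
    using that by (simp only: A convergent_LIMSEQ_iff)
  define \<phi> where "\<phi> = restrict (\<lambda>a. lim (\<lambda>n. x n a)) A"
  have lim: "(\<lambda>n. x n a) \<longlonglongrightarrow> \<phi> a" if "a \<in> A" for a using cv[OF that] that by (simp add: \<phi>_def)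
  note uniq = LIMSEQ_unique
  have "\<phi> \<in> characters"
    unfolding characters_def linear_functional_def
  proof (intro CollectI conjI ballI allI)
    show "\<phi> \<in> extensional A" by (simp add: \<phi>_def)
    show "\<phi> 1 = 1"
      using lim[OF one_closed] by (rule uniq) (simp add: character_one[OF x])
  next
    fix a b assume a: "a \<in> A" and b: "b \<in> A"
    show "\<phi> (a + b) = \<phi> a + \<phi> b"
      using lim[OF add_closed[OF a b]] tendsto_add[OF lim[OF a] lim[OF b]]
      by (simp add: lin_add[OF character_lin[OF x] a b] uniq)
    show "\<phi> (a * b) = \<phi> a * \<phi> b"
      using lim[OF mult_closed[OF a b]] tendsto_mult[OF lim[OF a] lim[OF b]]
      by (simp add: character_mult[OF x a b] uniq)
  next
    fix a assume a: "a \<in> A"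
    show "\<phi> (star a) = cnj (\<phi> a)"
      using lim[OF star_closed[OF a]] tendsto_cnj[OF lim[OF a]]
      by (simp add: character_star[OF x a] uniq)
    show "\<phi> (sc c * a) = c * \<phi> a" for c
      using lim[OF mult_closed[OF sc_closed[of c] a]] tendsto_mult_left[OF lim[OF a], of c]
      by (simp add: lin_scale[OF character_lin[OF x] a] uniq)
  qed
  moreover have eq: "\<phi> g = y g" if "g \<in> G" for g
  proof -
    have "g \<in> A" using that by (simp add: A generated_subalgebra.generator)
    then show ?thesis using uniq[OF lim conv[OF that]] by blast
  qed
  ultimately show thesis using that by blast
qed

lemma Hausdorff_character_topology: "Hausdorff_space character_topology"
  unfolding character_topology_def
  by (intro Hausdorff_space_subtopology) (simp add: Hausdorff_space_product_topology)

text \<open>Polarisation: \<open>a\<close> is the sum of \<open>c / 4\<close> times the hermitian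
  square of \<open>a + c\<close> over the four values \<open>c\<close> in {1, \<i>, -1, -\<i>}. It
  reduces the integral formula to hermitian squares, where monotone convergence is
  available.\<close>

lemma square_combination:
  assumes Q: "\<And>b. b \<in> A \<Longrightarrow> Q (star b * b)"
    and add: "\<And>a b. a \<in> A \<Longrightarrow> b \<in> A \<Longrightarrow> Q a \<Longrightarrow> Q b \<Longrightarrow> Q (a + b)"
    and scale: "\<And>c a. a \<in> A \<Longrightarrow> Q a \<Longrightarrow> Q (sc c * a)" and a: "a \<in> A"
  shows "Q a"
proof -
  define s where "s c = star (a + sc c) * (a + sc c)" for c
  have sA: "s c \<in> A" for c using a by (simp add: s_def closed)
  have s: "sc p * s c = sc p * (star a * a) + sc (p * c) * star a + sc (p * cnj c) * a + sc (p * (cnj c * c))" for p c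
    using a by (simp add: s_def star_add star_sc closed sc_mult algebra_simps)
  have quarter: "sc (1/4) * a + sc (1/4) * a + sc (1/4) * a + sc (1/4) * a = a"
    unfolding distrib_right[symmetric] sc_add[symmetric] by (simp add: sc_one)
  have coeffs: "1/4 * 1 = (1/4::complex)" "1/4 * cnj 1 = 1/4" "1/4 * (cnj 1 * 1) = 1/4"
    "\<i>/4 * \<i> = -1/4" "\<i>/4 * cnj \<i> = 1/4" "\<i>/4 * (cnj \<i> * \<i>) = \<i>/4"
    "-1/4 * -1 = (1/4::complex)" "-1/4 * cnj (-1) = 1/4" "-1/4 * (cnj (-1) * -1) = (-1/4::complex)"
    "-\<i>/4 * -\<i> = -1/4" "-\<i>/4 * cnj (-\<i>) = 1/4" "-\<i>/4 * (cnj (-\<i>) * -\<i>) = -\<i>/4"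
    by (simp_all add: complex_eq_iff)
  have neg: "sc (-1/4) = - sc (1/4)" "sc (-\<i>/4) = - sc (\<i>/4)"
    by (simp_all flip: sc_minus)
  have "sc (1/4) * s 1 + (sc (\<i>/4) * s \<i> + (sc (-1/4) * s (-1) + sc (-\<i>/4) * s (-\<i>)))
    = sc (1/4) * a + sc (1/4) * a + sc (1/4) * a + sc (1/4) * a"
    unfolding s unfolding coeffs unfolding neg by (simp add: algebra_simps)
  also have "\<dots> = a" by (rule quarter)
  finally have "a = sc (1/4) * s 1 + (sc (\<i>/4) * s \<i> + (sc (-1/4) * s (-1) + sc (-\<i>/4) * s (-\<i>)))" ..
  moreover have "Q (s c)" for c unfolding s_def using a by (intro Q) (simp add: closed)
  then have "Q (sc (1/4) * s 1 + (sc (\<i>/4) * s \<i> + (sc (-1/4) * s (-1) + sc (-\<i>/4) * s (-\<i>))))"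
    by (intro add scale closed sA)
  ultimately show ?thesis by simp
qed

end

lemma one_minus_power_le:
  fixes k :: real
  assumes "0 \<le> k" "k \<le> 1"
  shows "1 - k ^ n \<le> real n * (1 - k)"
  using Bernoulli_inequality[of "k - 1" n] assms by (simp add: algebra_simps)

section \<open>The representing measure on the characters\<close>

context comm_star_algebra
begin

lemma borel_measurable_evaluation:
  assumes "space N = characters" "sets N = sigma_sets characters {U. openin character_topology U}" "a \<in> A"
  shows "(\<lambda>\<phi>. \<phi> a) \<in> borel_measurable N"
proof (rule borel_measurableI)
  fix S :: "complex set" assume "open S"
  have "continuous_map character_topology euclidean (\<lambda>\<phi>. \<phi> a)"
    unfolding character_topology_def
    by (intro continuous_map_from_subtopology continuous_map_product_projection assms)
  then have "openin character_topology {\<phi> \<in> topspace character_topology. \<phi> a \<in> S}"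
    using \<open>open S\<close> by (intro openin_continuous_map_preimage) auto
  then show "(\<lambda>\<phi>. \<phi> a) -` S \<inter> space N \<in> sets N"
    unfolding assms topspace_character_topology by (intro sigma_sets.Basic) (simp add: vimage_def Int_def conj_commute)
qed

text \<open>Covers the case \<open>L 1 = 0\<close>, in which no normalisation to a probability
  measure is possible.\<close>

lemma moment_functional_zero:
  assumes L: "\<And>a. a \<in> A \<Longrightarrow> L a = 0"
  shows "moment_functional L"
proof -
  define M where "M = null_measure (sigma characters {U. openin character_topology U})"
  have sub: "{U. openin character_topology U} \<subseteq> Pow characters"
    using openin_subset[of character_topology] by (auto simp: topspace_character_topology)
  have M: "space M = characters" "sets M = sigma_sets characters {U. openin character_topology U}"
    by (simp_all add: M_def space_measure_of[OF sub] sets_measure_of[OF sub])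
  have zero: "emeasure M B = 0" for B by (simp add: M_def)
  have "radon_measure character_topology M"
    unfolding radon_measure_def topspace_character_topology
    by (simp add: M zero SUP_constant bot_ennreal)
  moreover have "has_bochner_integral M (\<lambda>\<phi>. \<phi> a) 0" if "a \<in> A" for a
  proof -
    have "AE \<phi> in M. \<phi> a = 0"
      by (rule AE_I[of _ _ "space M"]) (auto simp: M_def)
    moreover have "(\<lambda>\<phi>. \<phi> a) \<in> borel_measurable M" by (rule borel_measurable_evaluation[OF M that])
    ultimately show ?thesis
      using has_bochner_integral_cong_AE[of "\<lambda>\<phi>. \<phi> a" M "\<lambda>_. 0" 0] by (simp add: has_bochner_integral_zero)
  qed
  ultimately show ?thesis
    unfolding moment_functional_def using L
    by (intro exI[of _ M]) (auto simp: has_bochner_integral_iff)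
qed

text \<open>The distribution \<open>\<nu>\<close> on the parameter line represents only bounded
  continuous functions. A square \<open>a\<close> is therefore damped by a power of a factor
  increasing to 1; the damping error is dominated by a small multiple of \<open>a * p0\<close>, an
  element of the algebra, so it disappears in the limit. The same \<open>p0\<close> shows that no
  mass sits at infinity.\<close>

theorem moment_functional_of_nonneg:
  assumes A: "A = generated_subalgebra sc G" and G: "finite G" and L: "positive_functional L"
    and nonneg: "\<And>a. a \<in> A \<Longrightarrow> (\<And>\<phi>. \<phi> \<in> characters \<Longrightarrow> \<phi> a \<in> \<real>\<^sub>\<ge>\<^sub>0) \<Longrightarrow> L a \<in> \<real>\<^sub>\<ge>\<^sub>0"
  shows "moment_functional L"
proof (cases "L 1 = 0")
  case True
  have "L a = 0" if a: "a \<in> A" for a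
  proof (rule ccontr)
    assume La: "L a \<noteq> 0"
    define q where "q = Re (L (star a * a))"
    have q: "q \<ge> 0" using pos_square[OF L a] by (simp add: q_def complex_nonneg_Reals_iff)
    define s where "s = cmod (L a) / (q + 1)"
    \<comment> \<open>At \<open>s * a\<close> the bound reads
      \<open>2 * s * cmod (L a) \<le> s * s * q\<close>, and \<open>s\<close> is small enough that
      \<open>s * q \<le> cmod (L a)\<close>.\<close>
    have s: "s > 0" using La q by (simp add: s_def)
    have "L (sc (of_real s) * a) = s * L a" by (rule lin_scale[OF pos_lin[OF L] a])
    moreover have "star (sc (of_real s) * a) * (sc (of_real s) * a) = sc (of_real (s * s)) * (star a * a)"
      using a by (simp add: star_mult star_sc closed sc_mult algebra_simps)
    then have "L (star (sc (of_real s) * a) * (sc (of_real s) * a)) = of_real (s * s) * L (star a * a)"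
      by (simp only: lin_scale[OF pos_lin[OF L] mult_closed[OF star_closed[OF a] a]])
    ultimately have "2 * (s * cmod (L a)) \<le> s * s * q"
      using pos_bound[OF L mult_closed[OF sc_closed a], of "of_real s"] s True by (simp add: norm_mult q_def)
    then have "2 * cmod (L a) \<le> s * q" using s by simp
    also have "\<dots> \<le> cmod (L a)" using q by (simp add: s_def field_simps)
    finally show False using La by simp
  qed
  then show ?thesis using moment_functional_zero by blast
next
  case False
  let ?X = characters
  note lin = pos_lin[OF L]
  define c where "c = Re (L 1)"
  have L1: "L 1 \<in> \<real>\<^sub>\<ge>\<^sub>0" using pos_square[OF L one_closed] by simp
  then have c: "c > 0" using False by (auto simp: c_def complex_nonneg_Reals_iff complex_eq_iff)
  obtain l where E: "fun_subspace dominated"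
    and add: "\<And>f g. f \<in> dominated \<Longrightarrow> g \<in> dominated \<Longrightarrow> l (\<lambda>x. f x + g x) = l f + l g"
    and scale: "\<And>c f. f \<in> dominated \<Longrightarrow> l (\<lambda>x. c * f x) = c * l f"
    and lpos: "\<And>f. f \<in> dominated \<Longrightarrow> (\<And>\<phi>. \<phi> \<in> ?X \<Longrightarrow> 0 \<le> f \<phi>) \<Longrightarrow> 0 \<le> l f"
    and evE: "\<And>a. a \<in> A \<Longrightarrow> (\<lambda>\<phi>. Re (\<phi> a)) \<in> dominated"
    and lval: "\<And>a. a \<in> A \<Longrightarrow> l (\<lambda>\<phi>. Re (\<phi> a)) = Re (L a)"
    using positive_extension[OF L nonneg] by blast
  have lmono: "l f \<le> l g" if fg: "f \<in> dominated" "g \<in> dominated" and le: "\<And>\<phi>. \<phi> \<in> ?X \<Longrightarrow> f \<phi> \<le> g \<phi>" for f g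
  proof -
    have "0 \<le> l (\<lambda>x. g x + -1 * f x)"
      using le by (intro lpos fun_subspace_add[OF E] fun_subspace_scale[OF E] fg) auto
    also have "\<dots> = l g + -1 * l f"
      by (simp only: add[OF fg(2) fun_subspace_scale[OF E fg(1)]] scale[OF fg(1)])
    finally show ?thesis by simp
  qed
  have bddE: "f \<in> dominated" if "\<And>\<phi>. \<phi> \<in> ?X \<Longrightarrow> \<bar>f \<phi>\<bar> \<le> b" for f b
    unfolding dominated_def using that by (auto intro!: bexI[of _ "sc (of_real b)"] sc_closed simp: character_sc)
  have l1: "l (\<lambda>_. 1) = c"
  proof -
    have "l (\<lambda>_. 1) = l (\<lambda>\<phi>. Re (\<phi> 1))"
      by (intro antisym lmono bddE[of _ 1] evE one_closed) (auto simp: character_one)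
    then show ?thesis by (simp add: lval one_closed c_def)
  qed
  have Xne: "?X \<noteq> {}"
  proof
    assume "?X = {}"
    \<comment> \<open>Without characters the constant -1 would be vacuously nonnegative.\<close>
    then have "0 \<le> l (\<lambda>_. -1 * 1)" by (intro lpos bddE[of _ 1]) auto
    also have "\<dots> = -1 * l (\<lambda>_. 1)" by (intro scale bddE[of _ 1]) auto
    finally show False using l1 c by simp
  qed

  \<comment> \<open>The constant 2 makes \<open>1 / pr \<phi>\<close> strictly less than 1, as the
    range of the curve requires; the quotients \<open>\<phi> g / pr \<phi>\<close> are less than 1
    in modulus as well.\<close>
  define p0 where "p0 = sc 2 + (\<Sum>g\<in>G. star g * g)"
  have GA: "g \<in> A" if "g \<in> G" for g using that by (simp add: A generated_subalgebra.generator)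
  have p0A: "p0 \<in> A" unfolding p0_def by (intro closed sum_closed GA)
  define pr where "pr \<phi> = 2 + (\<Sum>g\<in>G. (cmod (\<phi> g))\<^sup>2)" for \<phi> :: "'a \<Rightarrow> complex"
  have \<phi>_p0: "\<phi> p0 = of_real (pr \<phi>)" if \<phi>: "\<phi> \<in> ?X" for \<phi>
  proof -
    have "\<phi> (\<Sum>g\<in>I. star g * g) = (\<Sum>g\<in>I. of_real ((cmod (\<phi> g))\<^sup>2))" if "I \<subseteq> G" for I
      using finite_subset[OF that G] that
    proof (induction I)
      case (insert g I)
      have g: "g \<in> A" using insert.prems GA by blast
      have "(\<Sum>g\<in>I. star g * g) \<in> A"
        by (intro sum_closed mult_closed star_closed GA) (use insert.prems in auto)
      with g have "\<phi> (star g * g + (\<Sum>g\<in>I. star g * g)) = cnj (\<phi> g) * \<phi> g + \<phi> (\<Sum>g\<in>I. star g * g)"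
        by (simp add: lin_add[OF character_lin[OF \<phi>]] character_mult[OF \<phi>] character_star[OF \<phi>] closed)
      moreover have "cnj (\<phi> g) * \<phi> g = of_real ((cmod (\<phi> g))\<^sup>2)"
        by (simp only: complex_norm_square mult.commute)
      ultimately show ?case using insert by simp
    qed (simp add: lin_zero[OF character_lin[OF \<phi>]])
    then show ?thesis
      by (simp add: p0_def pr_def lin_add[OF character_lin[OF \<phi>]] closed GA sum_closed character_sc[OF \<phi>])
  qed
  have pr2: "pr \<phi> \<ge> 2" for \<phi> by (simp add: pr_def sum_nonneg)
  have g_pr: "cmod (\<phi> g) < pr \<phi>" if "g \<in> G" for \<phi> g
  proof -
    have "(cmod (\<phi> g))\<^sup>2 \<le> (\<Sum>g\<in>G. (cmod (\<phi> g))\<^sup>2)"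
      using G that by (intro member_le_sum) auto
    moreover have "2 * cmod (\<phi> g) \<le> 1 + (cmod (\<phi> g))\<^sup>2"
      using sum_squares_bound[of 1 "cmod (\<phi> g)"] by simp
    ultimately show ?thesis using norm_ge_zero[of "\<phi> g"] unfolding pr_def by linarith
  qed

  obtain \<Gamma> :: "real \<Rightarrow> nat \<Rightarrow> complex" where \<Gamma>: "\<And>i. continuous_on UNIV (\<lambda>s. \<Gamma> s i)"
    and \<Gamma>_bd: "\<And>s i. cmod (\<Gamma> s i) \<le> 2"
    and \<Gamma>_surj: "\<And>y. (\<And>i. cmod (y i) < 1) \<Longrightarrow> \<exists>s\<in>{0..1}. \<forall>i. \<Gamma> s i = y i"
    using complex_space_filling_curve by blast
  \<comment> \<open>Homogeneous coordinates: the curve passes at \<open>t \<phi>\<close> through the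
    point with entries \<open>1 / pr \<phi>\<close> and \<open>\<phi> g / pr \<phi>\<close>, and
    \<open>\<phi>\<close> is recovered as the ratio of \<open>W g\<close> and
    \<open>Y\<close>.\<close>
  define Y where "Y s = Re (\<Gamma> s 0)" for s
  define W where "W g s = \<Gamma> s (Suc (to_nat_on G g))" for g s
  have contY: "continuous_on UNIV Y" unfolding Y_def by (intro continuous_intros \<Gamma>)
  have contW: "continuous_on UNIV (W g)" for g unfolding W_def by (rule \<Gamma>)
  have Y_bd: "\<bar>Y s\<bar> \<le> 2" for s unfolding Y_def using abs_Re_le_cmod \<Gamma>_bd order_trans by blast
  have W_bd: "cmod (W g s) \<le> 2" for g s unfolding W_def by (rule \<Gamma>_bd)
  have "\<exists>s\<in>{0..1}. Y s = 1 / pr \<phi> \<and> (\<forall>g\<in>G. W g s = \<phi> g / of_real (pr \<phi>))" for \<phi>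
  proof -
    define y where "y i = (if i = 0 then of_real (1 / pr \<phi>)
      else if i - 1 \<in> to_nat_on G ` G then \<phi> (from_nat_into G (i - 1)) / of_real (pr \<phi>) else 0)" for i
    have p: "pr \<phi> > 0" "\<bar>pr \<phi>\<bar> = pr \<phi>" using pr2[of \<phi>] by auto
    have fg: "from_nat_into G (to_nat_on G g) = g" if "g \<in> G" for g
      using that G by (simp add: countable_finite)
    have "cmod (y i) < 1" for i
    proof -
      consider "i = 0" | g where "i \<noteq> 0" "g \<in> G" "i - 1 = to_nat_on G g" | "i \<noteq> 0" "i - 1 \<notin> to_nat_on G ` G" by auto
      then show ?thesis
      proof cases
        case 1
        then show ?thesis using pr2[of \<phi>] p by (simp add: y_def norm_divide)
      next
        case 2
        then show ?thesis using p g_pr[of g \<phi>] by (auto simp: y_def norm_divide fg)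
      qed (simp add: y_def)
    qed
    from \<Gamma>_surj[of y, OF this] obtain s where s: "s \<in> {0..1}" "\<And>i. \<Gamma> s i = y i" by blast
    have "Y s = 1 / pr \<phi>" by (simp add: Y_def s(2) y_def)
    moreover have "W g s = \<phi> g / of_real (pr \<phi>)" if "g \<in> G" for g
      using that by (simp add: W_def s(2) y_def fg)
    ultimately show ?thesis using s(1) by blast
  qed
  then obtain t where t01: "\<And>\<phi>. t \<phi> \<in> {0..1}" and Yt: "\<And>\<phi>. Y (t \<phi>) = 1 / pr \<phi>"
    and Wt: "\<And>\<phi> g. g \<in> G \<Longrightarrow> W g (t \<phi>) = \<phi> g / of_real (pr \<phi>)" by metis

  obtain \<nu> where \<nu>: "real_distribution \<nu>" and
    int\<nu>: "\<And>h b. continuous_on UNIV h \<Longrightarrow> (\<And>s. \<bar>h s\<bar> \<le> b) \<Longrightarrow> l (\<lambda>x. h (t x)) / c = (LINT s|\<nu>. h s)"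
  proof (rule representing_distribution[of ?X "\<lambda>f. l f / c" t])
    have B: "f \<in> dominated" if "f \<in> {f. \<exists>b. \<forall>x\<in>?X. \<bar>f x\<bar> \<le> b}" for f :: "('a \<Rightarrow> complex) \<Rightarrow> real"
      using that by (auto intro: bddE)
    show "l (\<lambda>x. f x + g x) / c = l f / c + l g / c"
      if "f \<in> {f. \<exists>b. \<forall>x\<in>?X. \<bar>f x\<bar> \<le> b}" "g \<in> {f. \<exists>b. \<forall>x\<in>?X. \<bar>f x\<bar> \<le> b}" for f g
      by (simp add: add[OF B[OF that(1)] B[OF that(2)]] add_divide_distrib)
    show "l (\<lambda>x. k * f x) / c = k * (l f / c)" if "f \<in> {f. \<exists>b. \<forall>x\<in>?X. \<bar>f x\<bar> \<le> b}" for k f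
      by (simp add: scale[OF B[OF that]])
    show "0 \<le> l f / c" if "f \<in> {f. \<exists>b. \<forall>x\<in>?X. \<bar>f x\<bar> \<le> b}" "\<And>x. x \<in> ?X \<Longrightarrow> 0 \<le> f x" for f
      using lpos[OF B[OF that(1)] that(2)] c by simp
    show "l (\<lambda>_. 1) / c = 1" using l1 c by simp
  qed (use t01 in blast)+
  interpret \<nu>: real_distribution \<nu> by (rule \<nu>)
  have sets\<nu>: "sets \<nu> = sets borel" and space\<nu>: "space \<nu> = UNIV" by simp_all

  \<comment> \<open>At a parameter \<open>t \<phi>\<close> the factor \<open>\<kappa> M\<close> equals \<open>min 1 (M / pr \<phi>)\<close>; a sufficiently high power of it makes every element
    of \<open>A\<close> a bounded continuous function of the parameter.\<close>
  define R where "R M s = 1 / max (Y s) (1 / M)" for M s :: real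
  define \<kappa> where "\<kappa> M s = Y s * R M s" for M s
  have R_bd: "0 < R M s" "R M s \<le> M" if "M > 0" for M s
  proof -
    have M: "0 < 1 / M" using that by simp
    then have mx: "0 < max (Y s) (1 / M)" by linarith
    then show "0 < R M s" unfolding R_def by (intro divide_pos_pos) auto
    have "1 / max (Y s) (1 / M) \<le> 1 / (1 / M)"
      by (intro divide_left_mono mult_pos_pos mx M) auto
    then show "R M s \<le> M" by (simp add: R_def)
  qed
  have contR: "continuous_on UNIV (R M)" if "M > 0" for M
    unfolding R_def using that by (intro continuous_intros contY) (auto simp: max_def)
  have cont\<kappa>: "continuous_on UNIV (\<kappa> M)" if "M > 0" for M
    unfolding \<kappa>_def by (intro continuous_intros contY contR that)
  have \<kappa>_bd: "\<bar>\<kappa> M s\<bar> \<le> 2 * M" if "M > 0" for M s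
    unfolding \<kappa>_def abs_mult using R_bd[OF that, of s] Y_bd[of s] by (intro mult_mono) auto
  have \<kappa>_01: "0 < \<kappa> M s" "\<kappa> M s \<le> 1" if "M > 0" "Y s > 0" for M s
  proof -
    show "0 < \<kappa> M s" unfolding \<kappa>_def using R_bd[OF that(1), of s] that by simp
    have "max (Y s) (1 / M) > 0" using that by (simp add: less_max_iff_disj)
    then show "\<kappa> M s \<le> 1" unfolding \<kappa>_def R_def by (simp add: divide_le_eq)
  qed
  have \<kappa>_1: "\<kappa> M s = 1" if "M > 0" "Y s \<ge> 1 / M" for M s
  proof -
    have "Y s > 0" using that by (smt (verit) divide_pos_pos)
    then show ?thesis using that by (simp add: \<kappa>_def R_def max_def)
  qed
  have \<kappa>_mono: "\<kappa> M s \<le> \<kappa> M' s" if "M > 0" "M \<le> M'" "Y s > 0" for M M' s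
  proof -
    have "1 / M' \<le> 1 / M" using that by (simp add: frac_le)
    then have "max (Y s) (1 / M') \<le> max (Y s) (1 / M)" by auto
    moreover have "0 < max (Y s) (1 / M')" using that by (simp add: less_max_iff_disj)
    ultimately have "1 / max (Y s) (1 / M) \<le> 1 / max (Y s) (1 / M')" by (intro divide_left_mono) auto
    then show ?thesis unfolding \<kappa>_def R_def using that by (intro mult_left_mono) auto
  qed

  \<comment> \<open>The parameter \<open>s\<close> represents the character \<open>\<phi>\<close>; \<open>Y s = 0\<close> is the point at infinity.\<close>
  define rel where "rel s \<phi> \<longleftrightarrow> \<phi> \<in> ?X \<and> Y s > 0 \<and> (\<forall>g\<in>G. W g s = of_real (Y s) * \<phi> g)" for s \<phi>
  have rel_t: "rel (t \<phi>) \<phi>" if "\<phi> \<in> ?X" for \<phi>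
    using that pr2[of \<phi>] by (auto simp: rel_def Yt Wt)

  \<comment> \<open>The exponent does not depend on \<open>M\<close>. A generator costs one factor,
    since \<open>W g s * R M s\<close> is \<open>\<phi> g\<close> times \<open>\<kappa> M s\<close>.
    Exponents add for products; for sums both terms are padded to \<open>K1 + K2\<close>.\<close>
  have cut: "\<exists>K. \<forall>M>0. \<exists>h. continuous_on UNIV h \<and> (\<exists>b. \<forall>s. cmod (h s) \<le> b) \<and>
      (\<forall>s \<phi>. rel s \<phi> \<longrightarrow> h s = \<phi> a * of_real (\<kappa> M s ^ K))" if "a \<in> generated_subalgebra sc G" for a
    using that
  proof (induction rule: generated_subalgebra.induct)
    case (scalar x)
    show ?case
      by (intro exI[of _ 0] allI impI exI[of _ "\<lambda>_. x"]) (auto simp: rel_def character_sc)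
  next
    case (generator g)
    show ?case
    proof (intro exI[of _ 1] allI impI)
      fix M :: real assume M: "M > 0"
      have "continuous_on UNIV (\<lambda>s. W g s * of_real (R M s))"
        by (intro continuous_intros contW contR M)
      moreover have "cmod (W g s * of_real (R M s)) \<le> 2 * M" for s
        unfolding norm_mult using R_bd[OF M, of s] by (intro mult_mono W_bd) auto
      moreover have "W g s * of_real (R M s) = \<phi> g * of_real (\<kappa> M s ^ 1)" if "rel s \<phi>" for s \<phi>
        using that generator by (simp add: rel_def \<kappa>_def)
      ultimately show "\<exists>h. continuous_on UNIV h \<and> (\<exists>b. \<forall>s. cmod (h s) \<le> b) \<and>
          (\<forall>s \<phi>. rel s \<phi> \<longrightarrow> h s = \<phi> g * of_real (\<kappa> M s ^ 1))" by blast
    qed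
  next
    case (add x y)
    then have xy: "x \<in> A" "y \<in> A" by (simp_all only: A)
    obtain K1 where K1: "\<And>M. M > 0 \<Longrightarrow> \<exists>h. continuous_on UNIV h \<and> (\<exists>b. \<forall>s. cmod (h s) \<le> b) \<and>
      (\<forall>s \<phi>. rel s \<phi> \<longrightarrow> h s = \<phi> x * of_real (\<kappa> M s ^ K1))" using add.IH(1) by blast
    obtain K2 where K2: "\<And>M. M > 0 \<Longrightarrow> \<exists>h. continuous_on UNIV h \<and> (\<exists>b. \<forall>s. cmod (h s) \<le> b) \<and>
      (\<forall>s \<phi>. rel s \<phi> \<longrightarrow> h s = \<phi> y * of_real (\<kappa> M s ^ K2))" using add.IH(2) by blast
    show ?case
    proof (intro exI[of _ "K1 + K2"] allI impI)
      fix M :: real assume M: "M > 0"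
      obtain h1 b1 where h1: "continuous_on UNIV h1" "\<And>s. cmod (h1 s) \<le> b1"
        "\<And>s \<phi>. rel s \<phi> \<Longrightarrow> h1 s = \<phi> x * of_real (\<kappa> M s ^ K1)" using K1[OF M] by blast
      obtain h2 b2 where h2: "continuous_on UNIV h2" "\<And>s. cmod (h2 s) \<le> b2"
        "\<And>s \<phi>. rel s \<phi> \<Longrightarrow> h2 s = \<phi> y * of_real (\<kappa> M s ^ K2)" using K2[OF M] by blast
      let ?h = "\<lambda>s. h1 s * of_real (\<kappa> M s ^ K2) + h2 s * of_real (\<kappa> M s ^ K1)"
      have "continuous_on UNIV ?h" by (intro continuous_intros h1 h2 cont\<kappa> M)
      moreover have "cmod (?h s) \<le> b1 * (2 * M) ^ K2 + b2 * (2 * M) ^ K1" for s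
      proof (intro norm_triangle_mono)
        have b: "b1 \<ge> 0" "b2 \<ge> 0" using h1(2) h2(2) norm_ge_zero order_trans by blast+
        show "cmod (h1 s * of_real (\<kappa> M s ^ K2)) \<le> b1 * (2 * M) ^ K2"
          unfolding norm_mult norm_of_real power_abs using \<kappa>_bd[OF M] b by (intro mult_mono h1 power_mono) auto
        show "cmod (h2 s * of_real (\<kappa> M s ^ K1)) \<le> b2 * (2 * M) ^ K1"
          unfolding norm_mult norm_of_real power_abs using \<kappa>_bd[OF M] b by (intro mult_mono h2 power_mono) auto
      qed
      moreover have "?h s = \<phi> (x + y) * of_real (\<kappa> M s ^ (K1 + K2))" if r: "rel s \<phi>" for s \<phi>
      proof -
        have "linear_functional \<phi>" using r by (simp add: rel_def character_lin)
        then show ?thesis unfolding h1(3)[OF r] h2(3)[OF r]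
          by (simp add: lin_add xy power_add algebra_simps)
      qed
      ultimately show "\<exists>h. continuous_on UNIV h \<and> (\<exists>b. \<forall>s. cmod (h s) \<le> b) \<and>
          (\<forall>s \<phi>. rel s \<phi> \<longrightarrow> h s = \<phi> (x + y) * of_real (\<kappa> M s ^ (K1 + K2)))"
        by (intro exI[of _ ?h]) blast
    qed
  next
    case (mult x y)
    then have xy: "x \<in> A" "y \<in> A" by (simp_all only: A)
    obtain K1 where K1: "\<And>M. M > 0 \<Longrightarrow> \<exists>h. continuous_on UNIV h \<and> (\<exists>b. \<forall>s. cmod (h s) \<le> b) \<and>
      (\<forall>s \<phi>. rel s \<phi> \<longrightarrow> h s = \<phi> x * of_real (\<kappa> M s ^ K1))" using mult.IH(1) by blast
    obtain K2 where K2: "\<And>M. M > 0 \<Longrightarrow> \<exists>h. continuous_on UNIV h \<and> (\<exists>b. \<forall>s. cmod (h s) \<le> b) \<and>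
      (\<forall>s \<phi>. rel s \<phi> \<longrightarrow> h s = \<phi> y * of_real (\<kappa> M s ^ K2))" using mult.IH(2) by blast
    show ?case
    proof (intro exI[of _ "K1 + K2"] allI impI)
      fix M :: real assume M: "M > 0"
      obtain h1 b1 where h1: "continuous_on UNIV h1" "\<And>s. cmod (h1 s) \<le> b1"
        "\<And>s \<phi>. rel s \<phi> \<Longrightarrow> h1 s = \<phi> x * of_real (\<kappa> M s ^ K1)" using K1[OF M] by blast
      obtain h2 b2 where h2: "continuous_on UNIV h2" "\<And>s. cmod (h2 s) \<le> b2"
        "\<And>s \<phi>. rel s \<phi> \<Longrightarrow> h2 s = \<phi> y * of_real (\<kappa> M s ^ K2)" using K2[OF M] by blast
      let ?h = "\<lambda>s. h1 s * h2 s"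
      have "continuous_on UNIV ?h" by (intro continuous_intros h1 h2)
      moreover have b: "b1 \<ge> 0" using h1(2) norm_ge_zero order_trans by blast
      then have "cmod (?h s) \<le> b1 * b2" for s
        unfolding norm_mult by (intro mult_mono h1 h2) auto
      moreover have "?h s = \<phi> (x * y) * of_real (\<kappa> M s ^ (K1 + K2))" if r: "rel s \<phi>" for s \<phi>
      proof -
        have "\<phi> \<in> ?X" using r by (simp add: rel_def)
        then show ?thesis unfolding h1(3)[OF r] h2(3)[OF r]
          by (simp add: character_mult xy power_add algebra_simps)
      qed
      ultimately show "\<exists>h. continuous_on UNIV h \<and> (\<exists>b. \<forall>s. cmod (h s) \<le> b) \<and>
          (\<forall>s \<phi>. rel s \<phi> \<longrightarrow> h s = \<phi> (x * y) * of_real (\<kappa> M s ^ (K1 + K2)))"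
        by (intro exI[of _ ?h]) blast
    qed
  qed

  \<comment> \<open>The map \<open>t\<close> comes from a choice, so its image is not known to be
    measurable. The closure is, and closedness of the characters still provides a character for
    every parameter in \<open>S\<close>.\<close>
  define C where "C = closure (t ` ?X)"
  define S where "S = {s. Y s > 0} \<inter> C"
  have S_borel: "S \<in> sets borel"
  proof -
    have "open {s. Y s > 0}" using contY by (intro open_Collect_less continuous_on_const) auto
    then show ?thesis by (auto simp: S_def C_def)
  qed
  have "\<exists>\<phi>. rel s \<phi>" if s: "s \<in> S" for s
  proof -
    have Ys: "Y s > 0" and "s \<in> closure (t ` ?X)" using s by (auto simp: S_def C_def)
    then obtain \<sigma> where \<sigma>: "\<And>n. \<sigma> n \<in> t ` ?X" "\<sigma> \<longlonglongrightarrow> s" by (auto simp: closure_sequential)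
    then have "\<forall>n. \<exists>\<phi>. \<phi> \<in> ?X \<and> \<sigma> n = t \<phi>" by blast
    then obtain x where x: "\<And>n. x n \<in> ?X" "\<And>n. \<sigma> n = t (x n)" by metis
    have lim: "(\<lambda>n. f (\<sigma> n)) \<longlonglongrightarrow> f s" if "continuous_on UNIV f" for f :: "real \<Rightarrow> 'z::topological_space"
      by (rule continuous_on_tendsto_compose[OF that \<sigma>(2)]) auto
    have "(\<lambda>n. x n g) \<longlonglongrightarrow> W g s / of_real (Y s)" if g: "g \<in> G" for g
    proof -
      have "x n g = W g (\<sigma> n) / of_real (Y (\<sigma> n))" for n
        using rel_t[OF x(1), of n] g by (auto simp: rel_def x(2))
      then show ?thesis
        using Ys by (simp only:) (intro tendsto_intros lim contW contY, simp)
    qed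
    from generated_tendsto_character[OF A x(1) this] obtain \<phi> where
      "\<phi> \<in> ?X" "\<And>g. g \<in> G \<Longrightarrow> \<phi> g = W g s / of_real (Y s)" by blast
    then have "rel s \<phi>" using Ys by (simp add: rel_def)
    then show ?thesis by blast
  qed
  then obtain \<Phi> where \<Phi>: "\<And>s. s \<in> S \<Longrightarrow> rel s (\<Phi> s)" by metis
  have \<Phi>X: "\<Phi> s \<in> ?X" and YS: "Y s > 0" if "s \<in> S" for s using \<Phi>[OF that] by (auto simp: rel_def)

  have bdd_int: "integrable \<nu> h" if "continuous_on UNIV h" "\<And>s. norm (h s) \<le> b"
    for h :: "real \<Rightarrow> 'z::{banach, second_countable_topology}" and b
    using borel_measurable_continuous_onI[OF that(1)] that(2)
    by (intro \<nu>.integrable_const_bound[of _ b]) auto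
  have "AE s in \<nu>. s \<in> C"
  proof -
    \<comment> \<open>A bounded continuous test function that vanishes on the image of
      \<open>t\<close>, hence has integral 0, and is positive off \<open>C\<close>.\<close>
    have cC: "continuous_on UNIV (\<lambda>s. min 1 (infdist s C))" by (intro continuous_intros)
    have Cne: "C \<noteq> {}" using Xne by (simp add: C_def)
    have "(LINT s|\<nu>. min 1 (infdist s C)) = l (\<lambda>x. min 1 (infdist (t x) C)) / c"
      by (rule int\<nu>[OF cC, of 1, symmetric]) (auto simp: infdist_nonneg)
    also have "l (\<lambda>x. min 1 (infdist (t x) C)) = l (\<lambda>x. 0 * 1)"
      by (intro antisym lmono bddE[of _ 1]) (auto simp: infdist_nonneg C_def closure_subset[THEN subsetD])
    also have "\<dots> = 0" by (subst scale) (auto intro: bddE[of _ 1])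
    finally have "AE s in \<nu>. min 1 (infdist s C) = 0"
      using integral_nonneg_eq_0_iff_AE[OF bdd_int[OF cC, of 1]] by (auto simp: infdist_nonneg)
    then show ?thesis
      by eventually_elim (use Cne in_closed_iff_infdist_zero[of C] in \<open>auto simp: C_def min_def split: if_splits\<close>)
  qed
  moreover have "AE s in \<nu>. Y s > 0"
  proof -
    define Z where "Z = {s. Y s \<le> 0}"
    have Zc: "closed Z" unfolding Z_def by (intro closed_Collect_le contY continuous_on_const)
    define k where "k = Re (L p0) / c"
    \<comment> \<open>On \<open>Z\<close> the function \<open>R M\<close> equals \<open>M\<close>,
      while along \<open>t\<close> it stays below \<open>pr\<close>, the value of \<open>p0\<close>.
      The bound \<open>k\<close> is independent of \<open>M\<close>, which forces \<open>Z\<close>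
      to be null.\<close>
    have le: "M * measure \<nu> Z \<le> k" if M: "M > 0" for M
    proof -
      have "M * measure \<nu> Z = (LINT s|\<nu>. M * indicator Z s)" using Zc by simp
      also have "\<dots> \<le> (LINT s|\<nu>. R M s)"
      proof (rule integral_mono)
        show "integrable \<nu> (\<lambda>s. M * indicator Z s)" using Zc by (simp add: \<nu>.emeasure_finite less_top[symmetric])
        show "integrable \<nu> (R M)" using R_bd[OF M] by (intro bdd_int[of _ M] contR M) (auto simp: abs_of_pos)
        show "M * indicator Z s \<le> R M s" for s
        proof (cases "s \<in> Z")
          case True
          then have "Y s \<le> 1 / M" using M by (simp add: Z_def) (smt (verit) divide_pos_pos)
          then show ?thesis using True by (simp add: R_def max_def)
        qed (use R_bd[OF M] in \<open>simp add: less_imp_le\<close>)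
      qed
      also have "\<dots> = l (\<lambda>x. R M (t x)) / c"
        using R_bd[OF M] by (intro int\<nu>[OF contR[OF M], of M, symmetric]) (auto simp: abs_of_pos)
      also have "l (\<lambda>x. R M (t x)) \<le> l (\<lambda>\<phi>. Re (\<phi> p0))"
      proof (intro lmono evE p0A bddE[of _ M])
        show "\<bar>R M (t \<phi>)\<bar> \<le> M" for \<phi> using R_bd[OF M] by (auto simp: abs_of_pos)
        show "R M (t \<phi>) \<le> Re (\<phi> p0)" if "\<phi> \<in> ?X" for \<phi>
        proof -
          have "1 / max (1 / pr \<phi>) (1 / M) \<le> 1 / (1 / pr \<phi>)"
            using pr2[of \<phi>] by (intro divide_left_mono) (auto intro!: mult_pos_pos simp: less_max_iff_disj)
          then show ?thesis by (simp add: R_def Yt \<phi>_p0[OF that])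
        qed
      qed
      also have "\<dots> = Re (L p0)" by (rule lval[OF p0A])
      finally show ?thesis using c by (simp add: k_def divide_right_mono)
    qed
    have "measure \<nu> Z = 0"
    proof (rule ccontr)
      assume "measure \<nu> Z \<noteq> 0"
      then have m: "measure \<nu> Z > 0" using measure_nonneg[of \<nu> Z] by linarith
      have "(\<bar>k\<bar> + 1) / measure \<nu> Z * measure \<nu> Z \<le> k" using m by (intro le) simp
      then show False using m by simp
    qed
    then have "AE s in \<nu>. s \<notin> Z" using Zc by (subst (asm) \<nu>.prob_eq_0) auto
    then show ?thesis by eventually_elim (simp add: Z_def)
  qed
  ultimately have AES: "AE s in \<nu>. s \<in> S" by eventually_elim (simp add: S_def)

  \<comment> \<open>For a hermitian square the damped functions increase almost everywhere to the
    value of the character; their integrals are squeezed between \<open>Re (L a)\<close> minus a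
    vanishing error and \<open>Re (L a)\<close>, up to the factor \<open>1 / c\<close>.\<close>
  have key: "has_bochner_integral \<nu> (\<lambda>s. if s \<in> S then Re (\<Phi> s (star b * b)) else 0) (Re (L (star b * b)) / c)"
    if b: "b \<in> A" for b
  proof -
    define a where "a = star b * b"
    have aA: "a \<in> A" using b by (simp add: a_def closed)
    have a_nn: "\<phi> a = of_real (Re (\<phi> a)) \<and> Re (\<phi> a) \<ge> 0" if "\<phi> \<in> ?X" for \<phi>
    proof -
      have "\<phi> a = cnj (\<phi> b) * \<phi> b" using that b by (simp add: a_def character_mult character_star closed)
      then have "\<phi> a = of_real ((cmod (\<phi> b))\<^sup>2)" by (simp only: complex_norm_square mult.commute)
      then show ?thesis by (simp del: of_real_power)
    qed
    obtain K where K: "\<forall>M>0. \<exists>h. continuous_on UNIV h \<and> (\<exists>b. \<forall>s. cmod (h s) \<le> b) \<and>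
      (\<forall>s \<phi>. rel s \<phi> \<longrightarrow> h s = \<phi> a * of_real (\<kappa> M s ^ K))" using cut aA A by blast
    then have "\<forall>n. \<exists>h. continuous_on UNIV h \<and> (\<exists>b. \<forall>s. cmod (h s) \<le> b) \<and>
      (\<forall>s \<phi>. rel s \<phi> \<longrightarrow> h s = \<phi> a * of_real (\<kappa> (real (Suc n)) s ^ K))" by simp
    then obtain h where h: "\<And>n. continuous_on UNIV (h n)" "\<And>n. \<exists>b. \<forall>s. cmod (h n s) \<le> b"
      "\<And>n s \<phi>. rel s \<phi> \<Longrightarrow> h n s = \<phi> a * of_real (\<kappa> (real (Suc n)) s ^ K)" by metis
    let ?u = "\<lambda>s. if s \<in> S then Re (\<Phi> s a) else 0"
    have hS: "Re (h n s) = Re (\<Phi> s a) * \<kappa> (real (Suc n)) s ^ K" if "s \<in> S" for n s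
      using h(3)[OF \<Phi>[OF that]] by simp
    have cRe: "continuous_on UNIV (\<lambda>s. Re (h n s))" for n by (intro continuous_intros h)
    have bRe: "\<exists>b. \<forall>s. \<bar>Re (h n s)\<bar> \<le> b" for n
      using h(2)[of n] abs_Re_le_cmod order_trans by meson
    have "has_bochner_integral \<nu> ?u (Re (L a) / c)"
    proof (rule has_bochner_integral_monotone_convergence[where f = "\<lambda>n s. Re (h n s)"])
      show "integrable \<nu> (\<lambda>s. Re (h n s))" for n
        using bRe[of n] bdd_int[OF cRe] by auto
      show "AE s in \<nu>. mono (\<lambda>n. Re (h n s))"
        using AES
      proof eventually_elim
        case (elim s)
        show ?case
        proof (rule monoI)
          fix m n :: nat assume "m \<le> n"
          then have "\<kappa> (real (Suc m)) s ^ K \<le> \<kappa> (real (Suc n)) s ^ K"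
            using YS[OF elim] \<kappa>_01(1)[of "real (Suc m)" s] by (intro power_mono \<kappa>_mono) auto
          then show "Re (h m s) \<le> Re (h n s)"
            unfolding hS[OF elim] using a_nn[OF \<Phi>X[OF elim]] by (intro mult_left_mono) auto
        qed
      qed
      show "AE s in \<nu>. (\<lambda>n. Re (h n s)) \<longlonglongrightarrow> ?u s"
        using AES
      proof eventually_elim
        case (elim s)
        obtain n0 where n0: "1 / real (Suc n0) < Y s" using nat_approx_posE[OF YS[OF elim]] .
        have "Re (h n s) = ?u s" if "n \<ge> n0" for n
        proof -
          have "1 / real (Suc n) \<le> 1 / real (Suc n0)" using that by (intro divide_left_mono) auto
          then have "\<kappa> (real (Suc n)) s = 1" using n0 by (intro \<kappa>_1) auto
          then show ?thesis using elim by (simp only: hS[OF elim]) simp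
        qed
        then have "\<forall>\<^sub>F n in sequentially. Re (h n s) = ?u s"
          unfolding eventually_sequentially by blast
        then show ?case by (rule tendsto_eventually)
      qed
      show "(\<lambda>n. LINT s|\<nu>. Re (h n s)) \<longlonglongrightarrow> Re (L a) / c"
      proof -
        have eq: "(LINT s|\<nu>. Re (h n s)) = l (\<lambda>\<phi>. Re (h n (t \<phi>))) / c" for n
        proof -
          obtain B where "\<forall>s. \<bar>Re (h n s)\<bar> \<le> B" using bRe by blast
          then show ?thesis by (intro int\<nu>[OF cRe, symmetric]) blast
        qed
        have hE: "(\<lambda>\<phi>. Re (h n (t \<phi>))) \<in> dominated" for n
          using bRe[of n] by (auto intro: bddE)
        have ht: "Re (h n (t \<phi>)) = Re (\<phi> a) * \<kappa> (real (Suc n)) (t \<phi>) ^ K" if "\<phi> \<in> ?X" for n \<phi>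
          using h(3)[OF rel_t[OF that]] by simp
        have up: "l (\<lambda>\<phi>. Re (h n (t \<phi>))) \<le> Re (L a)" for n
          unfolding lval[OF aA, symmetric]
        proof (intro lmono hE evE aA)
          fix \<phi> assume \<phi>: "\<phi> \<in> ?X"
          have "Y (t \<phi>) > 0" using rel_t[OF \<phi>] by (simp add: rel_def)
          then have "\<kappa> (real (Suc n)) (t \<phi>) ^ K \<le> 1"
            using \<kappa>_01[of "real (Suc n)" "t \<phi>"] by (intro power_le_one) auto
          then show "Re (h n (t \<phi>)) \<le> Re (\<phi> a)"
            unfolding ht[OF \<phi>] using a_nn[OF \<phi>] by (intro mult_left_le) auto
        qed
        \<comment> \<open>Bernoulli gives \<open>1 - \<kappa> ^ K \<le> K * (1 - \<kappa>)\<close>,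
          and \<open>1 - \<kappa>\<close> is at most \<open>pr \<phi> / Suc n\<close>. Multiplied by
          the value of \<open>a\<close>, this bound is a multiple of the value of
          \<open>a * p0\<close>.\<close>
        have low: "Re (L a) - real K / real (Suc n) * Re (L (a * p0)) \<le> l (\<lambda>\<phi>. Re (h n (t \<phi>)))" for n
        proof -
          let ?k = "real K / real (Suc n)"
          have ap: "a * p0 \<in> A" by (intro closed aA p0A)
          have "l (\<lambda>\<phi>. Re (\<phi> a)) \<le> l (\<lambda>\<phi>. Re (h n (t \<phi>)) + ?k * Re (\<phi> (a * p0)))"
          proof (intro lmono hE evE aA fun_subspace_add[OF E] fun_subspace_scale[OF E] ap)
            fix \<phi> assume \<phi>: "\<phi> \<in> ?X"
            let ?\<kappa> = "\<kappa> (real (Suc n)) (t \<phi>)"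
            have "Y (t \<phi>) > 0" using rel_t[OF \<phi>] by (simp add: rel_def)
            then have k01: "0 < ?\<kappa>" "?\<kappa> \<le> 1" using \<kappa>_01[of "real (Suc n)" "t \<phi>"] by auto
            have "1 - ?\<kappa> \<le> pr \<phi> / real (Suc n)"
            proof (cases "pr \<phi> \<le> real (Suc n)")
              case True
              then have "?\<kappa> = 1" using pr2[of \<phi>] by (intro \<kappa>_1) (auto simp: Yt intro!: divide_left_mono)
              then show ?thesis using pr2[of \<phi>] by simp
            next
              case False
              then have "1 \<le> pr \<phi> / real (Suc n)" by (simp add: le_divide_eq)
              then show ?thesis using k01 by linarith
            qed
            then have "real K * (1 - ?\<kappa>) \<le> real K * (pr \<phi> / real (Suc n))" by (rule mult_left_mono) simp
            then have "1 - ?\<kappa> ^ K \<le> ?k * pr \<phi>"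
              using one_minus_power_le[of ?\<kappa> K] k01 by simp
            then have "Re (\<phi> a) * (1 - ?\<kappa> ^ K) \<le> Re (\<phi> a) * (?k * pr \<phi>)"
              using a_nn[OF \<phi>] by (intro mult_left_mono) auto
            moreover have "Re (\<phi> (a * p0)) = Re (\<phi> a) * pr \<phi>"
              by (simp add: character_mult[OF \<phi> aA p0A] \<phi>_p0[OF \<phi>])
            ultimately show "Re (\<phi> a) \<le> Re (h n (t \<phi>)) + ?k * Re (\<phi> (a * p0))"
              unfolding ht[OF \<phi>] by (simp add: algebra_simps)
          qed
          also have "\<dots> = l (\<lambda>\<phi>. Re (h n (t \<phi>))) + ?k * Re (L (a * p0))"
            by (simp only: add[OF hE fun_subspace_scale[OF E evE[OF ap]]] scale[OF evE[OF ap]] lval[OF ap])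
          finally show ?thesis by (simp add: lval[OF aA])
        qed
        have "(\<lambda>n. l (\<lambda>\<phi>. Re (h n (t \<phi>)))) \<longlonglongrightarrow> Re (L a)"
        proof (rule tendsto_sandwich[OF always_eventually[OF allI[OF low]] always_eventually[OF allI[OF up]]])
          have "(\<lambda>n. Re (L a) - real K * (1 / real (Suc n)) * Re (L (a * p0))) \<longlonglongrightarrow> Re (L a) - real K * 0 * Re (L (a * p0))"
            by (intro tendsto_intros lim_1_over_n[THEN LIMSEQ_Suc])
          then show "(\<lambda>n. Re (L a) - real K / real (Suc n) * Re (L (a * p0))) \<longlonglongrightarrow> Re (L a)" by simp
        qed simp
        then show ?thesis unfolding eq by (intro tendsto_divide tendsto_const) (use c in auto)
      qed
      have k1: "\<kappa> 1 s > 0" if "s \<in> S" for s using \<kappa>_01(1)[of 1 s] YS[OF that] by simp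
      \<comment> \<open>The function \<open>h 0\<close> is damped with \<open>M = 1\<close>, and on
        \<open>S\<close> that positive factor can be divided out, which leaves a quotient of
        continuous functions.\<close>
      have "?u = (\<lambda>s. indicator S s * (Re (h 0 s) / \<kappa> 1 s ^ K))"
        using hS[of _ 0] k1 by (auto simp: fun_eq_iff indicator_def) (smt (verit) zero_less_power)
      moreover have "\<dots> \<in> borel_measurable \<nu>"
        using S_borel borel_measurable_continuous_onI[OF cRe] borel_measurable_continuous_onI[OF cont\<kappa>[of 1]]
        by (intro borel_measurable_times borel_measurable_divide borel_measurable_power borel_measurable_indicator) auto
      ultimately show "?u \<in> borel_measurable \<nu>" by simp
    qed
    then show ?thesis by (simp only: a_def)
  qed

  have cont\<Phi>: "continuous_on S (\<lambda>s. \<Phi> s a)" if a: "a \<in> A" for a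
  proof -
    obtain K where K: "\<forall>M>0. \<exists>h. continuous_on UNIV h \<and> (\<exists>b. \<forall>s. cmod (h s) \<le> b) \<and>
      (\<forall>s \<phi>. rel s \<phi> \<longrightarrow> h s = \<phi> a * of_real (\<kappa> M s ^ K))" using cut a A by blast
    then obtain h where h: "continuous_on UNIV h" "\<And>s \<phi>. rel s \<phi> \<Longrightarrow> h s = \<phi> a * of_real (\<kappa> 1 s ^ K)"
      by (meson zero_less_one)
    have k1: "\<kappa> 1 s > 0" if "s \<in> S" for s using \<kappa>_01(1)[of 1 s] YS[OF that] by simp
    have "continuous_on S (\<lambda>s. h s / of_real (\<kappa> 1 s ^ K))"
      using k1 by (intro continuous_intros continuous_on_subset[OF h(1)] continuous_on_subset[OF cont\<kappa>]) force+
    moreover have "h s / of_real (\<kappa> 1 s ^ K) = \<Phi> s a" if "s \<in> S" for s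
      using h(2)[OF \<Phi>[OF that]] k1[OF that] by simp
    ultimately show ?thesis by (simp cong: continuous_on_cong)
  qed
  let ?T = character_topology
  have cm: "continuous_map (top_of_set S) ?T \<Phi>"
    unfolding character_topology_def continuous_map_in_subtopology continuous_map_componentwise
    using \<Phi>X cont\<Phi> by (auto simp: characters_def)
  obtain \<phi>0 where \<phi>0: "\<phi>0 \<in> ?X" using Xne by blast
  \<comment> \<open>Off \<open>S\<close>, which carries no mass, a fixed character serves as default
    value, so that the map is total and takes values in the characters.\<close>
  define \<Psi> where "\<Psi> s = (if s \<in> S then \<Phi> s else \<phi>0)" for s
  define N where "N = sigma ?X {U. openin ?T U}"
  have sub: "{U. openin ?T U} \<subseteq> Pow ?X"
    using openin_subset[of ?T] by (auto simp: topspace_character_topology)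
  have N: "space N = ?X" "sets N = sigma_sets ?X {U. openin ?T U}"
    by (simp_all add: N_def space_measure_of[OF sub] sets_measure_of[OF sub])
  have meas: "\<Psi> \<in> measurable \<nu> N"
    unfolding N_def
  proof (rule measurable_measure_of[OF sub])
    show "\<Psi> \<in> space \<nu> \<rightarrow> ?X" using \<Phi>X \<phi>0 by (auto simp: \<Psi>_def)
    fix U assume "U \<in> {U. openin ?T U}"
    then have "openin (top_of_set S) {s \<in> topspace (top_of_set S). \<Phi> s \<in> U}"
      by (intro openin_continuous_map_preimage[OF cm]) simp
    then obtain V where V: "open V" "{s \<in> S. \<Phi> s \<in> U} = S \<inter> V" by (auto simp: openin_open)
    have "\<Psi> -` U \<inter> space \<nu> = (S \<inter> V) \<union> (if \<phi>0 \<in> U then - S else {})"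
    proof (rule set_eqI)
      fix s
      have "s \<in> S \<Longrightarrow> \<Phi> s \<in> U \<longleftrightarrow> s \<in> V" using V(2) by blast
      then show "s \<in> \<Psi> -` U \<inter> space \<nu> \<longleftrightarrow> s \<in> (S \<inter> V) \<union> (if \<phi>0 \<in> U then - S else {})"
        by (cases "s \<in> S") (simp_all add: \<Psi>_def)
    qed
    also have "\<dots> \<in> sets \<nu>" using V(1) S_borel by auto
    finally show "\<Psi> -` U \<inter> space \<nu> \<in> sets \<nu>" .
  qed
  \<comment> \<open>Undoes the normalisation: the total mass must be \<open>L 1\<close>.\<close>
  define \<nu>' where "\<nu>' = density \<nu> (\<lambda>_. ennreal c)"
  have sets\<nu>': "sets \<nu>' = sets borel" and space\<nu>': "space \<nu>' = UNIV" by (simp_all add: \<nu>'_def)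
  have em: "emeasure \<nu>' B = ennreal c * emeasure \<nu> B" if "B \<in> sets borel" for B
    unfolding \<nu>'_def using that by (subst emeasure_density) (simp_all add: nn_integral_cmult_indicator)
  have fin: "emeasure \<nu>' B < \<infinity>" for B
  proof (cases "B \<in> sets borel")
    case True
    then show ?thesis unfolding em[OF True] \<nu>.emeasure_eq_measure by (simp flip: ennreal_mult'')
  next
    case False
    then show ?thesis using emeasure_notin_sets[of B \<nu>'] unfolding sets\<nu>' by simp
  qed
  have meas': "\<Psi> \<in> measurable \<nu>' N" using meas by (simp add: \<nu>'_def)
  define M where "M = distr \<nu>' N \<Psi>"
  have M: "space M = ?X" "sets M = sigma_sets ?X {U. openin ?T U}" by (simp_all add: M_def N)
  have emM: "emeasure M B = emeasure \<nu>' (\<Psi> -` B)" if "B \<in> sets M" for B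
    using emeasure_distr[OF meas', of B] that by (simp add: M_def space\<nu>')
  have pre: "\<Psi> -` B \<in> sets borel" if "B \<in> sets M" for B
    using measurable_sets[OF meas', of B] that by (simp add: M_def space\<nu>' sets\<nu>')
  have "radon_measure ?T M"
    unfolding radon_measure_def topspace_character_topology
  proof (intro conjI allI impI ballI M)
    show "emeasure M K < \<infinity>" for K
    proof (cases "K \<in> sets M")
      case True
      then show ?thesis using fin by (simp add: emM)
    qed (simp add: emeasure_notin_sets)
    fix B assume B: "B \<in> sets M"
    \<comment> \<open>Inner regularity is inherited from the line. Intersecting with
      \<open>S\<close> loses only a null set, and there the map is the continuous
      \<open>\<Phi>\<close>, which carries compact subsets of the parameter set to compact sets of
      characters.\<close>
    let ?D = "\<Psi> -` B \<inter> S"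
    have D: "?D \<in> sets borel" using pre[OF B] S_borel by auto
    have "emeasure M B = emeasure \<nu>' ?D"
    proof -
      have "emeasure \<nu> (\<Psi> -` B) = emeasure \<nu> ?D"
        using AES pre[OF B] D by (intro emeasure_eq_AE) auto
      then show ?thesis by (simp add: emM[OF B] em pre[OF B] D)
    qed
    also have "\<dots> = (SUP K\<in>{K. K \<subseteq> ?D \<and> compact K}. emeasure \<nu>' K)"
      using fin[of "space \<nu>'"] by (intro inner_regular sets\<nu>' D) auto
    also have "\<dots> \<le> (SUP K\<in>{K. compactin ?T K \<and> K \<subseteq> B}. emeasure M K)"
    proof (rule SUP_least)
      fix K assume K: "K \<in> {K. K \<subseteq> ?D \<and> compact K}"
      then have KS: "K \<subseteq> S" by blast
      have "compactin (top_of_set S) K" using K KS by (simp add: compactin_subtopology)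
      then have cK: "compactin ?T (\<Phi> ` K)" by (rule image_compactin[OF _ cm])
      then have "closedin ?T (\<Phi> ` K)" by (rule compactin_imp_closedin[OF Hausdorff_character_topology])
      then have "\<Phi> ` K \<subseteq> ?X" "openin ?T (?X - \<Phi> ` K)"
        by (simp_all add: closedin_def topspace_character_topology)
      then have "?X - (?X - \<Phi> ` K) \<in> sets M"
        unfolding M by (intro sigma_sets.Compl sigma_sets.Basic) simp
      then have KM: "\<Phi> ` K \<in> sets M" using \<open>\<Phi> ` K \<subseteq> ?X\<close> by (simp add: double_diff)
      have "\<Phi> ` K \<subseteq> B"
      proof (rule image_subsetI)
        fix s assume "s \<in> K"
        then have "s \<in> S" "\<Psi> s \<in> B" using K by blast+
        then show "\<Phi> s \<in> B" by (simp add: \<Psi>_def)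
      qed
      then have "emeasure M (\<Phi> ` K) \<le> (SUP K\<in>{K. compactin ?T K \<and> K \<subseteq> B}. emeasure M K)"
        using cK by (intro SUP_upper) simp
      moreover have "K \<subseteq> \<Psi> -` (\<Phi> ` K)" using KS by (auto simp: \<Psi>_def)
      then have "emeasure \<nu>' K \<le> emeasure M (\<Phi> ` K)"
        unfolding emM[OF KM] using pre[OF KM] by (intro emeasure_mono) (simp_all add: sets\<nu>')
      ultimately show "emeasure \<nu>' K \<le> (SUP K\<in>{K. compactin ?T K \<and> K \<subseteq> B}. emeasure M K)"
        by (rule order_trans[rotated])
    qed
    finally have "emeasure M B \<le> (SUP K\<in>{K. compactin ?T K \<and> K \<subseteq> B}. emeasure M K)" .
    moreover have "(SUP K\<in>{K. compactin ?T K \<and> K \<subseteq> B}. emeasure M K) \<le> emeasure M B"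
      using B by (intro SUP_least emeasure_mono) auto
    ultimately show "emeasure M B = (SUP K\<in>{K. compactin ?T K \<and> K \<subseteq> B}. emeasure M K)"
      by (rule antisym)
  qed
  moreover have "integrable M (\<lambda>\<phi>. \<phi> a) \<and> L a = (LINT \<phi>|M. \<phi> a)" if a: "a \<in> A" for a
  proof (rule square_combination[where Q = "\<lambda>a. integrable M (\<lambda>\<phi>. \<phi> a) \<and> L a = (LINT \<phi>|M. \<phi> a)"])
    fix b assume b: "b \<in> A"
    let ?a = "star b * b" and ?u = "\<lambda>s. if s \<in> S then Re (\<Phi> s (star b * b)) else 0"
    have aA: "?a \<in> A" using b by (intro closed)
    have real: "\<phi> ?a = of_real (Re (\<phi> ?a))" if "\<phi> \<in> ?X" for \<phi>
    proof -
      have "\<phi> ?a = cnj (\<phi> b) * \<phi> b" using that b by (simp add: character_mult character_star closed)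
      then have "\<phi> ?a = of_real ((cmod (\<phi> b))\<^sup>2)" by (simp only: complex_norm_square mult.commute)
      then show ?thesis by (simp del: of_real_power)
    qed
    have evm: "(\<lambda>\<phi>. \<phi> ?a) \<in> borel_measurable N" by (rule borel_measurable_evaluation[OF N aA])
    have m: "(\<lambda>s. \<Psi> s ?a) \<in> borel_measurable \<nu>" by (rule measurable_compose[OF meas evm])
    have ae: "AE s in \<nu>. \<Psi> s ?a = complex_of_real (?u s)"
      using AES by eventually_elim (use real \<Phi>X in \<open>auto simp: \<Psi>_def\<close>)
    have u: "integrable \<nu> ?u" "(LINT s|\<nu>. ?u s) = Re (L ?a) / c"
      using key[OF b] by (auto simp: has_bochner_integral_iff)
    have um: "(\<lambda>s. complex_of_real (?u s)) \<in> borel_measurable \<nu>"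
      by (rule measurable_compose[OF borel_measurable_integrable[OF u(1)]])
        (intro borel_measurable_continuous_onI continuous_intros)
    have i1: "integrable \<nu> (\<lambda>s. \<Psi> s ?a)"
      using integrable_cong_AE[OF m um ae] u(1) by (simp only: integrable_of_real)
    have i2: "(LINT s|\<nu>. \<Psi> s ?a) = of_real (Re (L ?a) / c)"
      unfolding integral_cong_AE[OF m um ae] integral_complex_of_real u(2) ..
    have "integrable \<nu>' (\<lambda>s. \<Psi> s ?a)"
      unfolding \<nu>'_def using c m i1 by (subst integrable_density) auto
    then have "integrable M (\<lambda>\<phi>. \<phi> ?a)"
      unfolding M_def using integrable_distr_eq[OF meas' evm] by simp
    moreover have "(LINT \<phi>|M. \<phi> ?a) = (LINT s|\<nu>'. \<Psi> s ?a)"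
      unfolding M_def by (rule integral_distr[OF meas' evm])
    then have "(LINT \<phi>|M. \<phi> ?a) = of_real c * (LINT s|\<nu>. \<Psi> s ?a)"
      unfolding \<nu>'_def using c m by (subst (asm) integral_density) (auto simp: scaleR_conv_of_real)
    then have "(LINT \<phi>|M. \<phi> ?a) = of_real (Re (L ?a))"
      using c by (simp add: i2)
    moreover have "L ?a = of_real (Re (L ?a))"
      using pos_square[OF L b] by (simp add: complex_nonneg_Reals_iff complex_eq_iff)
    ultimately show "integrable M (\<lambda>\<phi>. \<phi> ?a) \<and> L ?a = (LINT \<phi>|M. \<phi> ?a)" by simp
  next
    fix x y assume x: "x \<in> A" and y: "y \<in> A"
      and Q: "integrable M (\<lambda>\<phi>. \<phi> x) \<and> L x = (LINT \<phi>|M. \<phi> x)" "integrable M (\<lambda>\<phi>. \<phi> y) \<and> L y = (LINT \<phi>|M. \<phi> y)"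
    have "\<phi> (x + y) = \<phi> x + \<phi> y" if "\<phi> \<in> space M" for \<phi>
      using that x y by (simp add: M lin_add[OF character_lin])
    then have "integrable M (\<lambda>\<phi>. \<phi> (x + y)) \<longleftrightarrow> integrable M (\<lambda>\<phi>. \<phi> x + \<phi> y)"
      "(LINT \<phi>|M. \<phi> (x + y)) = (LINT \<phi>|M. \<phi> x + \<phi> y)"
      by (intro Bochner_Integration.integrable_cong Bochner_Integration.integral_cong refl; simp)+
    then show "integrable M (\<lambda>\<phi>. \<phi> (x + y)) \<and> L (x + y) = (LINT \<phi>|M. \<phi> (x + y))"
      using Q by (simp add: lin_add[OF lin x y])
  next
    fix k x assume x: "x \<in> A" and Q: "integrable M (\<lambda>\<phi>. \<phi> x) \<and> L x = (LINT \<phi>|M. \<phi> x)"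
    have "\<phi> (sc k * x) = k * \<phi> x" if "\<phi> \<in> space M" for \<phi>
      using that x by (simp add: M lin_scale[OF character_lin])
    then have "integrable M (\<lambda>\<phi>. \<phi> (sc k * x)) \<longleftrightarrow> integrable M (\<lambda>\<phi>. k * \<phi> x)"
      "(LINT \<phi>|M. \<phi> (sc k * x)) = (LINT \<phi>|M. k * \<phi> x)"
      by (intro Bochner_Integration.integrable_cong Bochner_Integration.integral_cong refl; simp)+
    then show "integrable M (\<lambda>\<phi>. \<phi> (sc k * x)) \<and> L (sc k * x) = (LINT \<phi>|M. \<phi> (sc k * x))"
      using Q by (simp add: lin_scale[OF lin x])
  qed (rule a)
  ultimately show ?thesis
    unfolding moment_functional_def by blast
qed

end

theorem theorem10:
  fixes d m :: nat and u v w :: "nat \<Rightarrow> complex" and f :: "nat \<Rightarrow> cpoly"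
  assumes "d \<ge> 2" and "m = 3 * d - 2"
    and "\<forall>j\<in>{1..d-1}. \<not> collinear {u j, v j, w j}"
    and "\<forall>j\<in>{1..d-1}. f (3 * j - 2) = zvar j + pconst (u j)"
    and "\<forall>j\<in>{1..d-1}. f (3 * j - 1) = zvar j + pconst (v j)"
    and "\<forall>j\<in>{1..d-1}. f (3 * j) = zvar j + pconst (w j)"
    and "f (3 * d - 2) = zvar d"
  shows "comm_star_algebra.moment_property fconst fract_star (frac_algebra d m f)"
proof -
  let ?A = "frac_algebra d m f"
  interpret comm_star_algebra fconst fract_star ?A
    by (rule comm_star_algebra_frac_algebra)
  have "moment_functional L" if L: "positive_functional L" for L
  proof (rule moment_functional_of_nonneg[OF _ _ L])
    show "?A = generated_subalgebra fconst (frac_generators d m f)"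
      by (simp add: frac_algebra_def)
    show "finite (frac_generators d m f)"
      by (simp add: frac_generators_def)
    show "L a \<in> \<real>\<^sub>\<ge>\<^sub>0" if "a \<in> ?A" "\<And>\<phi>. \<phi> \<in> characters \<Longrightarrow> \<phi> a \<in> \<real>\<^sub>\<ge>\<^sub>0" for a
      by (rule nonneg_on_characters_imp_nonneg[OF assms refl L that(1)]) (rule that(2))
  qed
  then show ?thesis
    by (simp add: moment_property_def)
qed

end
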